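(* For every positive integer $n$, the variance of the random variable `size' defined on the set of $(2n+1,2n+3)$-core partitions with distinct parts (with the uniform distribution) is $$ \frac{1}{15360}\left(934n^{6}+4687n^{5}+9700n^{4}+10505n^{3}+6256n^{2}+1518n\right). $$
   Context: A partition is a non-increasing finite sequence $\lambda=(\lambda_1,\dots,\lambda_k)$, $k\ge 0$, of positive integers (the empty partition is allowed); its size is $\lambda_1+\dots+\lambda_k$, and it has distinct parts if the $\lambda_i$ are pairwise distinct. The hook length of a cell $(i,j)$, $1\le j\le\lambda_i$, of its Ferrers (Young) diagram is $\lambda_i-i+\lambda'_j-j+1$, where $\lambda'$ is the conjugate partition. A partition is an $(s,t)$-core partition if none of its hook lengths equals $s$ and none equals $t$. For $s=2n+1$, $t=2n+3$ (relatively prime) the set of $(s,t)$-core partitions is finite. If $Q_n$ is the finite set of $(2n+1,2n+3)$-core partitions with distinct parts and $\mu_n=\frac{1}{|Q_n|}\sum_{\lambda\in Q_n}\mathrm{size}(\lambda)$, the variance is $\frac{1}{|Q_n|}\sum_{\lambda\in Q_n}(\mathrm{size}(\lambda)-\mu_n)^2$. *)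

theory Defs
  imports "HOL-Probability.Probability"
begin

definition is_partition :: "nat list \<Rightarrow> bool" where
  "is_partition xs \<longleftrightarrow> sorted_wrt (\<ge>) xs \<and> (\<forall>x\<in>set xs. 0 < x)"

(* Rows and columns are numbered from 1, whereas list positions start at 0. *)
definition part :: "nat list \<Rightarrow> nat \<Rightarrow> nat" where
  "part xs i = xs ! (i - 1)"

definition conjugate_part :: "nat list \<Rightarrow> nat \<Rightarrow> nat" where
  "conjugate_part xs j = card {i \<in> {1..length xs}. j \<le> part xs i}"

definition cells :: "nat list \<Rightarrow> (nat \<times> nat) set" where
  "cells xs = {(i, j). i \<in> {1..length xs} \<and> j \<in> {1..part xs i}}"

(* This is part xs i - i + conjugate_part xs j - j + 1. It is regrouped so that the one
   subtraction on nat does not truncate: for a cell (i, j) of a partition we have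
   j \<le> part xs i and i \<le> conjugate_part xs j. *)
definition hook_length :: "nat list \<Rightarrow> nat \<times> nat \<Rightarrow> nat" where
  "hook_length xs = (\<lambda>(i, j). part xs i + conjugate_part xs j + 1 - (i + j))"

definition core_partition :: "nat \<Rightarrow> nat \<Rightarrow> nat list \<Rightarrow> bool" where
  "core_partition s t xs \<longleftrightarrow>
     is_partition xs \<and> (\<forall>c\<in>cells xs. hook_length xs c \<noteq> s \<and> hook_length xs c \<noteq> t)"

definition distinct_core_partitions :: "nat \<Rightarrow> nat \<Rightarrow> nat list set" where
  "distinct_core_partitions s t = {xs. core_partition s t xs \<and> distinct xs}"

definition partition_size :: "nat list \<Rightarrow> nat" where
  "partition_size xs = sum_list xs"

end

theory Submission
  imports Defs "HOL-Computational_Algebra.Formal_Power_Series" "HOL-Computational_Algebra.Polynomial"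
begin

text \<open>A partition is determined by the set of its first-column hook lengths. The hook lengths in a
row are the differences between the first-column hook length of that row and the smaller numbers
missing from the set, so the partition has no hook of length \<open>s\<close> exactly if the set is closed
under subtracting \<open>s\<close>, and its parts are distinct exactly if the set contains no two consecutive
numbers (\<open>bij_betw_beta\<close>). For \<open>s = 2 * n + 1\<close>, a set closed under subtracting \<open>s\<close> is described by
the numbers \<open>N r\<close> of its elements in the residue classes modulo \<open>s\<close>; closure under subtracting \<open>s
+ 2\<close> says that \<open>N (r + 2) \<le> N r + 1\<close> all the way round the circle of residues, and neighbouring
classes are never both occupied. Hence the sequence \<open>N\<close> is a word of natural numbers that climbs
by at most one at each step, also cyclically, with a zero inserted before every positive letter
(\<open>bij_betw_spread\<close>).

Sequences that climb by at most one are the level sequences of binary trees. Cutting the cyclic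
word at its zeros therefore turns a core into a tree \<open>A\<close>, a position \<open>j \<le> nodes A\<close> at which the
cycle cuts the levels of \<open>A\<close>, and a list of trees of odd length (\<open>bij_betw_config_word\<close>). The size
of the core becomes an explicit function of \<open>j\<close> and of three statistics of the trees, namely
\<open>area\<close>, \<open>sqarea\<close> and \<open>torque\<close> (\<open>word_size_config\<close>). The first two are additive. The torque enters
linearly and changes sign under reversal while everything else stays fixed, so that in the first
two moments of the size only its own second moment survives (\<open>sum_size\<close>, \<open>sum_size_square\<close>).

Splitting a tree at its root and a list at its head gives recursions for the generating functions
of the mixed moments of these statistics. Each recursion is linear in the new unknown, and all
solutions are polynomials in one power series \<open>u\<close> with \<open>1 + 2 * u = (1 - 4 * X) powr (- 1 / 2)\<close>.
The individual moments involve odd powers of \<open>1 + 2 * u\<close>, whose coefficients are central binomial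
coefficients times polynomials; in the sums that make up the moments of the size only even powers
remain. The coefficient of \<open>X ^ n\<close> in \<open>(1 + 2 * u) ^ (2 * k + 2)\<close> is \<open>4 ^ n * ((n + k) choose k)\<close>,
so both moments are \<open>4 ^ n\<close> times a polynomial in \<open>n\<close>. As there are \<open>4 ^ n\<close> cores, mean and
variance are polynomials.\<close>

section \<open>First-column hook lengths\<close>

text \<open>These are the first-column hook lengths of the partition, also known as its beta set.\<close>

fun beta :: "nat list \<Rightarrow> nat set" where
  "beta [] = {}"
| "beta (x # xs) = insert (x + length xs) (beta xs)"

lemma is_partition_Cons:
  "is_partition (x # xs) \<longleftrightarrow> 0 < x \<and> (\<forall>y\<in>set xs. y \<le> x) \<and> is_partition xs"
  by (auto simp: is_partition_def)

lemma finite_beta [simp]: "finite (beta xs)"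
  by (induction xs) auto

lemma beta_less:
  "(\<And>y. y \<in> set xs \<Longrightarrow> y \<le> x) \<Longrightarrow> z \<in> beta xs \<Longrightarrow> z < x + length xs"
proof (induction xs)
  case (Cons y ys)
  have "y \<le> x" using Cons.prems(1) by simp
  from Cons.prems(2) consider "z = y + length ys" | "z \<in> beta ys" by auto
  then show ?case
  proof cases
    case 1
    then show ?thesis using \<open>y \<le> x\<close> by simp
  next
    case 2
    then have "z < x + length ys" using Cons.IH Cons.prems(1) by simp
    then show ?thesis by simp
  qed
qed simp

lemma top_notin_beta:
  assumes "is_partition (x # xs)"
  shows "x + length xs \<notin> beta xs"
  using beta_less[of xs x "x + length xs"] assms by (auto simp: is_partition_Cons)

lemma card_beta: "is_partition xs \<Longrightarrow> card (beta xs) = length xs"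
proof (induction xs)
  case (Cons x xs)
  then show ?case using top_notin_beta[OF Cons.prems] by (simp add: is_partition_Cons)
qed simp

lemma zero_notin_beta: "is_partition xs \<Longrightarrow> 0 \<notin> beta xs"
  by (induction xs) (auto simp: is_partition_Cons)

lemma conjugate_part_eq: "conjugate_part xs j = length (filter (\<lambda>y. j \<le> y) xs)"
proof -
  have "{i \<in> {1..length xs}. j \<le> part xs i} = Suc ` {i. i < length xs \<and> j \<le> xs ! i}"
    by (force simp: part_def image_iff Suc_le_eq gr0_conv_Suc)
  then show ?thesis
    unfolding conjugate_part_def by (simp add: card_image length_filter_conv_card)
qed

lemma cells_Cons:
  "cells (x # xs) = Pair 1 ` {1..x} \<union> (\<lambda>(i, j). (Suc i, j)) ` cells xs"
proof (rule set_eqI, clarify)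
  fix i j
  show "(i, j) \<in> cells (x # xs) \<longleftrightarrow>
    (i, j) \<in> Pair 1 ` {1..x} \<union> (\<lambda>(i, j). (Suc i, j)) ` cells xs"
  proof (cases i)
    case (Suc k)
    then show ?thesis
      by (cases k) (auto simp: cells_def part_def image_iff)
  qed (auto simp: cells_def)
qed

lemma hook_length_tail:
  assumes "is_partition (x # xs)" "(i, j) \<in> cells xs"
  shows "hook_length (x # xs) (Suc i, j) = hook_length xs (i, j)"
proof -
  have i: "1 \<le> i" "i \<le> length xs" "j \<le> part xs i" using assms(2) by (auto simp: cells_def)
  then have "xs ! (i - 1) \<in> set xs" by (intro nth_mem) simp
  then have "part xs i \<le> x" using assms(1) by (simp add: is_partition_Cons part_def)
  with i have "j \<le> x" by simp
  moreover have "part (x # xs) (Suc i) = part xs i" using i by (cases i) (auto simp: part_def)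
  ultimately show ?thesis by (simp add: hook_length_def conjugate_part_eq)
qed

text \<open>Read the boundary of the diagram as a lattice path whose steps are numbered from 0. Its
vertical steps sit at the elements of the beta set, and \<open>gap xs j\<close> is the number of its \<open>j\<close>-th
horizontal step.\<close>

definition gap :: "nat list \<Rightarrow> nat \<Rightarrow> nat" where
  "gap xs j = (j - 1) + length (filter (\<lambda>y. y < j) xs)"

lemma gap_notin_beta:
  assumes "is_partition xs" "1 \<le> j"
  shows "gap xs j \<notin> beta xs"
  using assms
proof (induction xs)
  case (Cons y ys)
  then have p: "\<And>z. z \<in> set ys \<Longrightarrow> z \<le> y" "is_partition ys" by (auto simp: is_partition_Cons)
  show ?case
  proof (cases "y < j")
    case True
    then have "\<And>z. z \<in> set (y # ys) \<Longrightarrow> z < j" using p(1) by force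
    then have f: "filter (\<lambda>z. z < j) (y # ys) = y # ys" by (simp add: filter_id_conv)
    have le: "\<And>z. z \<in> set (y # ys) \<Longrightarrow> z \<le> j - 1"
      using \<open>\<And>z. z \<in> set (y # ys) \<Longrightarrow> z < j\<close> by fastforce
    have "\<forall>z \<in> beta (y # ys). z < j - 1 + length (y # ys)"
      using beta_less[OF le] by blast
    then show ?thesis unfolding gap_def f by blast
  next
    case False
    have "length (filter (\<lambda>z. z < j) ys) \<le> length ys" by simp
    then have "gap ys j < y + length ys" using False Cons.prems(2) unfolding gap_def by linarith
    moreover have "gap (y # ys) j = gap ys j" using False by (simp add: gap_def)
    ultimately show ?thesis using Cons.IH p(2) Cons.prems(2) by auto
  qed
qed simp

text \<open>The gaps grow strictly with \<open>j\<close> and avoid the beta set, and there are \<open>x\<close> of them, which is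
exactly the number of places that the beta set leaves free below the top first-column hook length.\<close>

lemma gap_image:
  assumes "is_partition (x # xs)"
  shows "gap xs ` {1..x} = {..<x + length xs} - beta xs"
proof (rule card_subset_eq)
  have p: "\<And>z. z \<in> set xs \<Longrightarrow> z \<le> x" "is_partition xs" using assms by (auto simp: is_partition_Cons)
  show "finite ({..<x + length xs} - beta xs)" by simp
  show "gap xs ` {1..x} \<subseteq> {..<x + length xs} - beta xs"
  proof (clarsimp simp: gap_notin_beta[OF p(2)])
    fix j assume "Suc 0 \<le> j" "j \<le> x"
    moreover have "length (filter (\<lambda>z. z < j) xs) \<le> length xs" by simp
    ultimately show "gap xs j < x + length xs" unfolding gap_def by linarith
  qed
  have mono: "gap xs i < gap xs j" if "1 \<le> i" "i < j" for i j
  proof -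
    have "length (filter (\<lambda>z. z < i) xs) \<le> length (filter (\<lambda>z. z < j) xs)"
      using that by (induction xs) auto
    then show ?thesis using that unfolding gap_def by linarith
  qed
  have "inj_on (gap xs) {1..x}"
    by (rule linorder_inj_onI) (use mono in fastforce)+
  then have "card (gap xs ` {1..x}) = x" by (simp add: card_image)
  also have "x = card {..<x + length xs} - card (beta xs)" using card_beta[OF p(2)] by simp
  also have "\<dots> = card ({..<x + length xs} - beta xs)"
    by (rule card_Diff_subset[symmetric]) (use beta_less[OF p(1)] in auto)
  finally show "card (gap xs ` {1..x}) = card ({..<x + length xs} - beta xs)" .
qed

lemma hook_length_top:
  assumes "is_partition (x # xs)" "j \<in> {1..x}"
  shows "hook_length (x # xs) (1, j) = x + length xs - gap xs j"
proof -
  have "length (filter (\<lambda>y. y < j) xs) + length (filter (\<lambda>y. j \<le> y) xs) = length xs"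
    using sum_length_filter_compl[of "\<lambda>y. y < j" xs] by (simp add: not_less)
  then show ?thesis
    using assms(2) by (auto simp: hook_length_def part_def conjugate_part_eq gap_def)
qed

text \<open>By \<open>gap_image\<close> the hook lengths in the top row are the distances from its first-column hook
length down to the numbers missing from the beta set, and removing the top row changes no other
hook length.\<close>

lemma no_hook_iff_beta:
  assumes "is_partition xs" "0 < s"
  shows "(\<forall>c\<in>cells xs. hook_length xs c \<noteq> s) \<longleftrightarrow> (\<forall>z\<in>beta xs. s \<le> z \<longrightarrow> z - s \<in> beta xs)"
  using assms(1)
proof (induction xs)
  case Nil
  then show ?case by (auto simp: cells_def)
next
  case (Cons x xs)
  let ?X = "x + length xs"
  have p: "\<And>z. z \<in> set xs \<Longrightarrow> z \<le> x" "is_partition xs"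
    using Cons.prems by (auto simp: is_partition_Cons)
  have lt: "\<And>z. z \<in> beta xs \<Longrightarrow> z < ?X" using beta_less[OF p(1)] .
  have top: "(\<forall>j\<in>{1..x}. hook_length (x # xs) (1, j) \<noteq> s) \<longleftrightarrow> (s \<le> ?X \<longrightarrow> ?X - s \<in> beta xs)"
  proof -
    have "(\<forall>j\<in>{1..x}. hook_length (x # xs) (1, j) \<noteq> s) \<longleftrightarrow> (\<forall>g\<in>gap xs ` {1..x}. ?X - g \<noteq> s)"
      using hook_length_top[OF Cons.prems] by auto
    also have "\<dots> \<longleftrightarrow> (\<forall>g<?X. g \<notin> beta xs \<longrightarrow> ?X - g \<noteq> s)"
      unfolding gap_image[OF Cons.prems] by auto
    also have "\<dots> \<longleftrightarrow> (s \<le> ?X \<longrightarrow> ?X - s \<in> beta xs)"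
      using \<open>0 < s\<close> by (smt (verit) diff_diff_cancel diff_le_self diff_less le_add_diff_inverse2
          le_neq_implies_less less_imp_le_nat nless_le zero_less_diff add_diff_cancel_left')
    finally show ?thesis .
  qed
  have tail: "(\<forall>c\<in>cells xs. hook_length (x # xs) (case c of (i, j) \<Rightarrow> (Suc i, j)) \<noteq> s)
      \<longleftrightarrow> (\<forall>c\<in>cells xs. hook_length xs c \<noteq> s)"
    using hook_length_tail[OF Cons.prems] by fastforce
  have "(\<forall>c\<in>cells (x # xs). hook_length (x # xs) c \<noteq> s) \<longleftrightarrow>
      (s \<le> ?X \<longrightarrow> ?X - s \<in> beta xs) \<and> (\<forall>z\<in>beta xs. s \<le> z \<longrightarrow> z - s \<in> beta xs)"
    unfolding cells_Cons ball_Un ball_simps using top tail Cons.IH[OF p(2)] by auto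
  also have "\<dots> \<longleftrightarrow> (\<forall>z\<in>beta (x # xs). s \<le> z \<longrightarrow> z - s \<in> beta (x # xs))"
    using lt \<open>0 < s\<close> by fastforce
  finally show ?case .
qed

text \<open>Two neighbouring rows are equal exactly if their first-column hook lengths are consecutive.\<close>

lemma distinct_iff_beta:
  assumes "is_partition xs"
  shows "distinct xs \<longleftrightarrow> (\<forall>z\<in>beta xs. Suc z \<notin> beta xs)"
  using assms
proof (induction xs)
  case (Cons x xs)
  let ?X = "x + length xs"
  have p: "\<And>z. z \<in> set xs \<Longrightarrow> z \<le> x" "is_partition xs"
    using Cons.prems by (auto simp: is_partition_Cons)
  have lt: "\<And>z. z \<in> beta xs \<Longrightarrow> z < ?X" using beta_less[OF p(1)] .
  have top: "x \<in> set xs \<longleftrightarrow> (\<exists>z\<in>beta xs. Suc z = ?X)"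
  proof
    assume "x \<in> set xs"
    then obtain ys where ys: "xs = x # ys"
      using p by (cases xs) (force simp: is_partition_Cons)+
    then show "\<exists>z\<in>beta xs. Suc z = ?X" by simp
  next
    assume "\<exists>z\<in>beta xs. Suc z = ?X"
    then obtain z where z: "z \<in> beta xs" "Suc z = ?X" by blast
    show "x \<in> set xs"
    proof (rule ccontr)
      assume "x \<notin> set xs"
      then have "\<And>y. y \<in> set xs \<Longrightarrow> y \<le> x - 1" using p(1)
        by (metis One_nat_def Suc_leI Suc_pred le_neq_implies_less less_imp_Suc_add not_less_eq_eq
            zero_less_Suc)
      then have "z < x - 1 + length xs" using beta_less z(1) by blast
      moreover have "1 \<le> x" using Cons.prems by (simp add: is_partition_Cons)
      ultimately show False using z(2) by simp
    qed
  qed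
  have "Suc ?X \<notin> beta xs" using lt by force
  then show ?case using Cons.IH[OF p(2)] top by auto
qed simp

lemma Max_beta: "is_partition (x # xs) \<Longrightarrow> Max (beta (x # xs)) = x + length xs"
  using beta_less[of xs x] by (intro Max_eqI) (auto simp: is_partition_Cons less_imp_le)

lemma inj_on_beta: "inj_on beta {xs. is_partition xs}"
proof (rule inj_onI, clarify)
  fix xs ys assume "is_partition xs" "is_partition ys" "beta xs = beta ys"
  then show "xs = ys"
  proof (induction xs arbitrary: ys)
    case Nil
    then show ?case by (cases ys) auto
  next
    case (Cons x xs)
    then obtain y ys' where ys: "ys = y # ys'" by (cases ys) auto
    have len: "length xs = length ys'"
      using card_beta[OF Cons.prems(1)] card_beta[OF Cons.prems(2)] Cons.prems(3) ys by simp
    have "x + length xs = y + length ys'"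
      using Max_beta[OF Cons.prems(1)] Max_beta[of y ys'] Cons.prems ys by simp
    then have "x = y" using len by simp
    moreover have "beta xs = beta ys'"
      using Cons.prems top_notin_beta[OF Cons.prems(1)] top_notin_beta[of y ys'] ys
        \<open>x + length xs = y + length ys'\<close> by (metis beta.simps(2) insert_ident)
    ultimately show ?case using Cons.IH[of ys'] Cons.prems ys by (auto simp: is_partition_Cons)
  qed
qed

text \<open>The largest element must come from the top row; the length of that row is the largest
element minus the number of the remaining elements.\<close>

lemma beta_surj: "finite S \<Longrightarrow> 0 \<notin> S \<Longrightarrow> \<exists>xs. is_partition xs \<and> beta xs = S"
proof (induction "card S" arbitrary: S)
  case 0
  then show ?case by (intro exI[of _ "[]"]) (auto simp: is_partition_def)
next
  case (Suc k)
  then have ne: "S \<noteq> {}" by auto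
  let ?S = "S - {Max S}"
  have "card ?S = k" using Suc ne by simp
  then obtain xs where xs: "is_partition xs" "beta xs = ?S"
    using Suc.hyps(1)[of ?S] Suc.prems by auto
  have len: "length xs = k" using card_beta[OF xs(1)] xs(2) \<open>card ?S = k\<close> by simp
  have "S \<subseteq> {1..Max S}" using Suc.prems by (auto simp: Suc_le_eq intro: gr0I)
  from card_mono[OF _ this] have k: "k < Max S" using Suc.hyps(2) by simp
  have "y \<le> Max S - k" if "y \<in> set xs" for y
  proof -
    obtain z zs where zs: "xs = z # zs" using \<open>y \<in> set xs\<close> by (cases xs) auto
    have "z + length zs \<in> ?S" using zs xs(2) by auto
    then have "z + length zs < Max S" using Suc.prems(1)
        by (metis DiffD1 DiffD2 Max.coboundedI le_neq_implies_less singletonI)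
    moreover have "y \<le> z" using that xs(1) zs by (auto simp: is_partition_Cons)
    ultimately show ?thesis using len zs by simp
  qed
  then have "is_partition ((Max S - k) # xs)" using xs(1) k by (simp add: is_partition_Cons)
  moreover have "beta ((Max S - k) # xs) = S"
    using xs(2) len k ne Suc.prems(1) by (auto simp: insert_absorb)
  ultimately show ?case by blast
qed

lemma partition_size_beta:
  assumes "is_partition xs"
  shows "real (partition_size xs) =
    (\<Sum>z\<in>beta xs. real z) - real (card (beta xs)) * (real (card (beta xs)) - 1) / 2"
  using assms
proof (induction xs)
  case Nil
  then show ?case by (simp add: partition_size_def)
next
  case (Cons x xs)
  then have p: "is_partition xs" by (simp add: is_partition_Cons)
  show ?case
    using Cons.IH[OF p] top_notin_beta[OF Cons.prems] card_beta[OF p]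
    by (simp add: partition_size_def field_simps)
qed

definition core_sets :: "nat \<Rightarrow> nat \<Rightarrow> nat set set" where
  "core_sets s t = {S. finite S \<and> 0 \<notin> S \<and> (\<forall>z\<in>S. s \<le> z \<longrightarrow> z - s \<in> S) \<and>
     (\<forall>z\<in>S. t \<le> z \<longrightarrow> z - t \<in> S) \<and> (\<forall>z\<in>S. Suc z \<notin> S)}"

lemma bij_betw_beta:
  assumes "0 < s" "0 < t"
  shows "bij_betw beta (distinct_core_partitions s t) (core_sets s t)"
proof (rule bij_betw_imageI)
  have eq: "xs \<in> distinct_core_partitions s t \<longleftrightarrow> is_partition xs \<and> beta xs \<in> core_sets s t" for xs
  proof (cases "is_partition xs")
    case True
    then show ?thesis
      using no_hook_iff_beta[OF True assms(1)] no_hook_iff_beta[OF True assms(2)]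
        distinct_iff_beta[OF True] zero_notin_beta[OF True]
      by (auto simp: distinct_core_partitions_def core_partition_def core_sets_def)
  qed (simp add: distinct_core_partitions_def core_partition_def)
  show "inj_on beta (distinct_core_partitions s t)"
    by (rule inj_on_subset[OF inj_on_beta]) (auto simp: eq)
  show "beta ` distinct_core_partitions s t = core_sets s t"
  proof
    show "core_sets s t \<subseteq> beta ` distinct_core_partitions s t"
    proof
      fix S assume S: "S \<in> core_sets s t"
      then obtain xs where "is_partition xs" "beta xs = S"
        using beta_surj[of S] by (auto simp: core_sets_def)
      then show "S \<in> beta ` distinct_core_partitions s t" using S eq by blast
    qed
  qed (auto simp: eq)
qed

section \<open>Core sets on the abacus\<close>

text \<open>An abacus with \<open>s\<close> runners: the beads on runner \<open>r\<close> occupy the lowest \<open>N ! r\<close> places \<open>r, r +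
s, r + 2 * s\<close> and so on.\<close>

definition runner_set :: "nat \<Rightarrow> nat list \<Rightarrow> nat set" where
  "runner_set s N = (\<lambda>(r, k). r + k * s) ` (SIGMA r:{..<s}. {..<N ! r})"

lemma mem_runner_set:
  assumes "0 < s"
  shows "z \<in> runner_set s N \<longleftrightarrow> z div s < N ! (z mod s)"
proof
  assume "z \<in> runner_set s N"
  then show "z div s < N ! (z mod s)" by (auto simp: runner_set_def)
next
  assume *: "z div s < N ! (z mod s)"
  show "z \<in> runner_set s N" unfolding runner_set_def
    by (rule image_eqI[of _ _ "(z mod s, z div s)"]) (use assms * in auto)
qed

lemma mem_runner_set_pair:
  assumes "r < s"
  shows "r + k * s \<in> runner_set s N \<longleftrightarrow> k < N ! r"
  using assms by (subst mem_runner_set) auto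

lemma inj_on_runner_pair: "inj_on (\<lambda>(r, k). r + k * s) (SIGMA r:{..<s}. K r)" for s :: nat
proof (rule inj_onI, clarsimp)
  fix r k r' k' :: nat
  assume *: "r < s" "r' < s" "r + k * s = r' + k' * s"
  then have "(r + k * s) mod s = (r' + k' * s) mod s" by simp
  moreover have "(r + k * s) mod s = r" "(r' + k' * s) mod s = r'" using *(1,2) by simp_all
  ultimately have "r = r'" by simp
  then show "r = r' \<and> k = k'" using * by auto
qed

lemma finite_runner_set [simp]: "finite (runner_set s N)"
  by (auto simp: runner_set_def)

lemma sum_runner_set:
  "(\<Sum>z\<in>runner_set s N. f z) = (\<Sum>r<s. \<Sum>k<N ! r. f (r + k * s))"
  unfolding runner_set_def
  by (subst sum.reindex[OF inj_on_runner_pair]) (simp add: sum.Sigma split_def)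

lemma downward_closed_lessThan:
  fixes K :: "nat set"
  assumes "finite K" "\<And>k. Suc k \<in> K \<Longrightarrow> k \<in> K"
  shows "\<exists>m. K = {..<m}"
proof (cases "K = {}")
  case False
  have down: "k + i \<in> K \<Longrightarrow> k \<in> K" for k i
    by (induction i) (auto dest: assms(2))
  have "Max K \<in> K" using assms(1) False by simp
  then have "k \<in> K" if "k \<le> Max K" for k
    using down[of k "Max K - k"] that by simp
  moreover have "k \<le> Max K" if "k \<in> K" for k using assms(1) that by simp
  ultimately have "K = {..<Suc (Max K)}" unfolding lessThan_Suc_atMost by blast
  then show ?thesis by blast
qed auto

lemma runner_set_surj:
  assumes "finite S" "0 < s" "\<And>z. z \<in> S \<Longrightarrow> s \<le> z \<Longrightarrow> z - s \<in> S"
  shows "\<exists>N. length N = s \<and> runner_set s N = S"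
proof -
  let ?K = "\<lambda>r. {k. r + k * s \<in> S}"
  have "\<exists>m. ?K r = {..<m}" for r
  proof -
    have fin: "finite (?K r)"
      by (rule finite_subset[OF _ assms(1)[THEN finite_vimageI[of _ "\<lambda>k. r + k * s"]]])
        (use assms(2) in \<open>auto simp: inj_def\<close>)
    show ?thesis
      by (rule downward_closed_lessThan[OF fin]) (use assms(3)[of "r + Suc _ * s"] in auto)
  qed
  then obtain m where m: "\<And>r. ?K r = {..<m r}" by metis
  have "z \<in> runner_set s (map m [0..<s]) \<longleftrightarrow> z \<in> S" for z
  proof -
    have "z \<in> runner_set s (map m [0..<s]) \<longleftrightarrow> z div s \<in> ?K (z mod s)"
      unfolding m using assms(2) by (simp add: mem_runner_set)
    then show ?thesis by simp
  qed
  then show ?thesis by (intro exI[of _ "map m [0..<s]"]) auto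
qed

lemma inj_on_runner_set: "inj_on (runner_set s) {N. length N = s}"
proof (rule inj_onI, clarify)
  fix N M assume *: "runner_set (length N) N = runner_set (length N) M" "length M = length N"
  show "N = M"
  proof (rule nth_equalityI)
    fix r assume "r < length N"
    then have "k < N ! r \<longleftrightarrow> k < M ! r" for k using *(1) mem_runner_set_pair by blast
    then show "N ! r = M ! r" by (metis linorder_neqE_nat less_irrefl)
  qed (use * in simp)
qed

text \<open>The last condition is the increment condition \<open>N (r + 2) \<le> N r + 1\<close> across the end of the
list. Residue \<open>2 * n + 2\<close> is the same as residue \<open>1\<close> one place higher up, which is why the bound
is 2.\<close>

definition runner_counts :: "nat \<Rightarrow> nat list set" where
  "runner_counts n = {N. length N = 2 * n + 1 \<and> N ! 0 = 0 \<and>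
     (\<forall>r. r + 2 < length N \<longrightarrow> N ! (r + 2) \<le> N ! r + 1) \<and>
     (\<forall>r. r + 1 < length N \<longrightarrow> N ! r = 0 \<or> N ! (r + 1) = 0) \<and>
     N ! 1 \<le> N ! (2 * n) + 2}"

lemma all_less_shift: "(\<forall>k<a. c \<le> k \<longrightarrow> k - c < m) \<longleftrightarrow> a \<le> m + c" for a c m :: nat
proof
  assume *: "\<forall>k<a. c \<le> k \<longrightarrow> k - c < m"
  show "a \<le> m + c" using *[rule_format, of "m + c"] by (rule_tac ccontr) simp
qed auto

text \<open>Subtracting \<open>s + 2\<close> moves a bead two runners back and one place down; from runner 1 it goes
to runner \<open>s - 1\<close> and two places down. Two consecutive numbers are beads side by side on
neighbouring runners, and since beads are pushed down there are then also two such beads in the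
lowest places.\<close>

lemma runner_set_core_iff:
  assumes "length N = 2 * n + 1" "1 \<le> n"
  shows "runner_set (2 * n + 1) N \<in> core_sets (2 * n + 1) (2 * n + 3) \<longleftrightarrow> N \<in> runner_counts n"
proof -
  define s where "s = 2 * n + 1"
  let ?S = "runner_set s N"
  have s: "0 < s" "2 * n + 3 = s + 2" "length N = s" "2 < s"
    using assms by (auto simp: s_def)
  note mem = mem_runner_set_pair[of _ s _ N]
  have ball: "(\<forall>z\<in>?S. P z) \<longleftrightarrow> (\<forall>r<s. \<forall>k<N ! r. P (r + k * s))" for P
    by (auto simp: runner_set_def)
  have zero: "0 \<notin> ?S \<longleftrightarrow> N ! 0 = 0" using mem[of 0 0] s by simp
  have s_closed: "\<forall>z\<in>?S. s \<le> z \<longrightarrow> z - s \<in> ?S"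
  proof (unfold ball, intro allI impI)
    fix r k assume *: "r < s" "k < N ! r" "s \<le> r + k * s"
    then obtain k' where "k = Suc k'" by (cases k) auto
    then show "r + k * s - s \<in> ?S" using mem[of r k'] * by simp
  qed
  have t_closed: "(\<forall>z\<in>?S. s + 2 \<le> z \<longrightarrow> z - (s + 2) \<in> ?S) \<longleftrightarrow>
      (\<forall>r. r + 2 < s \<longrightarrow> N ! (r + 2) \<le> N ! r + 1) \<and> N ! 1 \<le> N ! (s - 1) + 2"
    if z: "N ! 0 = 0"
  proof -
    have "(\<forall>z\<in>?S. s + 2 \<le> z \<longrightarrow> z - (s + 2) \<in> ?S) \<longleftrightarrow>
       (\<forall>r<s. \<forall>k<N ! r. s + 2 \<le> r + k * s \<longrightarrow> r + k * s - (s + 2) \<in> ?S)" by (rule ball)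
    also have "\<dots> \<longleftrightarrow> (\<forall>r<s. r = 0 \<or> r = 1 \<and> N ! 1 \<le> N ! (s - 1) + 2
        \<or> 2 \<le> r \<and> N ! r \<le> N ! (r - 2) + 1)"
    proof (intro all_cong1 imp_cong refl)
      fix r assume "r < s"
      consider "r = 0" | "r = 1" | "2 \<le> r" by linarith
      then show "(\<forall>k<N ! r. s + 2 \<le> r + k * s \<longrightarrow> r + k * s - (s + 2) \<in> ?S) \<longleftrightarrow>
        (r = 0 \<or> r = 1 \<and> N ! 1 \<le> N ! (s - 1) + 2 \<or> 2 \<le> r \<and> N ! r \<le> N ! (r - 2) + 1)"
      proof cases
        case 1
        then show ?thesis using z by simp
      next
        case 2
        have A: "s + 2 \<le> r + k * s \<longleftrightarrow> 2 \<le> k" for k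
        proof (cases "2 \<le> k")
          case True
          then obtain m where "k = 2 + m" using le_Suc_ex[OF True] by blast
          then show ?thesis using 2 s by (simp add: add_mult_distrib)
        next
          case False
          then have "k * s \<le> 1 * s" by (intro mult_right_mono) simp_all
          then have "\<not> s + 2 \<le> r + k * s" unfolding 2 by linarith
          then show ?thesis using False by blast
        qed
        have B: "r + k * s - (s + 2) = (s - 1) + (k - 2) * s" if k2: "2 \<le> k" for k
        proof -
          obtain m where "k = 2 + m" using le_Suc_ex[OF k2] by blast
          then show ?thesis using 2 s by (simp add: add_mult_distrib)
        qed
        have "(\<forall>k<N ! r. s + 2 \<le> r + k * s \<longrightarrow> r + k * s - (s + 2) \<in> ?S) \<longleftrightarrow>
            (\<forall>k<N ! 1. 2 \<le> k \<longrightarrow> k - 2 < N ! (s - 1))"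
          unfolding A using B mem[of "s - 1"] s 2 by auto
        also have "\<dots> \<longleftrightarrow> N ! 1 \<le> N ! (s - 1) + 2"
          by (rule all_less_shift)
        finally show ?thesis using 2 by simp
      next
        case 3
        have A: "s + 2 \<le> r + k * s \<longleftrightarrow> 1 \<le> k" for k
        proof (cases k)
          case 0
          then show ?thesis using \<open>r < s\<close> by simp
        qed (use 3 in simp)
        have B: "r + k * s - (s + 2) = (r - 2) + (k - 1) * s" if k1: "1 \<le> k" for k
        proof -
          obtain m where "k = Suc m" using k1 by (cases k) auto
          then show ?thesis using 3 by simp
        qed
        have "(\<forall>k<N ! r. s + 2 \<le> r + k * s \<longrightarrow> r + k * s - (s + 2) \<in> ?S) \<longleftrightarrow>
            (\<forall>k<N ! r. 1 \<le> k \<longrightarrow> k - 1 < N ! (r - 2))"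
          unfolding A using B mem[of "r - 2"] \<open>r < s\<close> by auto
        also have "\<dots> \<longleftrightarrow> N ! r \<le> N ! (r - 2) + 1"
          by (rule all_less_shift)
        finally show ?thesis using 3 by simp
      qed
    qed
    also have "\<dots> \<longleftrightarrow> (\<forall>r. r + 2 < s \<longrightarrow> N ! (r + 2) \<le> N ! r + 1) \<and> N ! 1 \<le> N ! (s - 1) + 2"
      (is "(\<forall>r<s. ?P r) \<longleftrightarrow> ?Q")
    proof
      assume *: "\<forall>r<s. ?P r"
      then show ?Q using *[rule_format, of 1] *[rule_format, of "_ + 2"] s by fastforce
    next
      assume *: ?Q
      show "\<forall>r<s. ?P r"
      proof (intro allI impI)
        fix r assume "r < s"
        show "?P r"
        proof (cases "2 \<le> r")
          case True
          then have "r - 2 + 2 = r" by simp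
          then show ?thesis using conjunct1[OF *, rule_format, of "r - 2"] \<open>r < s\<close> True by simp
        next
          case False
          then have "r = 0 \<or> r = 1" by auto
          then show ?thesis using * by blast
        qed
      qed
    qed
    finally show ?thesis .
  qed
  have consec: "(\<forall>z\<in>?S. Suc z \<notin> ?S) \<longleftrightarrow> (\<forall>r. r + 1 < s \<longrightarrow> N ! r = 0 \<or> N ! (r + 1) = 0)"
    if z: "N ! 0 = 0"
  proof
    assume *: "\<forall>z\<in>?S. Suc z \<notin> ?S"
    show "\<forall>r. r + 1 < s \<longrightarrow> N ! r = 0 \<or> N ! (r + 1) = 0"
    proof (intro allI impI)
      fix r assume "r + 1 < s"
      then show "N ! r = 0 \<or> N ! (r + 1) = 0"
        using *[rule_format, of r] mem[of r 0] mem[of "r + 1" 0] by auto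
    qed
  next
    assume *: "\<forall>r. r + 1 < s \<longrightarrow> N ! r = 0 \<or> N ! (r + 1) = 0"
    show "\<forall>z\<in>?S. Suc z \<notin> ?S"
    proof (unfold ball, intro allI impI)
      fix r k assume rk: "r < s" "k < N ! r"
      show "Suc (r + k * s) \<notin> ?S"
      proof (cases "r + 1 < s")
        case True
        then show ?thesis using mem[of "r + 1" k] * rk by auto
      next
        case False
        then have "Suc (r + k * s) = 0 + Suc k * s" using rk by simp
        then show ?thesis using mem[of 0 "Suc k"] s z by (metis not_less_zero)
      qed
    qed
  qed
  have counts: "N \<in> runner_counts n \<longleftrightarrow> N ! 0 = 0 \<and>
     (\<forall>r. r + 2 < s \<longrightarrow> N ! (r + 2) \<le> N ! r + 1) \<and>
     (\<forall>r. r + 1 < s \<longrightarrow> N ! r = 0 \<or> N ! (r + 1) = 0) \<and> N ! 1 \<le> N ! (s - 1) + 2"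
    using s(3) unfolding runner_counts_def by (simp only: mem_Collect_eq) (simp add: s_def)
  show ?thesis
  proof (cases "N ! 0 = 0")
    case True
    show ?thesis
      unfolding counts s(2) s_def[symmetric] core_sets_def mem_Collect_eq zero
        t_closed[OF True] consec[OF True]
      using s_closed finite_runner_set[of s N] by argo
  next
    case False
    then show ?thesis
      unfolding counts s(2) s_def[symmetric] core_sets_def mem_Collect_eq zero by blast
  qed
qed

lemma bij_betw_runner_set:
  assumes "1 \<le> n"
  shows "bij_betw (runner_set (2 * n + 1)) (runner_counts n) (core_sets (2 * n + 1) (2 * n + 3))"
proof (rule bij_betw_imageI)
  show "inj_on (runner_set (2 * n + 1)) (runner_counts n)"
    by (rule inj_on_subset[OF inj_on_runner_set]) (auto simp: runner_counts_def)
  show "runner_set (2 * n + 1) ` runner_counts n = core_sets (2 * n + 1) (2 * n + 3)"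
  proof
    show "runner_set (2 * n + 1) ` runner_counts n \<subseteq> core_sets (2 * n + 1) (2 * n + 3)"
      using runner_set_core_iff[OF _ assms] by (auto simp: runner_counts_def)
    show "core_sets (2 * n + 1) (2 * n + 3) \<subseteq> runner_set (2 * n + 1) ` runner_counts n"
    proof
      fix S assume S: "S \<in> core_sets (2 * n + 1) (2 * n + 3)"
      then obtain N where N: "length N = 2 * n + 1" "runner_set (2 * n + 1) N = S"
        using runner_set_surj[of S "2 * n + 1"] by (auto simp: core_sets_def)
      then show "S \<in> runner_set (2 * n + 1) ` runner_counts n"
        using runner_set_core_iff[OF N(1) assms] S by blast
    qed
  qed
qed

text \<open>Positions are numbered from 0, so prepending an entry moves every other entry one position
further.\<close>

fun first_moment :: "nat list \<Rightarrow> real" where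
  "first_moment [] = 0"
| "first_moment (x # xs) = first_moment xs + real (sum_list xs)"

lemma first_moment_eq: "first_moment N = (\<Sum>r<length N. real r * real (N ! r))"
proof (induction N)
  case (Cons x N)
  have "real (sum_list N) = (\<Sum>r<length N. real (N ! r))"
    by (simp add: sum_list_sum_nth atLeast0LessThan)
  then show ?case using Cons
    by (simp add: sum.lessThan_Suc_shift sum.distrib algebra_simps del: sum.lessThan_Suc)
qed simp

lemma first_moment_append:
  "first_moment (xs @ ys) = first_moment xs + first_moment ys + real (length xs) * real (sum_list ys)"
  by (induction xs) (auto simp: algebra_simps)

definition sum_squares :: "nat list \<Rightarrow> real" where
  "sum_squares xs = (\<Sum>x\<leftarrow>xs. (real x)\<^sup>2)"

lemma sum_arith: "(\<Sum>k<m. real (r + k * s)) = real r * real m + real s * (real m * (real m - 1) / 2)"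
  by (induction m) (auto simp: field_simps)

text \<open>The elements on a runner form an arithmetic progression. Subtracting the sum of the numbers
\<open>0, 1, 2\<close> and so on up to the number of rows minus one turns the sum of the first-column hook
lengths into the size; this makes the coefficient of the sum of \<open>N\<close> equal to \<open>- n\<close>.\<close>

lemma partition_size_runner:
  assumes "xs \<in> distinct_core_partitions s t" "beta xs = runner_set s N" "length N = s"
    "s = 2 * n + 1"
  shows "real (partition_size xs) = real s / 2 * sum_squares N - (real (sum_list N))\<^sup>2 / 2
     + first_moment N - real n * real (sum_list N)"
proof -
  have p: "is_partition xs" using assms(1)
    by (simp add: distinct_core_partitions_def core_partition_def)
  have T: "real (sum_list N) = (\<Sum>r<s. real (N ! r))"
    using assms(3) by (simp add: sum_list_sum_nth atLeast0LessThan)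
  have Y: "sum_squares N = (\<Sum>r<s. (real (N ! r))\<^sup>2)"
    using assms(3) by (simp add: sum_squares_def sum_list_sum_nth atLeast0LessThan)
  have "real (card (beta xs)) = (\<Sum>z\<in>runner_set s N. 1)" using assms(2) by simp
  also have "\<dots> = real (sum_list N)" by (subst sum_runner_set) (simp add: T)
  finally have c: "real (card (beta xs)) = real (sum_list N)" .
  have "(\<Sum>z\<in>beta xs. real z) = (\<Sum>r<s. \<Sum>k<N ! r. real (r + k * s))"
    unfolding assms(2) by (rule sum_runner_set)
  also have "\<dots> = (\<Sum>r<s. real r * real (N ! r) + real s / 2 * ((real (N ! r))\<^sup>2 - real (N ! r)))"
    unfolding sum_arith by (simp add: power2_eq_square algebra_simps diff_divide_distrib)
  also have "\<dots> = first_moment N + real s / 2 * (sum_squares N - real (sum_list N))"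
    unfolding first_moment_eq assms(3) T Y sum.distrib
    by (simp only: sum_distrib_left[symmetric] sum_subtractf)
  finally show ?thesis
    using partition_size_beta[OF p] unfolding c assms(4) by (simp add: field_simps power2_eq_square)
qed

section \<open>Climbing words\<close>

text \<open>Inserting a zero before every positive letter produces precisely the empty list and the
lists that start with 0 and have no two adjacent positive entries.\<close>

fun spread :: "nat list \<Rightarrow> nat list" where
  "spread [] = []"
| "spread (x # w) = (if x = 0 then 0 # spread w else 0 # x # spread w)"

text \<open>The parameter is a virtual letter in front of the word.\<close>

fun climbs :: "nat \<Rightarrow> nat list \<Rightarrow> bool" where
  "climbs p [] = True"
| "climbs p (x # xs) = (x \<le> p + 1 \<and> climbs x xs)"

text \<open>The virtual letter \<open>last w + 1\<close> in front makes the climbing condition cyclic: going round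
the circle of residues once lowers the count of beads by one.\<close>

definition core_words :: "nat \<Rightarrow> nat list set" where
  "core_words n = {w. w \<noteq> [] \<and> climbs (last w + 1) w \<and> length (spread w) = 2 * n + 1}"

lemma spread_append: "spread (xs @ ys) = spread xs @ spread ys"
  by (induction xs) auto

lemma spread_nth_0: "spread w = [] \<or> spread w ! 0 = 0"
  by (cases w) auto

lemma inj_spread: "spread v = spread w \<Longrightarrow> v = w"
proof (induction v arbitrary: w)
  case Nil
  then show ?case by (cases w) (auto split: if_splits)
next
  case (Cons x v)
  then obtain y w' where w: "w = y # w'" by (cases w) (auto split: if_splits)
  have hd: "spread u \<noteq> z # us" if "z \<noteq> 0" for u us z
    using that by (cases u) auto
  have "x = y \<and> spread v = spread w'"
    using Cons.prems hd hd[symmetric] by (auto simp: w split: if_splits)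
  then show ?case using Cons.IH w by blast
qed

lemma spread_surj:
  "N = [] \<or> N ! 0 = 0 \<Longrightarrow> (\<And>r. r + 1 < length N \<Longrightarrow> N ! r = 0 \<or> N ! (r + 1) = 0) \<Longrightarrow> \<exists>w. N = spread w"
proof (induction "length N" arbitrary: N rule: less_induct)
  case less
  note adj = less.prems(2)
  show ?case
  proof (cases N)
    case Nil
    then show ?thesis by (intro exI[of _ "[]"]) simp
  next
    case (Cons z M)
    then have z: "z = 0" using less.prems(1) by simp
    show ?thesis
    proof (cases "M = [] \<or> M ! 0 = 0")
      case True
      have "\<exists>w. M = spread w"
        by (rule less.hyps[OF _ True]) (use Cons adj[of "Suc _"] in auto)
      then obtain w where "M = spread w" by blast
      then show ?thesis using Cons z by (intro exI[of _ "0 # w"]) simp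
    next
      case False
      then obtain x M' where M: "M = x # M'" "x \<noteq> 0" by (cases M) auto
      have first: "M' = [] \<or> M' ! 0 = 0" using adj[of 1] Cons M by (cases M') auto
      have "\<exists>w. M' = spread w"
        by (rule less.hyps[OF _ first]) (use Cons M adj[of "Suc (Suc _)"] in auto)
      then obtain w where "M' = spread w" by blast
      then show ?thesis using Cons z M by (intro exI[of _ "x # w"]) simp
    qed
  qed
qed

lemma spread_adjacent:
  "r + 1 < length (spread w) \<Longrightarrow> spread w ! r = 0 \<or> spread w ! (r + 1) = 0"
proof (induction w arbitrary: r)
  case (Cons x w)
  have z: "0 < length (spread w) \<Longrightarrow> spread w ! 0 = 0" using spread_nth_0[of w] by auto
  show ?case
  proof (cases "x = 0")
    case True
    then show ?thesis using Cons.IH[of "r - 1"] Cons.prems by (cases r) auto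
  next
    case False
    then show ?thesis using Cons.IH[of "r - 2"] Cons.prems z
      by (cases r; cases "r - 1") auto
  qed
qed simp

lemma all_shift_2: "(\<forall>r. r + 2 < length (x # N) \<longrightarrow> (x # N) ! (r + 2) \<le> (x # N) ! r + (1::nat)) \<longleftrightarrow>
    (1 < length N \<longrightarrow> N ! 1 \<le> x + 1) \<and> (\<forall>r. r + 2 < length N \<longrightarrow> N ! (r + 2) \<le> N ! r + 1)"
  (is "(\<forall>r. ?P r) \<longleftrightarrow> ?A \<and> (\<forall>r. ?Q r)")
proof -
  have "(\<forall>r. ?P r) \<longleftrightarrow> ?P 0 \<and> (\<forall>r. ?P (Suc r))" by (metis not0_implies_Suc)
  then show ?thesis by (simp add: numeral_2_eq_2)
qed

text \<open>Two places before a letter \<open>y\<close> the list \<open>spread (x # y # w)\<close> has the letter \<open>x\<close>: it reads \<open>0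
x 0 y\<close> for positive \<open>x\<close> and \<open>0 0 y\<close> for \<open>x = 0\<close>. So the increment condition for the list is the
climbing condition for the word.\<close>

lemma spread_climbs:
  "(\<forall>r. r + 2 < length (spread (x # w)) \<longrightarrow> spread (x # w) ! (r + 2) \<le> spread (x # w) ! r + 1)
     \<longleftrightarrow> climbs x w"
proof (induction w arbitrary: x)
  case Nil
  then show ?case by simp
next
  case (Cons y w)
  have one: "(1 < length (spread (y # w)) \<longrightarrow> spread (y # w) ! 1 \<le> x + 1) \<longleftrightarrow> y \<le> x + 1"
    using spread_nth_0[of w] by auto
  have two: "spread (y # w) ! 0 = 0" "spread (y # w) \<noteq> []" by auto
  define M where "M = spread (y # w)"
  have IH: "(\<forall>r. r + 2 < length M \<longrightarrow> M ! (r + 2) \<le> M ! r + 1) \<longleftrightarrow> climbs y w"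
    using Cons.IH by (simp add: M_def)
  have M: "spread (x # y # w) = (if x = 0 then 0 # M else 0 # x # M)"
    by (simp add: M_def)
  show ?case
    using one two IH unfolding M M_def[symmetric]
    by (auto simp only: all_shift_2 if_True if_False split: if_splits) (auto simp: all_shift_2)
qed

lemma last_spread: "w \<noteq> [] \<Longrightarrow> last (spread w) = last w"
proof (induction w)
  case (Cons x w)
  have "w \<noteq> [] \<Longrightarrow> spread w \<noteq> []" by (cases w) auto
  then show ?case using Cons by (cases "w = []") auto
qed simp

lemma bij_betw_spread:
  assumes "1 \<le> n"
  shows "bij_betw spread (core_words n) (runner_counts n)"
proof (rule bij_betw_imageI)
  show "inj_on spread (core_words n)" by (auto intro!: inj_onI inj_spread)
  have eq: "spread w \<in> runner_counts n \<longleftrightarrow> w \<in> core_words n" for w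
  proof (cases w)
    case Nil
    then show ?thesis by (simp add: runner_counts_def core_words_def)
  next
    case (Cons x v)
    show ?thesis
    proof (cases "length (spread w) = 2 * n + 1")
      case True
      have "spread w ! (2 * n) = last (spread w)"
        using True by (metis add_diff_cancel_right' last_conv_nth length_0_conv add_is_0 one_neq_zero)
      also have "\<dots> = last w" using Cons last_spread by blast
      finally have l: "spread w ! (2 * n) = last w" .
      have h: "spread w ! 1 = x" using True assms Cons spread_nth_0[of v] by (auto split: if_splits)
      show ?thesis
        using spread_climbs[of x v] spread_nth_0[of w] spread_adjacent[of _ w] True l h Cons
        by (auto simp: runner_counts_def core_words_def simp del: spread.simps)
    qed (simp add: runner_counts_def core_words_def)
  qed
  show "spread ` core_words n = runner_counts n"
  proof
    show "runner_counts n \<subseteq> spread ` core_words n"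
    proof
      fix N assume N: "N \<in> runner_counts n"
      then obtain w where "N = spread w" using spread_surj[of N] by (auto simp: runner_counts_def)
      then show "N \<in> spread ` core_words n" using N eq by blast
    qed
  qed (auto simp: eq)
qed

section \<open>Cutting climbing words into binary trees\<close>

datatype btree = Leaf | Node btree btree

fun nodes :: "btree \<Rightarrow> nat" where
  "nodes Leaf = 0"
| "nodes (Node P Q) = nodes P + 1 + nodes Q"

text \<open>The depths of the nodes in preorder, where only steps into left subtrees count. The nonempty
ones are exactly the sequences that start with 0 and climb by at most 1.\<close>

fun levels :: "btree \<Rightarrow> nat list" where
  "levels Leaf = []"
| "levels (Node P Q) = 0 # map Suc (levels P) @ levels Q"

definition lifted :: "nat \<Rightarrow> btree \<Rightarrow> nat list" where
  "lifted h P = map (\<lambda>x. x + Suc h) (levels P)"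

lemma lifted_simps [simp]:
  "lifted h Leaf = []"
  "lifted h (Node P Q) = Suc h # lifted (Suc h) P @ lifted h Q"
  by (auto simp: lifted_def)

lemma length_lifted [simp]: "length (lifted h P) = nodes P"
  by (induction P arbitrary: h) auto

lemma lifted_gt: "x \<in> set (lifted h P) \<Longrightarrow> h < x"
  by (auto simp: lifted_def)

lemma climbs_append: "climbs p (xs @ ys) \<longleftrightarrow> climbs p xs \<and> climbs (last (p # xs)) ys"
  by (induction xs arbitrary: p) auto

lemma climbs_mono: "climbs p xs \<Longrightarrow> p \<le> q \<Longrightarrow> climbs q xs"
  by (cases xs) auto

lemma climbs_lifted_append:
  "climbs h ys \<Longrightarrow> ys = [] \<or> hd ys \<le> h \<Longrightarrow> climbs h (lifted h P @ ys)"
proof (induction P arbitrary: h ys)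
  case (Node P Q)
  have "climbs h (lifted h Q @ ys)" using Node by blast
  then have "climbs (Suc h) (lifted h Q @ ys)" by (rule climbs_mono) simp
  moreover have "lifted h Q @ ys = [] \<or> hd (lifted h Q @ ys) \<le> Suc h"
    using Node.prems by (cases Q) auto
  ultimately show ?case using Node.IH(1)[of "Suc h" "lifted h Q @ ys"] by simp
qed simp

text \<open>Cut the word before its first letter that does not exceed \<open>h\<close>. If there is anything before
the cut, the first letter is the root, and the letters up to the next occurrence of a letter below
\<open>Suc (Suc h)\<close> form its left subtree, one level higher.\<close>

lemma parse_lifted:
  "climbs h v \<Longrightarrow> \<exists>P u. v = lifted h P @ u \<and> (u = [] \<or> hd u \<le> h)"
proof (induction "length v" arbitrary: v h rule: less_induct)
  case less
  show ?case
  proof (cases "v = [] \<or> hd v \<le> h")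
    case True
    then show ?thesis by (intro exI[of _ Leaf] exI[of _ v]) simp
  next
    case False
    then obtain v' where v: "v = Suc h # v'" using less.prems by (cases v) auto
    have "length v' < length v" "climbs (Suc h) v'" using less.prems v by simp_all
    from less.hyps[OF this] obtain P u'
      where u': "v' = lifted (Suc h) P @ u'" "u' = [] \<or> hd u' \<le> Suc h" by (elim exE conjE)
    have "length u' < length v" using u' v by simp
    moreover have "climbs h u'"
      using u' v less.prems by (cases u') (auto simp: climbs_append)
    ultimately obtain Q u where u: "u' = lifted h Q @ u" "u = [] \<or> hd u \<le> h"
      by (elim less.hyps[THEN exE] exE conjE)
    show ?thesis by (intro exI[of _ "Node P Q"] exI[of _ u]) (use u u' v in simp)
  qed
qed

text \<open>The end of the lifted tree is visible, because the remainder is empty or starts at a level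
that does not occur in the tree.\<close>

lemma lifted_unique:
  "lifted h P @ u = lifted h P' @ u' \<Longrightarrow> u = [] \<or> hd u \<le> h \<Longrightarrow> u' = [] \<or> hd u' \<le> h
   \<Longrightarrow> P = P' \<and> u = u'"
proof (induction P arbitrary: h P' u u')
  case Leaf
  then show ?case by (cases P') (auto simp: neq_Nil_conv)
next
  case (Node P Q)
  obtain R S where P': "P' = Node R S" using Node.prems by (cases P') auto
  have hd: "lifted h T @ v = [] \<or> hd (lifted h T @ v) \<le> Suc h" if "v = [] \<or> hd v \<le> h" for T v
    using that by (cases T) auto
  have "lifted (Suc h) P @ lifted h Q @ u = lifted (Suc h) R @ lifted h S @ u'"
    using Node.prems(1) P' by simp
  from Node.IH(1)[OF this hd hd] Node.prems(2,3)
  have "P = R" "lifted h Q @ u = lifted h S @ u'" by auto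
  then show ?case using Node.IH(2)[of h u S u'] Node.prems(2,3) P' by simp
qed

text \<open>Each tree is followed by the zero at which the climbing word comes back to the ground.\<close>

fun forest_word :: "btree list \<Rightarrow> nat list" where
  "forest_word [] = []"
| "forest_word (B # Bs) = lifted 0 B @ 0 # forest_word Bs"

fun forest_length :: "btree list \<Rightarrow> nat" where
  "forest_length [] = 0"
| "forest_length (B # Bs) = 2 * nodes B + 1 + forest_length Bs"

lemma climbs_forest_word: "climbs 0 (forest_word Bs)"
  by (induction Bs) (auto intro!: climbs_lifted_append)

lemma hd_forest_word: "forest_word Bs \<noteq> [] \<Longrightarrow> hd (forest_word Bs) \<le> 1"
proof (cases Bs)
  case (Cons B Bs')
  then show ?thesis by (cases B) auto
qed simp

lemma last_forest_word: "Bs \<noteq> [] \<Longrightarrow> last (forest_word Bs) = 0 \<and> forest_word Bs \<noteq> []"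
proof (induction Bs)
  case (Cons B Bs)
  then show ?case by (cases "Bs = []") auto
qed simp

lemma forest_word_unique: "forest_word Bs = forest_word Cs \<Longrightarrow> Bs = Cs"
proof (induction Bs arbitrary: Cs)
  case Nil
  then show ?case by (cases Cs) auto
next
  case (Cons B Bs)
  obtain C Cs' where Cs: "Cs = C # Cs'" using Cons.prems by (cases Cs) auto
  have "B = C \<and> 0 # forest_word Bs = 0 # forest_word Cs'"
    by (rule lifted_unique[of 0]) (use Cons.prems Cs in auto)
  then show ?case using Cons.IH Cs by simp
qed

lemma parse_forest:
  "climbs 0 v \<Longrightarrow> v = [] \<or> last v = 0 \<Longrightarrow> \<exists>Bs. v = forest_word Bs"
proof (induction "length v" arbitrary: v rule: less_induct)
  case less
  show ?case
  proof (cases "v = []")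
    case True
    then show ?thesis by (intro exI[of _ "[]"]) simp
  next
    case False
    obtain B u where u: "v = lifted 0 B @ u" "u = [] \<or> hd u \<le> 0"
      using parse_lifted[OF less.prems(1)] by blast
    have "u \<noteq> []"
    proof
      assume "u = []"
      then have "last v \<in> set (lifted 0 B)" using u(1) False by auto
      then show False using lifted_gt[of "last v" 0 B] less.prems(2) False by simp
    qed
    then obtain u' where u': "u = 0 # u'" using u(2) by (cases u) auto
    have "length u' < length v" using u(1) u' by simp
    moreover have "climbs 0 u'" using less.prems(1) u(1) u' by (auto simp: climbs_append)
    moreover have "u' = [] \<or> last u' = 0"
      using less.prems(2) False unfolding u(1) u' by (cases "u' = []") simp_all
    ultimately obtain Bs where "u' = forest_word Bs"
      by (elim less.hyps[THEN exE])
    then show ?thesis using u(1) u' by (intro exI[of _ "B # Bs"]) simp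
  qed
qed

lemma length_spread_lifted: "length (spread (lifted h P)) = 2 * nodes P"
proof (induction P arbitrary: h)
  case (Node P Q)
  then show ?case by (simp add: spread_append)
qed simp

lemma length_spread_forest: "length (spread (forest_word Bs)) = forest_length Bs"
  by (induction Bs) (auto simp: spread_append length_spread_lifted)

lemma length_spread_positive:
  "(\<And>x. x \<in> set w \<Longrightarrow> 0 < x) \<Longrightarrow> length (spread w) = 2 * length w"
  by (induction w) auto

lemma length_spread_map_Suc: "length (spread (map Suc w)) = 2 * length w"
  by (induction w) auto

text \<open>The letters of a core word after its last zero continue cyclically in its head, one level
higher, and together these two pieces are the levels of \<open>A\<close>; \<open>j\<close> is the number of levels in the
tail of the word.\<close>

definition configurations :: "nat \<Rightarrow> (btree \<times> nat \<times> btree list) set" where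
  "configurations n = {(A, j, Bs). j \<le> nodes A \<and> 2 * nodes A + forest_length Bs = 2 * n + 1}"

fun config_word :: "btree \<times> nat \<times> btree list \<Rightarrow> nat list" where
  "config_word (A, j, Bs) =
     drop j (lifted 1 A) @ forest_word Bs @ map (\<lambda>x. x - 1) (take j (lifted 1 A))"

lemma climbs_pred:
  "climbs (Suc p) xs \<Longrightarrow> (\<And>x. x \<in> set xs \<Longrightarrow> 0 < x) \<Longrightarrow> climbs p (map (\<lambda>x. x - 1) xs)"
  by (induction xs arbitrary: p) auto

lemma climbs_Suc: "climbs p xs \<Longrightarrow> climbs (Suc p) (map Suc xs)"
  by (induction xs arbitrary: p) auto

text \<open>The letters of \<open>A\<close> start at level 2 and those of the list at level 1, so that the cyclic
climbing condition at the junction is the ordinary one for \<open>lifted 1 A @ forest_word Bs\<close>, with 1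
as virtual letter in front.\<close>

lemma config_word_core:
  assumes "(A, j, Bs) \<in> configurations n"
  shows "config_word (A, j, Bs) \<in> core_words n"
proof -
  let ?va = "lifted 1 A" and ?r = "forest_word Bs"
  have j: "j \<le> nodes A" and len: "2 * nodes A + forest_length Bs = 2 * n + 1"
    using assms by (auto simp: configurations_def)
  have "Bs \<noteq> []"
  proof
    assume "Bs = []"
    then have "2 * nodes A = 2 * n + 1" using len by simp
    then show False by presburger
  qed
  then have r: "last ?r = 0" "?r \<noteq> []" using last_forest_word by auto
  have "climbs 1 (?va @ ?r)"
    by (rule climbs_lifted_append)
      (use climbs_mono[OF climbs_forest_word, of 1 Bs] hd_forest_word in auto)
  then have c: "climbs 1 (take j ?va)" "climbs (last (1 # take j ?va)) (drop j ?va @ ?r)"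
    using climbs_append[of 1 "take j ?va" "drop j ?va @ ?r"]
    unfolding append_assoc[symmetric] append_take_drop_id by blast+
  have gt: "1 < x" if "x \<in> set (take j ?va)" for x
    using lifted_gt[of x 1 A] that by (meson in_set_takeD)
  have p: "climbs 0 (map (\<lambda>x. x - 1) (take j ?va))"
    by (rule climbs_pred) (use c(1) gt in force)+
  have last: "last (config_word (A, j, Bs)) + 1 = last (1 # take j ?va)"
  proof (cases "take j ?va = []")
    case True
    then show ?thesis using r by simp
  next
    case False
    then have "1 < last (take j ?va)" using gt last_in_set by blast
    then show ?thesis using False by (simp add: last_map)
  qed
  have "climbs (last (config_word (A, j, Bs)) + 1) (config_word (A, j, Bs))"
    unfolding last using c(2) p r by (simp add: climbs_append)
  moreover have "length (spread (config_word (A, j, Bs))) = 2 * n + 1"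
  proof -
    have "length (spread (drop j ?va)) = 2 * (nodes A - j)"
      using lifted_gt[of _ 1 A] by (subst length_spread_positive) (force dest: in_set_dropD)+
    moreover have "length (spread (map (\<lambda>x. x - 1) (take j ?va))) = 2 * j"
      using gt j by (subst length_spread_positive) force+
    ultimately show ?thesis using len j by (simp add: spread_append length_spread_forest)
  qed
  ultimately show ?thesis using r by (simp add: core_words_def)
qed

lemma split_at_last_zero:
  "0 \<in> set w \<Longrightarrow> \<exists>u F. w = u @ F \<and> u \<noteq> [] \<and> last u = (0::nat) \<and> (\<forall>x\<in>set F. 0 < x)"
proof -
  assume "0 \<in> set w"
  then obtain us F where "w = us @ 0 # F" "0 \<notin> set F" by (meson split_list_last)
  then show ?thesis by (intro exI[of _ "us @ [0]"] exI[of _ F]) (auto intro: gr0I)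
qed

text \<open>The length of the spread word is odd, so the word contains a zero. Moving its positive tail,
raised by one level, to the front gives a climbing word that ends in zero, which can be parsed.\<close>

lemma core_word_config:
  assumes "w \<in> core_words n"
  shows "\<exists>c\<in>configurations n. config_word c = w"
proof -
  have w: "w \<noteq> []" "climbs (last w + 1) w" "length (spread w) = 2 * n + 1"
    using assms by (auto simp: core_words_def)
  have "0 \<in> set w"
  proof (rule ccontr)
    assume "0 \<notin> set w"
    then have "length (spread w) = 2 * length w" by (intro length_spread_positive) (auto intro: gr0I)
    then show False using w(3) by presburger
  qed
  then obtain u F where uF: "w = u @ F" "u \<noteq> []" "last u = 0" "\<forall>x\<in>set F. 0 < x"
    using split_at_last_zero by blast
  \<comment> \<open>Raise the tail by one level and move it to the front.\<close>
  let ?v = "map Suc F @ u"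
  have F: "climbs 0 F" and u: "climbs (last w + 1) u"
    using w(2) uF by (auto simp: climbs_append)
  have last: "last (1 # map Suc F) = last w + 1"
    using uF by (auto simp: last_map)
  have v: "climbs 1 ?v"
    unfolding climbs_append last using climbs_Suc[OF F] u by simp
  obtain A r where r: "?v = lifted 1 A @ r" "r = [] \<or> hd r \<le> 1"
    using parse_lifted[OF v] by blast
  have "r \<noteq> []"
  proof
    assume "r = []"
    then have "last ?v \<in> set (lifted 1 A)" using r(1) uF(2)
        by (metis append_Nil2 append_is_Nil_conv last_in_set)
    then show False using lifted_gt[of "last ?v" 1 A] uF by simp
  qed
  have "last r = last ?v" using r(1) \<open>r \<noteq> []\<close> by simp
  then have "last r = 0" using uF by simp
  moreover have "climbs 0 r"
    using v r \<open>r \<noteq> []\<close> unfolding r(1) climbs_append by (cases r) auto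
  ultimately obtain Bs where Bs: "r = forest_word Bs" using parse_forest by blast
  have j: "length F \<le> nodes A"
  proof (rule ccontr)
    assume "\<not> length F \<le> nodes A"
    then have lt: "nodes A < length F" by simp
    then have "?v ! nodes A = Suc (F ! nodes A)" by (simp add: nth_append)
    moreover have "?v ! nodes A = hd r" unfolding r(1) using \<open>r \<noteq> []\<close> by (simp add: nth_append hd_conv_nth)
    moreover have "0 < F ! nodes A" using uF(4) lt by simp
    ultimately show False using r(2) \<open>r \<noteq> []\<close> by simp
  qed
  have take: "take (length F) (lifted 1 A) = map Suc F"
  proof -
    have "take (length F) (lifted 1 A @ r) = map Suc F" unfolding r(1)[symmetric] by simp
    then show ?thesis using j by simp
  qed
  have drop: "drop (length F) (lifted 1 A) @ r = u"
  proof -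
    have "drop (length F) (lifted 1 A @ r) = u" unfolding r(1)[symmetric] by simp
    then show ?thesis using j by simp
  qed
  have word: "config_word (A, length F, Bs) = w"
    using take drop uF(1) Bs by (simp flip: append_assoc) (simp add: o_def)
  have "2 * nodes A + forest_length Bs = 2 * n + 1"
  proof -
    have "length (spread ?v) = length (spread w)"
      using uF(4) unfolding uF(1)
      by (simp add: spread_append length_spread_positive[of F] length_spread_map_Suc)
    then show ?thesis using w(3) unfolding r(1) Bs
      by (simp add: spread_append length_spread_lifted length_spread_forest)
  qed
  then have "(A, length F, Bs) \<in> configurations n" using j by (simp add: configurations_def)
  then show ?thesis using word by blast
qed

lemma append_Cons_eq_iff_notin:
  "a @ z # F = b @ z # F' \<Longrightarrow> z \<notin> set F \<Longrightarrow> z \<notin> set F' \<Longrightarrow> a = b \<and> F = F'"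
proof (induction a arbitrary: b)
  case Nil
  then show ?case by (cases b) auto
next
  case (Cons c a)
  then show ?case by (cases b) auto
qed

lemma zero_split_unique:
  assumes "u @ F = u' @ F'" "u \<noteq> []" "u' \<noteq> []" "last u = 0" "last u' = (0::nat)"
    "\<And>x. x \<in> set F \<Longrightarrow> 0 < x" "\<And>x. x \<in> set F' \<Longrightarrow> 0 < x"
  shows "u = u' \<and> F = F'"
proof -
  obtain a where a: "u = a @ [0]" using assms(2,4) by (metis append_butlast_last_id)
  obtain b where b: "u' = b @ [0]" using assms(3,5) by (metis append_butlast_last_id)
  have "a @ 0 # F = b @ 0 # F'" using assms(1) a b by simp
  moreover have "0 \<notin> set F" "0 \<notin> set F'" using assms(6,7) by blast+
  ultimately have "a = b \<and> F = F'" by (metis append_Cons_eq_iff_notin)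
  then show ?thesis using a b by simp
qed

text \<open>The tail after the last zero can be read off from the word, hence so can \<open>j\<close>; putting the
raised tail in front determines the trees by unique parsing.\<close>

lemma bij_betw_config_word: "bij_betw config_word (configurations n) (core_words n)"
proof (rule bij_betw_imageI)
  show "config_word ` configurations n = core_words n"
  proof
    show "core_words n \<subseteq> config_word ` configurations n" using core_word_config by (metis imageI subsetI)
  qed (use config_word_core in auto)
  show "inj_on config_word (configurations n)"
  proof (rule inj_onI)
    fix x y
    assume xy: "x \<in> configurations n" "y \<in> configurations n" "config_word x = config_word y"
    obtain A j Bs where x: "x = (A, j, Bs)" by (cases x)
    obtain A' j' Bs' where y: "y = (A', j', Bs')" by (cases y)
    have c: "(A, j, Bs) \<in> configurations n" "(A', j', Bs') \<in> configurations n"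
      and eq: "config_word (A, j, Bs) = config_word (A', j', Bs')"
      using xy x y by simp_all
    have ne: "forest_word Cs \<noteq> [] \<and> last (forest_word Cs) = 0"
      if "(C, k, Cs) \<in> configurations n" for C k Cs
    proof -
      have "Cs \<noteq> []"
      proof
        assume "Cs = []"
        then have "2 * nodes C = 2 * n + 1" using that by (simp add: configurations_def)
        then show False by presburger
      qed
      then show ?thesis using last_forest_word by blast
    qed
    have pos: "0 < y" if "y \<in> set (map (\<lambda>x. x - 1) (take k (lifted 1 C)))" for y k C
      using that lifted_gt[of _ 1 C] by (fastforce dest: in_set_takeD)
    have "drop j (lifted 1 A) @ forest_word Bs = drop j' (lifted 1 A') @ forest_word Bs' \<and>
        map (\<lambda>x. x - 1) (take j (lifted 1 A)) = map (\<lambda>x. x - 1) (take j' (lifted 1 A'))"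
      by (rule zero_split_unique) (use eq ne[OF c(1)] ne[OF c(2)] pos in auto)
    moreover have jj: "j = j'"
      using conjunct2[OF calculation, THEN arg_cong, of length] c by (simp add: configurations_def)
    moreover have "take j (lifted 1 A) = take j' (lifted 1 A')"
    proof -
      have inv: "map Suc (map (\<lambda>x. x - 1) (take k (lifted 1 C))) = take k (lifted 1 C)" for k C
        using lifted_gt[of _ 1 C] by (auto intro!: map_idI dest!: in_set_takeD) fastforce
      show ?thesis using arg_cong[OF conjunct2[OF calculation(1)], of "map Suc"] unfolding inv .
    qed
    ultimately have "lifted 1 A @ forest_word Bs = lifted 1 A' @ forest_word Bs'"
      by (metis append_assoc append_take_drop_id)
    then have "A = A' \<and> forest_word Bs = forest_word Bs'"
      by (rule lifted_unique) (use hd_forest_word in auto)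
    then show "x = y" unfolding x y using jj forest_word_unique by blast
  qed
qed

section \<open>The size as a function of the trees\<close>

text \<open>The sum of all levels, with the root at level 1.\<close>

fun area :: "btree \<Rightarrow> real" where
  "area Leaf = 0"
| "area (Node P Q) = area P + real (nodes P) + 1 + area Q"

text \<open>The sum of the squares of all levels, with the root at level 1.\<close>

fun sqarea :: "btree \<Rightarrow> real" where
  "sqarea Leaf = 0"
| "sqarea (Node P Q) = sqarea P + 2 * area P + real (nodes P) + 1 + sqarea Q"

text \<open>The part of the first moment of the levels that changes sign under reversal, see
\<open>torque_mirror\<close>. If two sequences with \<open>p\<close> and \<open>q\<close> nodes and areas \<open>s\<close> and \<open>t\<close> are joined, moments
being taken about the centres, then \<open>p * t - q * s\<close> is added. Raising a tree by one level changes
all levels by the same amount and therefore does not affect its torque.\<close>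

fun torque :: "btree \<Rightarrow> real" where
  "torque Leaf = 0"
| "torque (Node P Q) = torque P + torque Q + (real (nodes P) + 1) * area Q
     - real (nodes Q) * (area P + real (nodes P) + 1)"

fun forest_area :: "btree list \<Rightarrow> real" where
  "forest_area [] = 0"
| "forest_area (B # Bs) = area B + forest_area Bs"

fun forest_sqarea :: "btree list \<Rightarrow> real" where
  "forest_sqarea [] = 0"
| "forest_sqarea (B # Bs) = sqarea B + forest_sqarea Bs"

text \<open>A tree with \<open>m\<close> nodes followed by a zero occupies \<open>2 * m + 1\<close> places, so the joining rule is
that of \<open>torque\<close> with lengths in place of the doubled numbers of nodes.\<close>

fun forest_torque :: "btree list \<Rightarrow> real" where
  "forest_torque [] = 0"
| "forest_torque (B # Bs) = torque B + forest_torque Bs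
     + ((2 * real (nodes B) + 1) * forest_area Bs - real (forest_length Bs) * area B) / 2"

lemma sum_squares_simps [simp]:
  "sum_squares [] = 0"
  "sum_squares (x # xs) = (real x)\<^sup>2 + sum_squares xs"
  "sum_squares (xs @ ys) = sum_squares xs + sum_squares ys"
  by (simp_all add: sum_squares_def)

lemma sum_spread: "sum_list (spread w) = sum_list w"
  by (induction w) auto

lemma sum_squares_spread: "sum_squares (spread w) = sum_squares w"
  by (induction w) auto

lemma sum_lifted: "real (sum_list (lifted h P)) = area P + real h * real (nodes P)"
  by (induction P arbitrary: h) (auto simp: algebra_simps)

lemma sum_squares_lifted:
  "sum_squares (lifted h P) = sqarea P + 2 * real h * area P + (real h)\<^sup>2 * real (nodes P)"
  by (induction P arbitrary: h) (auto simp: algebra_simps power2_eq_square)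

lemma first_moment_spread_positive_Cons:
  "0 < x \<Longrightarrow> first_moment (spread (x # w)) = real x + first_moment (spread w) + 2 * real (sum_list w)"
  by (simp add: sum_spread)

lemma first_moment_spread_append:
  "first_moment (spread (v @ w)) = first_moment (spread v) + first_moment (spread w)
     + real (length (spread v)) * real (sum_list w)"
  by (simp add: spread_append first_moment_append sum_spread)

text \<open>This isolates the torque: the remaining part of the first moment depends only on statistics
that reversal preserves.\<close>

lemma first_moment_lifted:
  "first_moment (spread (lifted h P)) = torque P + sqarea P / 2
     + (real (nodes P) - 1 / 2) * area P + real h * (real (nodes P))\<^sup>2"
proof (induction P arbitrary: h)
  case (Node P Q)
  have "first_moment (spread (lifted h (Node P Q))) = real (Suc h)
     + first_moment (spread (lifted (Suc h) P @ lifted h Q))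
     + 2 * real (sum_list (lifted (Suc h) P @ lifted h Q))"
    unfolding lifted_simps by (rule first_moment_spread_positive_Cons) simp
  then show ?case
    unfolding first_moment_spread_append Node.IH length_spread_lifted sum_list_append of_nat_add
      sum_lifted nodes.simps area.simps sqarea.simps torque.simps
    by (simp add: sum_lifted field_simps power2_eq_square)
qed simp

lemma sum_forest_word: "real (sum_list (forest_word Bs)) = forest_area Bs"
  by (induction Bs) (auto simp: sum_lifted)

lemma sum_squares_forest_word: "sum_squares (forest_word Bs) = forest_sqarea Bs"
  by (induction Bs) (auto simp: sum_squares_lifted)

lemma first_moment_forest_word:
  "first_moment (spread (forest_word Bs)) = forest_torque Bs + forest_sqarea Bs / 2
     + (real (forest_length Bs) / 2 - 1) * forest_area Bs"
proof (induction Bs)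
  case (Cons B Bs)
  have "first_moment (spread (forest_word (B # Bs))) = first_moment (spread (lifted 0 B))
     + (first_moment (spread (forest_word Bs)) + forest_area Bs)
     + 2 * real (nodes B) * forest_area Bs"
    by (simp add: first_moment_spread_append length_spread_lifted sum_forest_word sum_spread)
  then show ?case
    unfolding Cons.IH first_moment_lifted
    by (simp add: field_simps)
qed simp

lemma sum_map_add:
  "real (sum_list (map (\<lambda>x. x + Suc c) xs)) = real (sum_list (map Suc xs)) + real c * real (length xs)"
  by (induction xs) (auto simp: algebra_simps)

lemma first_moment_spread_add:
  "first_moment (spread (map (\<lambda>x. x + Suc c) xs)) =
     first_moment (spread (map Suc xs)) + real c * (real (length xs))\<^sup>2"
proof (induction xs)
  case (Cons x xs)
  show ?case
    using Cons sum_map_add[of c xs] unfolding list.map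
    by (subst (1 2) first_moment_spread_positive_Cons) (auto simp: algebra_simps power2_eq_square)
qed simp

lemma sum_squares_map_add:
  "sum_squares (map (\<lambda>x. x + Suc c) xs) = sum_squares (map Suc xs)
     + 2 * real c * real (sum_list (map Suc xs)) + (real c)\<^sup>2 * real (length xs)"
  by (induction xs) (auto simp: algebra_simps power2_eq_square)

definition config_size :: "nat \<Rightarrow> btree \<times> nat \<times> btree list \<Rightarrow> real" where
  "config_size n = (\<lambda>(A, j, Bs). let T = area A + forest_area Bs in
     (real n + 1) * (sqarea A + area A + forest_sqarea Bs) - T\<^sup>2 / 2
     + torque A + forest_torque Bs - (real j + 1 / 2) * T
     + (real (nodes A) - real j) * (real (nodes A) - real j + 1) / 2)"

definition word_size :: "nat \<Rightarrow> nat list \<Rightarrow> real" where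
  "word_size n N = (2 * real n + 1) / 2 * sum_squares N - (real (sum_list N))\<^sup>2 / 2
     + first_moment N - real n * real (sum_list N)"

text \<open>The levels of \<open>A\<close> before the cut stand one full turn later than those after it and are lower
by one. The two effects balance: the sums of the first \<open>j\<close> levels cancel, and the cut matters only
through the number \<open>j\<close>.\<close>

lemma word_size_config:
  assumes "(A, j, Bs) \<in> configurations n"
  shows "word_size n (spread (config_word (A, j, Bs))) = config_size n (A, j, Bs)"
proof -
  define U1 U2 where "U1 = take j (levels A)" and "U2 = drop j (levels A)"
  \<comment> \<open>The list occupies \<open>2 * m + 1\<close> places.\<close>
  define m where "m = n - nodes A"
  have j: "j \<le> nodes A" and len: "2 * nodes A + forest_length Bs = 2 * n + 1"
    using assms by (auto simp: configurations_def)
  then have n: "n = nodes A + m" and fl: "forest_length Bs = 2 * m + 1"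
    by (auto simp: m_def)
  define l1 l2 where "l1 = real (length U1)" and "l2 = real (length U2)"
  have lA: "length (levels A) = nodes A" using length_lifted[of 0 A] by (simp add: lifted_def)
  have l: "l1 = real j" "l1 + l2 = real (nodes A)"
    using j lA by (auto simp: l1_def l2_def U1_def U2_def)
  define s1 s2 where "s1 = real (sum_list (map Suc U1))" and "s2 = real (sum_list (map Suc U2))"
  define q1 q2 where "q1 = sum_squares (map Suc U1)" and "q2 = sum_squares (map Suc U2)"
  define f1 f2 where "f1 = first_moment (spread (map Suc U1))" and "f2 = first_moment (spread (map Suc U2))"
  have lev: "lifted 0 A = map Suc U1 @ map Suc U2"
    by (simp add: lifted_def U1_def U2_def flip: map_append)
  have tot: "area A = s1 + s2" "sqarea A = q1 + q2"
    using sum_lifted[of 0 A] sum_squares_lifted[of 0 A] unfolding lev s1_def s2_def q1_def q2_def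
    by simp_all
  have mom: "torque A + sqarea A / 2 + (real (nodes A) - 1 / 2) * area A = f1 + f2 + 2 * l1 * s2"
    using first_moment_lifted[of 0 A]
    unfolding lev first_moment_spread_append f1_def f2_def l1_def s2_def
    by (simp add: length_spread_map_Suc)
  define R where "R = forest_word Bs"
  have Rs: "real (sum_list R) = forest_area Bs" "sum_squares R = forest_sqarea Bs"
    "first_moment (spread R) = forest_torque Bs + forest_sqarea Bs / 2 + (real m - 1 / 2) * forest_area Bs"
    "length (spread R) = 2 * m + 1"
    unfolding R_def using first_moment_forest_word[of Bs]
    by (simp_all add: sum_forest_word sum_squares_forest_word length_spread_forest fl add_divide_distrib)
  have w: "config_word (A, j, Bs) = map (\<lambda>x. x + Suc 1) U2 @ R @ map Suc U1"
    by (simp add: lifted_def U1_def U2_def R_def take_map drop_map o_def)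
  have len2: "length (spread (map (\<lambda>x. x + Suc 1) U2)) = 2 * length U2"
    using length_spread_map_Suc[of "map Suc U2"] by (simp add: o_def)
  have T: "real (sum_list (config_word (A, j, Bs))) = s2 + l2 + forest_area Bs + s1"
    unfolding w using sum_map_add[of 1 U2] Rs(1)
    by (simp add: s1_def s2_def l2_def)
  have Y: "sum_squares (config_word (A, j, Bs)) = q2 + 2 * s2 + l2 + forest_sqarea Bs + q1"
    unfolding w sum_squares_simps(3) Rs(2) sum_squares_map_add
    by (simp add: q1_def q2_def s2_def l2_def)
  have Z: "first_moment (spread (config_word (A, j, Bs))) = f2 + l2\<^sup>2
     + (forest_torque Bs + forest_sqarea Bs / 2 + (real m - 1 / 2) * forest_area Bs)
     + f1 + (2 * real m + 1) * s1 + 2 * l2 * (forest_area Bs + s1)"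
    unfolding w first_moment_spread_append first_moment_spread_add len2 Rs(3,4) sum_list_append
        of_nat_add Rs(1)
    by (simp add: f1_def f2_def s1_def l2_def algebra_simps)
  have "torque A = f1 + f2 + 2 * l1 * s2 - (q1 + q2) / 2 - (l1 + l2 - 1 / 2) * (s1 + s2)"
    using mom unfolding tot l(2)[symmetric] by linarith
  moreover have "real n = l1 + l2 + real m" using l n by simp
  ultimately show ?thesis
    unfolding word_size_def config_size_def prod.case Let_def sum_spread sum_squares_spread T Y Z tot
      l(1)[symmetric] l(2)[symmetric]
    by (simp only:) (simp add: field_simps power2_eq_square)
qed

text \<open>The chain of bijections from partitions to configurations carries the size to \<open>config_size\<close>.\<close>

lemma sum_over_cores:
  assumes "1 \<le> n"
  shows "(\<Sum>xs\<in>distinct_core_partitions (2 * n + 1) (2 * n + 3). f (real (partition_size xs)))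
    = (\<Sum>c\<in>configurations n. f (config_size n c))"
proof -
  let ?C = "distinct_core_partitions (2 * n + 1) (2 * n + 3)"
  define g where "g S = real (partition_size (inv_into ?C beta S))" for S
  have b: "bij_betw beta ?C (core_sets (2 * n + 1) (2 * n + 3))" by (rule bij_betw_beta) simp_all
  have size: "real (partition_size xs) = g (beta xs)" if "xs \<in> ?C" for xs
    using that b by (simp add: g_def bij_betw_inv_into_left)
  have comp: "bij_betw (runner_set (2 * n + 1) \<circ> spread \<circ> config_word) (configurations n)
      (core_sets (2 * n + 1) (2 * n + 3))"
    using bij_betw_trans[OF bij_betw_config_word bij_betw_trans[OF bij_betw_spread[OF assms]
      bij_betw_runner_set[OF assms]]] by (simp add: o_assoc)
  have "(\<Sum>xs\<in>?C. f (real (partition_size xs))) = (\<Sum>xs\<in>?C. f (g (beta xs)))"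
    using size by simp
  also have "\<dots> = (\<Sum>S\<in>core_sets (2 * n + 1) (2 * n + 3). f (g S))"
    by (rule sum.reindex_bij_betw[OF b])
  also have "\<dots> = (\<Sum>c\<in>configurations n. f (g ((runner_set (2 * n + 1) \<circ> spread \<circ> config_word) c)))"
    by (rule sum.reindex_bij_betw[OF comp, symmetric])
  also have "\<dots> = (\<Sum>c\<in>configurations n. f (config_size n c))"
  proof (rule sum.cong[OF refl])
    fix c assume c: "c \<in> configurations n"
    obtain A j Bs where A: "c = (A, j, Bs)" by (cases c)
    let ?N = "spread (config_word c)"
    have w: "config_word c \<in> core_words n" using config_word_core c A by blast
    then have len: "length ?N = 2 * n + 1" by (simp add: core_words_def)
    have "runner_set (2 * n + 1) ?N \<in> core_sets (2 * n + 1) (2 * n + 3)"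
      using bij_betwE[OF comp] c by auto
    then have "runner_set (2 * n + 1) ?N \<in> beta ` ?C"
      unfolding bij_betw_imp_surj_on[OF b] .
    then obtain xs where xs: "xs \<in> ?C" "beta xs = runner_set (2 * n + 1) ?N"
      by (elim imageE) (simp only:)
    have "g (runner_set (2 * n + 1) ?N) = word_size n ?N"
      using partition_size_runner[OF xs(1,2) len refl]
      unfolding xs(2)[symmetric] size[OF xs(1), symmetric] word_size_def by simp
    also have "\<dots> = config_size n c" using word_size_config c unfolding A by blast
    finally show "f (g ((runner_set (2 * n + 1) \<circ> spread \<circ> config_word) c)) = f (config_size n c)"
      by simp
  qed
  finally show ?thesis .
qed

section \<open>Generating functions of weighted classes\<close>

definition finite_fibres :: "('a \<Rightarrow> nat) \<Rightarrow> 'a set \<Rightarrow> bool" where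
  "finite_fibres sz S \<longleftrightarrow> (\<forall>k. finite {x \<in> S. sz x = k})"

definition gf :: "('a \<Rightarrow> nat) \<Rightarrow> 'a set \<Rightarrow> ('a \<Rightarrow> real) \<Rightarrow> real fps" where
  "gf sz S f = Abs_fps (\<lambda>k. \<Sum>x | x \<in> S \<and> sz x = k. f x)"

definition euler_op :: "real fps \<Rightarrow> real fps" where
  "euler_op F = fps_X * fps_deriv F"

lemma euler_op_nth: "fps_nth (euler_op F) k = real k * fps_nth F k"
  by (cases k) (auto simp: euler_op_def)

lemma gf_nth: "fps_nth (gf sz S f) k = (\<Sum>x | x \<in> S \<and> sz x = k. f x)"
  by (simp add: gf_def)

lemma gf_add: "gf sz S (\<lambda>x. f x + g x) = gf sz S f + gf sz S g"
  by (simp add: fps_eq_iff gf_nth sum.distrib)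

lemma gf_diff: "gf sz S (\<lambda>x. f x - g x) = gf sz S f - gf sz S g"
  by (simp add: fps_eq_iff gf_nth sum_subtractf)

lemma gf_scale: "gf sz S (\<lambda>x. c * f x) = fps_const c * gf sz S f"
  by (simp add: fps_eq_iff gf_nth sum_distrib_left)

lemma gf_numeral: "gf sz S (\<lambda>x. numeral c * f x) = numeral c * gf sz S f"
  by (simp add: gf_scale numeral_fps_const)

lemma gf_size: "gf sz S (\<lambda>x. real (sz x) * f x) = euler_op (gf sz S f)"
  by (auto simp: fps_eq_iff gf_nth euler_op_nth sum_distrib_left intro!: sum.cong)

lemma gf_cong: "(\<And>x. x \<in> S \<Longrightarrow> f x = g x) \<Longrightarrow> gf sz S f = gf sz S g"
  by (auto simp: fps_eq_iff gf_nth intro!: sum.cong)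

lemma finite_fibres_prod:
  assumes "finite_fibres sz S" "finite_fibres sz' S'"
  shows "finite_fibres (\<lambda>(x, y). sz x + sz' y) (S \<times> S')"
  unfolding finite_fibres_def
proof
  fix k
  have "{z \<in> S \<times> S'. (\<lambda>(x, y). sz x + sz' y) z = k} \<subseteq>
      (\<Union>i\<le>k. {x \<in> S. sz x = i}) \<times> (\<Union>i\<le>k. {y \<in> S'. sz' y = i})"
    by auto
  then show "finite {z \<in> S \<times> S'. (\<lambda>(x, y). sz x + sz' y) z = k}"
    by (rule finite_subset) (use assms in \<open>auto simp: finite_fibres_def\<close>)
qed

lemma gf_prod:
  assumes "finite_fibres sz S" "finite_fibres sz' S'"
  shows "gf (\<lambda>(x, y). sz x + sz' y) (S \<times> S') (\<lambda>(x, y). f x * g y) = gf sz S f * gf sz' S' g"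
proof (rule fps_ext)
  fix k
  let ?A = "\<lambda>i. {x \<in> S. sz x = i}" and ?B = "\<lambda>i. {y \<in> S'. sz' y = i}"
  have fin: "finite (?A i)" "finite (?B i)" for i using assms by (auto simp: finite_fibres_def)
  have "fps_nth (gf sz S f * gf sz' S' g) k = (\<Sum>i=0..k. \<Sum>z\<in>?A i \<times> ?B (k - i). case z of (x, y) \<Rightarrow> f x * g y)"
    by (simp add: fps_mult_nth gf_nth sum_product sum.cartesian_product)
  also have "\<dots> = (\<Sum>z\<in>(\<Union>i\<in>{0..k}. ?A i \<times> ?B (k - i)). case z of (x, y) \<Rightarrow> f x * g y)"
    by (rule sum.UNION_disjoint[symmetric]) (use fin in auto)
  also have "(\<Union>i\<in>{0..k}. ?A i \<times> ?B (k - i)) = {z \<in> S \<times> S'. (\<lambda>(x, y). sz x + sz' y) z = k}"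
    by auto
  finally show "fps_nth (gf (\<lambda>(x, y). sz x + sz' y) (S \<times> S') (\<lambda>(x, y). f x * g y)) k =
      fps_nth (gf sz S f * gf sz' S' g) k"
    by (simp add: gf_nth conj_commute cong: conj_cong)
qed

lemma gf_bij:
  assumes "bij_betw h S S'" "\<And>x. x \<in> S \<Longrightarrow> sz' (h x) = sz x"
  shows "gf sz' S' f = gf sz S (\<lambda>x. f (h x))"
proof (rule fps_ext)
  fix k
  have "bij_betw h {x \<in> S. sz x = k} {y \<in> S'. sz' y = k}"
    using assms by (auto simp: bij_betw_def inj_on_def)
  then show "fps_nth (gf sz' S' f) k = fps_nth (gf sz S (\<lambda>x. f (h x))) k"
    by (simp add: gf_nth sum.reindex_bij_betw[symmetric])
qed

lemma gf_Suc: "gf (\<lambda>x. Suc (sz x)) S f = fps_X * gf sz S f"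
proof (rule fps_ext)
  fix k
  show "fps_nth (gf (\<lambda>x. Suc (sz x)) S f) k = fps_nth (fps_X * gf sz S f) k"
    by (cases k) (simp_all add: gf_nth)
qed

lemma gf_insert:
  assumes "finite_fibres sz S" "a \<notin> S" "sz a = 0"
  shows "gf sz (insert a S) f = fps_const (f a) + gf sz S f"
proof (rule fps_ext)
  fix k
  have "{x. x \<in> insert a S \<and> sz x = k} = (if k = 0 then insert a {x \<in> S. sz x = k} else {x \<in> S. sz x = k})"
    using assms(3) by auto
  then show "fps_nth (gf sz (insert a S) f) k = fps_nth (fps_const (f a) + gf sz S f) k"
    using assms by (auto simp: gf_nth finite_fibres_def)
qed

text \<open>The bijection maps the sum to its own negative.\<close>

lemma gf_antisymmetric:
  assumes "bij_betw h S S" "\<And>x. x \<in> S \<Longrightarrow> sz (h x) = sz x" "\<And>x. x \<in> S \<Longrightarrow> f (h x) = - f x"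
  shows "gf sz S f = 0"
proof -
  have "gf sz S f = gf sz S (\<lambda>x. f (h x))" by (rule gf_bij[where h = h]) (use assms in auto)
  also have "\<dots> = gf sz S (\<lambda>x. 0 - f x)" using assms(3) by (intro gf_cong) simp
  also have "\<dots> = - gf sz S f" by (simp add: fps_eq_iff gf_nth sum_negf)
  finally show ?thesis by (simp add: fps_eq_iff)
qed

section \<open>Generating functions of binary trees\<close>

abbreviation tree_gf :: "(btree \<Rightarrow> real) \<Rightarrow> real fps" where
  "tree_gf \<equiv> gf nodes UNIV"

abbreviation pair_gf :: "(btree \<Rightarrow> btree \<Rightarrow> real) \<Rightarrow> real fps" where
  "pair_gf F \<equiv> gf (\<lambda>(P, Q). nodes P + nodes Q) UNIV (\<lambda>(P, Q). F P Q)"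

lemma UNIV_btree: "(UNIV :: btree set) = insert Leaf (case_prod Node ` UNIV)"
proof -
  have "t \<in> insert Leaf (case_prod Node ` UNIV)" for t by (cases t) (auto simp: image_iff)
  then show ?thesis by blast
qed

lemma finite_fibres_btree: "finite_fibres nodes UNIV"
proof -
  have fin: "finite {P. nodes P \<le> k}" for k
  proof (induction k)
    case 0
    have "P = Leaf" if "nodes P = 0" for P using that by (cases P) auto
    then have "{P. nodes P \<le> 0} \<subseteq> {Leaf}" by auto
    then show ?case by (rule finite_subset) simp
  next
    case (Suc k)
    have "{P. nodes P \<le> Suc k} \<subseteq> insert Leaf (case_prod Node ` ({P. nodes P \<le> k} \<times> {P. nodes P \<le> k}))"
    proof
      fix P assume "P \<in> {P. nodes P \<le> Suc k}"
      then show "P \<in> insert Leaf (case_prod Node ` ({P. nodes P \<le> k} \<times> {P. nodes P \<le> k}))"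
        by (cases P) (auto simp: image_iff)
    qed
    then show ?case by (rule finite_subset) (use Suc in simp)
  qed
  have "finite {P. nodes P = k}" for k
    by (rule finite_subset[OF _ fin[of k]]) auto
  then show ?thesis by (simp add: finite_fibres_def)
qed

lemma pair_gf_prod: "pair_gf (\<lambda>P Q. f P * g Q) = tree_gf f * tree_gf g"
  using gf_prod[OF finite_fibres_btree finite_fibres_btree, of f g] by simp

lemma pair_gf_add: "pair_gf (\<lambda>P Q. F P Q + G P Q) = pair_gf F + pair_gf G"
  by (simp add: split_def gf_add)

lemma pair_gf_diff: "pair_gf (\<lambda>P Q. F P Q - G P Q) = pair_gf F - pair_gf G"
  by (simp add: split_def gf_diff)

lemma pair_gf_numeral: "pair_gf (\<lambda>P Q. numeral c * F P Q) = numeral c * pair_gf F"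
  by (simp add: split_def gf_numeral)

lemma tree_gf_rec: "tree_gf f = fps_const (f Leaf) + fps_X * pair_gf (\<lambda>P Q. f (Node P Q))"
proof -
  let ?sz = "\<lambda>(P, Q). nodes P + nodes Q"
  have fin: "finite_fibres nodes (case_prod Node ` UNIV)"
    using finite_fibres_btree by (auto simp: finite_fibres_def intro: rev_finite_subset)
  have "tree_gf f = gf nodes (insert Leaf (case_prod Node ` UNIV)) f"
    by (subst UNIV_btree) simp
  also have "\<dots> = fps_const (f Leaf) + gf nodes (case_prod Node ` UNIV) f"
    by (rule gf_insert[OF fin]) auto
  also have "gf nodes (case_prod Node ` UNIV) f = gf (\<lambda>x. Suc (?sz x)) UNIV (\<lambda>x. f (case_prod Node x))"
    by (rule gf_bij) (auto simp: bij_betw_def inj_on_def)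
  also have "\<dots> = fps_X * gf ?sz UNIV (\<lambda>x. f (case_prod Node x))" by (rule gf_Suc)
  also have "(\<lambda>x. f (case_prod Node x)) = (\<lambda>(P, Q). f (Node P Q))" by auto
  finally show ?thesis .
qed

definition slot_op :: "real fps \<Rightarrow> real fps" where
  "slot_op F = euler_op F + F"

text \<open>The number of admissible positions \<open>j\<close> at which the levels of \<open>P\<close> can be cut.\<close>

definition slots :: "btree \<Rightarrow> real" where
  "slots P = real (nodes P) + 1"

lemma tree_gf_slots: "tree_gf (\<lambda>P. slots P * f P) = slot_op (tree_gf f)"
  by (simp add: slots_def slot_op_def ring_distribs gf_add gf_size)

subsection \<open>The uniformizing series\<close>

text \<open>The Catalan series \<open>c\<close>, the series \<open>(1 - 4 * X) powr (- 1 / 2)\<close> of central binomial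
coefficients, and the parameter \<open>u\<close> that makes all of them rational: \<open>X = u * (1 + u) / (1 + 2 *
u)\<^sup>2\<close> and \<open>c = (1 + 2 * u) / (1 + u)\<close>.\<close>

definition catalan :: "real fps" where "catalan = tree_gf (\<lambda>_. 1)"
definition central :: "real fps" where "central = slot_op catalan"
definition unif :: "real fps" where "unif = fps_X * catalan * central"

lemma euler_op_add: "euler_op (F + G) = euler_op F + euler_op G"
  by (simp add: euler_op_def algebra_simps)
lemma euler_op_mult: "euler_op (F * G) = euler_op F * G + F * euler_op G"
  by (simp add: euler_op_def algebra_simps)
lemma euler_op_X: "euler_op fps_X = fps_X"
  by (simp add: euler_op_def)
lemma euler_op_numeral: "euler_op (numeral k) = 0" "euler_op 1 = 0" "euler_op 0 = 0"
  by (simp_all add: euler_op_def)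
lemma euler_op_of_int: "euler_op (of_int k) = 0"
  by (simp add: euler_op_def fps_of_int[symmetric])

lemma catalan_rec: "catalan = 1 + fps_X * (catalan * catalan)"
  using tree_gf_rec[of "\<lambda>_. 1"] pair_gf_prod[of "\<lambda>_. 1" "\<lambda>_. 1"] by (simp add: catalan_def)

lemma central_inverse: "central * (1 - 2 * (fps_X * catalan)) = 1"
proof -
  have "euler_op catalan = fps_X * (catalan * catalan) + fps_X * (2 * catalan * euler_op catalan)"
    by (subst catalan_rec) (simp add: euler_op_add euler_op_mult euler_op_X euler_op_numeral algebra_simps)
  then show ?thesis unfolding central_def slot_op_def using catalan_rec by algebra
qed

lemma central_unif: "central = 1 + 2 * unif"
  using central_inverse unfolding unif_def by algebra

lemma X_central_square: "fps_X * central\<^sup>2 = unif * (1 + unif)"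
  using central_inverse catalan_rec unfolding unif_def by algebra

lemma catalan_unif: "catalan * (1 + unif) = central"
  using central_inverse catalan_rec unfolding unif_def by algebra

lemma X_catalan_central: "fps_X * catalan * central = unif"
  by (simp add: unif_def)

lemma central_nonzero: "central \<noteq> 0"
  using central_inverse by auto

text \<open>Apply the Euler operator to \<open>X * (1 + 2 * u)\<^sup>2 = u * (1 + u)\<close>. The result keeps polynomials
in \<open>u\<close> stable under the operators that insert factors \<open>nodes\<close> into a moment.\<close>

lemma euler_op_unif: "euler_op unif = unif * (1 + unif) * (1 + 2 * unif)"
proof -
  have "euler_op (fps_X * (1 + 2 * unif)\<^sup>2) = euler_op (unif * (1
      + unif))" using X_central_square central_unif by simp
  then have a: "fps_X * (1 + 2 * unif)\<^sup>2 + fps_X * (4 * (1 + 2 * unif) * euler_op unif) =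
      euler_op unif * (1 + 2 * unif)"
    by (simp add: euler_op_add euler_op_mult euler_op_X euler_op_numeral power2_eq_square algebra_simps)
  have X: "fps_X * (1 + 2 * unif)\<^sup>2 = unif * (1 + unif)" using X_central_square central_unif by simp
  have "central * (euler_op unif - unif * (1 + unif) * (1 + 2 * unif)) = 0"
    unfolding central_unif using a X by algebra
  then show ?thesis using central_nonzero by simp
qed

text \<open>The moments turn out to be integer polynomials in \<open>unif\<close>. Writing them as values of this
evaluation homomorphism reduces identities between series to computations with integer
polynomials.\<close>

definition upoly :: "int poly \<Rightarrow> real fps" where
  "upoly p = poly (map_poly of_int p) unif"

lemma upoly_pCons: "upoly (pCons a p) = of_int a + unif * upoly p"
  by (simp add: upoly_def map_poly_pCons)

lemma upoly_0 [simp]: "upoly 0 = 0" and upoly_1 [simp]: "upoly 1 = 1"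
  by (simp_all add: upoly_def)

lemma central_upoly: "central = upoly [:1, 2:]"
  by (simp add: upoly_pCons central_unif)

lemma upoly_add: "upoly p + upoly r = upoly (p + r)"
proof (induction p r rule: poly_induct2)
  case (pCons a p b r)
  have "upoly (pCons a p) + upoly (pCons b r) = of_int (a + b) + unif * (upoly p + upoly r)"
    by (simp add: upoly_pCons algebra_simps)
  then show ?case by (simp add: pCons upoly_pCons)
qed simp

lemma upoly_smult: "of_int c * upoly p = upoly (smult c p)"
  by (induction p) (simp_all add: upoly_pCons algebra_simps)

lemma upoly_numeral_mult: "numeral k * upoly p = upoly (smult (numeral k) p)"
  using upoly_smult[of "numeral k" p] by simp

lemma upoly_uminus: "- upoly p = upoly (- p)"
  using upoly_smult[of "- 1" p] by simp

lemma upoly_diff: "upoly p - upoly r = upoly (p - r)"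
  using upoly_add[of p "- r"] by (simp add: upoly_uminus[symmetric])

lemma upoly_mult: "upoly p * upoly r = upoly (p * r)"
proof (induction p)
  case (pCons a p)
  have "upoly (pCons a p) * upoly r = of_int a * upoly r + unif * (upoly p * upoly r)"
    by (simp add: upoly_pCons algebra_simps)
  also have "\<dots> = upoly (smult a r) + upoly (pCons 0 (p * r))"
    by (simp add: upoly_smult pCons.IH upoly_pCons)
  finally show ?case by (simp add: upoly_add)
qed simp

lemma euler_op_upoly: "euler_op (upoly p) = upoly (pderiv p * [:0, 1, 3, 2:])"
proof (induction p)
  case (pCons a p)
  have q: "upoly [:0, 1, 3, 2:] = unif * (1 + unif) * (1 + 2 * unif)"
    by (simp add: upoly_pCons algebra_simps)
  have "euler_op (upoly (pCons a p)) = upoly [:0, 1, 3, 2:] * upoly p + unif * upoly (pderiv p * [:0, 1,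
      3, 2:])"
    unfolding upoly_pCons euler_op_add euler_op_mult euler_op_of_int euler_op_unif pCons.IH
        by (simp add: algebra_simps)
  also have "\<dots> = upoly ([:0, 1, 3, 2:] * p + pCons 0 (pderiv p * [:0, 1, 3, 2:]))"
  proof -
    have shift: "unif * upoly r = upoly (pCons 0 r)" for r by (simp add: upoly_pCons)
    show ?thesis unfolding upoly_mult shift upoly_add ..
  qed
  also have "[:0, 1, 3, 2:] * p + pCons 0 (pderiv p * [:0, 1, 3, 2:]) = pderiv (pCons a p) * [:0, 1, 3, 2:]"
    unfolding pderiv_pCons distrib_right mult_pCons_left[of 0 "pderiv p"]
    by (simp only: smult_0_left add_0 mult.commute)
  finally show ?case .
qed (simp add: euler_op_numeral)

lemma slot_op_upoly: "slot_op (upoly p) = upoly (pderiv p * [:0, 1, 3, 2:] + p)"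
  by (simp add: slot_op_def euler_op_upoly upoly_add)

lemma slot_op_catalan: "slot_op catalan = upoly [:1, 2:]"
  by (simp add: central_def[symmetric] central_upoly)

lemmas upoly_arith = upoly_add upoly_diff upoly_mult upoly_numeral_mult slot_op_upoly euler_op_upoly
    pderiv_pCons slot_op_catalan

text \<open>A root recursion contains the unknown twice, once for each subtree, multiplied by \<open>X * c\<close>.
Since \<open>1 - 2 * X * c\<close> is invertible the solution is unique, and multiplying by \<open>(1 + 2 * u)\<^sup>2\<close>
removes \<open>X\<close> and \<open>c\<close> from the equation, so that a proposed solution is verified in the ring of
polynomials.\<close>

lemma tree_solve:
  assumes "S = fps_X * (catalan * (upoly low + 2 * S) + upoly rest)"
    and "[:1, 2:] * p = [:0, 1:] * [:1, 2:] * low + [:0, 1, 1:] * rest"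
  shows "S = upoly p"
proof -
  have p: "central * upoly p = unif * central * upoly low + unif * (1 + unif) * upoly rest"
    using arg_cong[OF assms(2), of upoly] by (simp only: upoly_add[symmetric] upoly_mult[symmetric])
      (simp add: upoly_pCons algebra_simps central_unif)
  have "central\<^sup>2 * S = (fps_X * catalan * central) * central * (upoly low + 2 * S)
      + (fps_X * central\<^sup>2) * upoly rest"
    by (subst assms(1)) algebra
  then have "central\<^sup>2 * S = central * upoly p + 2 * unif * central * S"
    unfolding X_catalan_central X_central_square using p by algebra
  then have "central * (S - upoly p) = 0" unfolding central_unif by algebra
  then show ?thesis using central_nonzero by simp
qed

subsection \<open>Reversal\<close>

fun graft :: "btree \<Rightarrow> btree \<Rightarrow> btree" where
  "graft Leaf R = R"
| "graft (Node P Q) R = Node P (graft Q R)"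

text \<open>A tree encodes the Dyck path that goes up, traverses the left subtree, goes down and
traverses the right subtree. This is the tree of the reversed path.\<close>

fun mirror :: "btree \<Rightarrow> btree" where
  "mirror Leaf = Leaf"
| "mirror (Node P Q) = graft (mirror Q) (Node (mirror P) Leaf)"

lemma graft_Leaf [simp]: "graft P Leaf = P"
  by (induction P) auto

lemma graft_assoc: "graft (graft P Q) R = graft P (graft Q R)"
  by (induction P) auto

lemma graft_stats [simp]:
  "nodes (graft P R) = nodes P + nodes R"
  "area (graft P R) = area P + area R"
  "sqarea (graft P R) = sqarea P + sqarea R"
  by (induction P) auto

lemma torque_graft:
  "torque (graft P R) = torque P + torque R + real (nodes P) * area R - real (nodes R) * area P"
  by (induction P) (auto simp: algebra_simps)

lemma mirror_graft: "mirror (graft P R) = graft (mirror R) (mirror P)"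
  by (induction P) (auto simp: graft_assoc)

lemma mirror_mirror [simp]: "mirror (mirror P) = P"
  by (induction P) (auto simp: mirror_graft)

lemma mirror_stats [simp]:
  "nodes (mirror P) = nodes P" "area (mirror P) = area P" "sqarea (mirror P) = sqarea P"
proof -
  show n: "nodes (mirror P) = nodes P" for P by (induction P) auto
  show a: "area (mirror P) = area P" for P by (induction P) (auto simp: n)
  show "sqarea (mirror P) = sqarea P" by (induction P) (auto simp: n a)
qed

lemma torque_mirror: "torque (mirror P) = - torque P"
  by (induction P) (auto simp: torque_graft algebra_simps)

lemma bij_mirror: "bij mirror"
  by (rule bijI') (metis mirror_mirror)+

lemma tree_gf_torque: "(\<And>P. f (mirror P) = f P) \<Longrightarrow> tree_gf (\<lambda>P. torque P * f P) = 0"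
  by (rule gf_antisymmetric[OF bij_mirror]) (auto simp: torque_mirror)

subsection \<open>Moments of the tree statistics\<close>

lemma gf_sum: "gf sz S (\<lambda>x. \<Sum>i\<in>I. f i x) = (\<Sum>i\<in>I. gf sz S (f i))"
  by (simp add: fps_eq_iff gf_nth fps_sum_nth sum.swap[of _ I])

text \<open>The contribution of a root together with its left subtree \<open>P\<close>, which sits one level higher.\<close>

definition raised_area :: "btree \<Rightarrow> real" where
  "raised_area P = area P + slots P"

text \<open>The analogue of \<open>raised_area\<close> for \<open>sqarea\<close>, by expanding \<open>(x + 1)\<^sup>2\<close>.\<close>

definition raised_sqarea :: "btree \<Rightarrow> real" where
  "raised_sqarea P = sqarea P + 2 * area P + slots P"

definition moment :: "nat \<Rightarrow> nat \<Rightarrow> real fps" where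
  "moment i k = tree_gf (\<lambda>P. area P ^ i * sqarea P ^ k)"

definition raised_moment :: "nat \<Rightarrow> nat \<Rightarrow> real fps" where
  "raised_moment i k = tree_gf (\<lambda>P. raised_area P ^ i * raised_sqarea P ^ k)"

lemma binomial_product:
  "(x + y) ^ i * (u + v) ^ k = (\<Sum>a\<le>i. \<Sum>b\<le>k. real (i choose a) * real (k choose b) *
     ((x ^ a * u ^ b) * (y ^ (i - a) * v ^ (k - b))))" for x y u v :: real
  by (simp only: binomial_ring sum_product) (simp add: mult_ac)

text \<open>Both statistics of a tree are sums of a contribution of the root with its left subtree and a
contribution of the right subtree, so that the moments multiply by the binomial theorem.\<close>

lemma moment_rec:
  "moment i k = fps_const (0 ^ i * 0 ^ k) + fps_X * (\<Sum>a\<le>i. \<Sum>b\<le>k.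
     fps_const (real (i choose a) * real (k choose b)) * (raised_moment a b * moment (i - a) (k - b)))"
proof -
  have "area (Node P Q) ^ i * sqarea (Node P Q) ^ k = (\<Sum>a\<le>i. \<Sum>b\<le>k.
      real (i choose a) * real (k choose b) * ((raised_area P ^ a * raised_sqarea P ^ b) *
        (area Q ^ (i - a) * sqarea Q ^ (k - b))))" for P Q
    unfolding binomial_product[symmetric]
    by (simp add: raised_area_def raised_sqarea_def slots_def algebra_simps)
  then have "pair_gf (\<lambda>P Q. area (Node P Q) ^ i * sqarea (Node P Q) ^ k) = (\<Sum>a\<le>i. \<Sum>b\<le>k.
      fps_const (real (i choose a) * real (k choose b)) * pair_gf (\<lambda>P Q.
        (raised_area P ^ a * raised_sqarea P ^ b) * (area Q ^ (i - a) * sqarea Q ^ (k - b))))"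
    by (simp only: split_def gf_sum gf_scale)
  then show ?thesis
    unfolding moment_def raised_moment_def by (subst tree_gf_rec) (simp only: pair_gf_prod area.simps
        sqarea.simps)
qed

lemma sum_atMost_small:
  "(\<Sum>a\<le>(0::nat). f a) = f 0"
  "(\<Sum>a\<le>(1::nat). f a) = f 0 + f 1"
  "(\<Sum>a\<le>(2::nat). f a) = f 0 + f 1 + f 2"
  "(\<Sum>a\<le>(3::nat). f a) = f 0 + f 1 + f 2 + f 3"
  "(\<Sum>a\<le>(4::nat). f a) = f 0 + f 1 + f 2 + f 3 + f 4"
  for f :: "nat \<Rightarrow> 'a::comm_monoid_add"
  by (simp_all add: eval_nat_numeral)

lemma choose_small:
  "(2::nat) choose 1 = 2" "(3::nat) choose 1 = 3" "(3::nat) choose 2 = 3"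
  "(4::nat) choose 1 = 4" "(4::nat) choose 2 = 6" "(4::nat) choose 3 = 4"
  by (simp_all add: eval_nat_numeral)

named_theorems moment_values

definition monomial :: "nat \<Rightarrow> nat \<Rightarrow> btree \<Rightarrow> real" where
  "monomial i k P = area P ^ i * sqarea P ^ k"

lemma moment_mono: "tree_gf (monomial i k) = moment i k"
  unfolding moment_def by (rule gf_cong) (simp add: monomial_def)

lemma moment_00 [moment_values]: "moment 0 0 = catalan" and raised_00: "raised_moment 0 0 = catalan"
  by (simp_all add: moment_def raised_moment_def catalan_def)

lemmas moment_rec_simps = sum_atMost_small choose_small moment_00 raised_00
  numeral_fps_const[symmetric] One_nat_def[symmetric]

text \<open>For each pair of exponents the raised moment is the unraised one plus moments already known;
with this, the recursion becomes an instance of \<open>tree_solve\<close>.\<close>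

lemma raised_10_aux: "raised_moment 1 0 = moment 1 0 + upoly [:1, 2:]"
proof -
  have "raised_moment 1 0 = tree_gf (\<lambda>P. monomial 1 0 P + (slots P * monomial 0 0 P))"
    unfolding raised_moment_def raised_area_def raised_sqarea_def monomial_def by (intro gf_cong) algebra
  also have "\<dots> = moment 1 0 + (slot_op (moment 0 0))"
    by (simp only: gf_add gf_numeral tree_gf_slots moment_mono)
  finally show ?thesis by (simp add: moment_values upoly_arith del: One_nat_def)
qed

lemma moment_10 [moment_values]: "moment 1 0 = upoly [:0, 1, 2:]"
proof (rule tree_solve)
  have rest: "0 = upoly 0" (is "?sum = upoly ?rest") by simp
  have "moment 1 0 = fps_X * (catalan * moment 1 0 + ?sum + raised_moment 1 0 * catalan)"
    by (subst moment_rec) (simp add: moment_rec_simps algebra_simps del: One_nat_def)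
  then show "moment 1 0 = fps_X * (catalan * (upoly [:1, 2:] + 2 * moment 1 0) + upoly ?rest)"
    unfolding rest raised_10_aux by (simp add: algebra_simps)
qed simp

lemma raised_10 [moment_values]: "raised_moment 1 0 = upoly [:1, 3, 2:]"
  by (simp add: raised_10_aux moment_10 upoly_arith del: One_nat_def)

lemma raised_20_aux: "raised_moment 2 0 = moment 2 0 + upoly [:1, 8, 24, 32, 16:]"
proof -
  have "raised_moment 2 0 = tree_gf (\<lambda>P. monomial 2 0 P + (2 * (slots P * monomial 1 0 P)
      + slots P * (slots P * monomial 0 0 P)))"
    unfolding raised_moment_def raised_area_def raised_sqarea_def monomial_def by (intro gf_cong) algebra
  also have "\<dots> = moment 2 0 + (2 * slot_op (moment 1 0) + slot_op (slot_op (moment 0 0)))"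
    by (simp only: gf_add gf_numeral tree_gf_slots moment_mono)
  finally show ?thesis by (simp add: moment_values upoly_arith del: One_nat_def)
qed

lemma moment_20 [moment_values]: "moment 2 0 = upoly [:0, 1, 10, 32, 42, 20:]"
proof (rule tree_solve)
  have rest: "2 * (raised_moment 1 0 * moment 1 0) = upoly [:0, 2, 10, 16, 8:]"
    (is "?sum = upoly ?rest")
    by (simp add: moment_values upoly_arith del: One_nat_def)
  have "moment 2 0 = fps_X * (catalan * moment 2 0 + ?sum + raised_moment 2 0 * catalan)"
    by (subst moment_rec) (simp add: moment_rec_simps algebra_simps del: One_nat_def)
  then show "moment 2 0 = fps_X * (catalan * (upoly [:1, 8, 24, 32, 16:] + 2 * moment 2 0) + upoly ?rest)"
    unfolding rest raised_20_aux by (simp add: algebra_simps)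
qed simp

lemma raised_20 [moment_values]: "raised_moment 2 0 = upoly [:1, 9, 34, 64, 58, 20:]"
  by (simp add: raised_20_aux moment_20 upoly_arith del: One_nat_def)

lemma raised_30_aux: "raised_moment 3 0 = moment 3 0 + upoly [:1, 26, 228, 972, 2280, 3012, 2100, 600:]"
proof -
  have "raised_moment 3 0 = tree_gf (\<lambda>P. monomial 3 0 P + (3 * (slots P * monomial 2 0 P)
      + 3 * (slots P * (slots P * monomial 1 0 P)) + slots P * (slots P * (slots P * monomial 0 0 P))))"
    unfolding raised_moment_def raised_area_def raised_sqarea_def monomial_def by (intro gf_cong) algebra
  also have "\<dots> = moment 3 0 + (3 * slot_op (moment 2 0) + 3 * slot_op (slot_op (moment 1 0))
      + slot_op (slot_op (slot_op (moment 0 0))))"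
    by (simp only: gf_add gf_numeral tree_gf_slots moment_mono)
  finally show ?thesis by (simp add: moment_values upoly_arith del: One_nat_def)
qed

lemma moment_30 [moment_values]: "moment 3 0 = upoly [:0, 1, 32, 294, 1260, 2922, 3786, 2580, 720:]"
proof (rule tree_solve)
  have rest: "3 * (raised_moment 1 0 * moment 2 0) + (3 * (raised_moment 2 0 * moment 1 0)) = upoly [:0,
      6, 72, 348, 870, 1188, 840, 240:]"
    (is "?sum = upoly ?rest")
    by (simp add: moment_values upoly_arith del: One_nat_def)
  have "moment 3 0 = fps_X * (catalan * moment 3 0 + ?sum + raised_moment 3 0 * catalan)"
    by (subst moment_rec) (simp add: moment_rec_simps algebra_simps del: One_nat_def)
  then show "moment 3 0 = fps_X * (catalan * (upoly [:1, 26, 228, 972, 2280, 3012, 2100, 600:]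
      + 2 * moment 3 0) + upoly ?rest)"
    unfolding rest raised_30_aux by (simp add: algebra_simps)
qed simp

lemma raised_30 [moment_values]: "raised_moment 3 0 = upoly [:1, 27, 260, 1266, 3540, 5934, 5886, 3180,
    720:]"
  by (simp add: raised_30_aux moment_30 upoly_arith del: One_nat_def)

lemma raised_40_aux: "raised_moment 4 0 = moment 4 0 + upoly [:1, 80, 1584, 14336, 73120, 230592,
    467520, 611328, 498432, 230400, 46080:]"
proof -
  have "raised_moment 4 0 = tree_gf (\<lambda>P. monomial 4 0 P + (4 * (slots P * monomial 3 0 P)
      + 6 * (slots P * (slots P * monomial 2 0 P)) + 4 * (slots P * (slots P * (slots P * monomial 1 0
      P))) + slots P * (slots P * (slots P * (slots P * monomial 0 0 P)))))"
    unfolding raised_moment_def raised_area_def raised_sqarea_def monomial_def by (intro gf_cong) algebra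
  also have "\<dots> = moment 4 0 + (4 * slot_op (moment 3 0) + 6 * slot_op (slot_op (moment 2 0))
      + 4 * slot_op (slot_op (slot_op (moment 1 0))) + slot_op (slot_op (slot_op (slot_op (moment 0 0)))))"
    by (simp only: gf_add gf_numeral tree_gf_slots moment_mono)
  finally show ?thesis by (simp add: moment_values upoly_arith del: One_nat_def)
qed

lemma moment_40 [moment_values]: "moment 4 0 = upoly [:0, 1, 94, 1940, 17754, 90416, 282924, 567288,
    732360, 589128, 268680, 53040:]"
proof (rule tree_solve)
  have rest: "4 * (raised_moment 1 0 * moment 3 0) + (6 * (raised_moment 2 0 * moment 2 0)
      + (4 * (raised_moment 3 0 * moment 1 0))) = upoly [:0, 14, 370, 3760, 20372, 66552, 137880,
      182688, 150072, 69600, 13920:]"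
    (is "?sum = upoly ?rest")
    by (simp add: moment_values upoly_arith del: One_nat_def)
  have "moment 4 0 = fps_X * (catalan * moment 4 0 + ?sum + raised_moment 4 0 * catalan)"
    by (subst moment_rec) (simp add: moment_rec_simps algebra_simps del: One_nat_def)
  then show "moment 4 0 = fps_X * (catalan * (upoly [:1, 80, 1584, 14336, 73120, 230592, 467520, 611328,
      498432, 230400, 46080:] + 2 * moment 4 0) + upoly ?rest)"
    unfolding rest raised_40_aux by (simp add: algebra_simps)
qed simp

lemma raised_01_aux: "raised_moment 0 1 = moment 0 1 + upoly [:1, 4, 4:]"
proof -
  have "raised_moment 0 1 = tree_gf (\<lambda>P. monomial 0 1 P + (2 * monomial 1 0 P + slots P * monomial 0 0 P))"
    unfolding raised_moment_def raised_area_def raised_sqarea_def monomial_def by (intro gf_cong) algebra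
  also have "\<dots> = moment 0 1 + (2 * moment 1 0 + slot_op (moment 0 0))"
    by (simp only: gf_add gf_numeral tree_gf_slots moment_mono)
  finally show ?thesis by (simp add: moment_values upoly_arith del: One_nat_def)
qed

lemma moment_01 [moment_values]: "moment 0 1 = upoly [:0, 1, 4, 4:]"
proof (rule tree_solve)
  have rest: "0 = upoly 0" (is "?sum = upoly ?rest") by simp
  have "moment 0 1 = fps_X * (catalan * moment 0 1 + ?sum + raised_moment 0 1 * catalan)"
    by (subst moment_rec) (simp add: moment_rec_simps algebra_simps del: One_nat_def)
  then show "moment 0 1 = fps_X * (catalan * (upoly [:1, 4, 4:] + 2 * moment 0 1) + upoly ?rest)"
    unfolding rest raised_01_aux by (simp add: algebra_simps)
qed simp

lemma raised_01 [moment_values]: "raised_moment 0 1 = upoly [:1, 5, 8, 4:]"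
  by (simp add: raised_01_aux moment_01 upoly_arith del: One_nat_def)

lemma raised_11_aux: "raised_moment 1 1 = moment 1 1 + upoly [:1, 14, 68, 152, 160, 64:]"
proof -
  have "raised_moment 1 1 = tree_gf (\<lambda>P. monomial 1 1 P + (2 * monomial 2 0 P
      + 3 * (slots P * monomial 1 0 P) + slots P * monomial 0 1 P + slots P * (slots P * monomial 0 0 P)))"
    unfolding raised_moment_def raised_area_def raised_sqarea_def monomial_def by (intro gf_cong) algebra
  also have "\<dots> = moment 1 1 + (2 * moment 2 0 + 3 * slot_op (moment 1 0) + slot_op (moment 0 1)
      + slot_op (slot_op (moment 0 0)))"
    by (simp only: gf_add gf_numeral tree_gf_slots moment_mono)
  finally show ?thesis by (simp add: moment_values upoly_arith del: One_nat_def)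
qed

lemma moment_11 [moment_values]: "moment 1 1 = upoly [:0, 1, 16, 80, 178, 184, 72:]"
proof (rule tree_solve)
  have rest: "raised_moment 0 1 * moment 1 0 + (raised_moment 1 0 * moment 0 1) = upoly [:0, 2, 14, 36,
      40, 16:]"
    (is "?sum = upoly ?rest")
    by (simp add: moment_values upoly_arith del: One_nat_def)
  have "moment 1 1 = fps_X * (catalan * moment 1 1 + ?sum + raised_moment 1 1 * catalan)"
    by (subst moment_rec) (simp add: moment_rec_simps algebra_simps del: One_nat_def)
  then show "moment 1 1 = fps_X * (catalan * (upoly [:1, 14, 68, 152, 160, 64:] + 2 * moment 1 1)
      + upoly ?rest)"
    unfolding rest raised_11_aux by (simp add: algebra_simps)
qed simp

lemma raised_11 [moment_values]: "raised_moment 1 1 = upoly [:1, 15, 84, 232, 338, 248, 72:]"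
  by (simp add: raised_11_aux moment_11 upoly_arith del: One_nat_def)

lemma raised_21_aux: "raised_moment 2 1 = moment 2 1 + upoly [:1, 44, 544, 3152, 10124, 19128, 21160,
    12672, 3168:]"
proof -
  have "raised_moment 2 1 = tree_gf (\<lambda>P. monomial 2 1 P + (2 * monomial 3 0 P
      + 5 * (slots P * monomial 2 0 P) + 2 * (slots P * monomial 1 1 P)
      + 4 * (slots P * (slots P * monomial 1 0 P)) + slots P * (slots P * monomial 0 1 P)
      + slots P * (slots P * (slots P * monomial 0 0 P))))"
    unfolding raised_moment_def raised_area_def raised_sqarea_def monomial_def by (intro gf_cong) algebra
  also have "\<dots> = moment 2 1 + (2 * moment 3 0 + 5 * slot_op (moment 2 0) + 2 * slot_op (moment 1 1)
      + 4 * slot_op (slot_op (moment 1 0)) + slot_op (slot_op (moment 0 1))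
      + slot_op (slot_op (slot_op (moment 0 0))))"
    by (simp only: gf_add gf_numeral tree_gf_slots moment_mono)
  finally show ?thesis by (simp add: moment_values upoly_arith del: One_nat_def)
qed

lemma moment_21 [moment_values]: "moment 2 1 = upoly [:0, 1, 50, 638, 3716, 11870, 22194, 24244, 14328,
    3536:]"
proof (rule tree_solve)
  have rest: "raised_moment 0 1 * moment 2 0 + (2 * (raised_moment 1 0 * moment 1 1)
      + (2 * (raised_moment 1 1 * moment 1 0) + (raised_moment 2 0 * moment 0 1))) = upoly [:0, 6, 100,
      652, 2222, 4336, 4880, 2944, 736:]"
    (is "?sum = upoly ?rest")
    by (simp add: moment_values upoly_arith del: One_nat_def)
  have "moment 2 1 = fps_X * (catalan * moment 2 1 + ?sum + raised_moment 2 1 * catalan)"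
    by (subst moment_rec) (simp add: moment_rec_simps algebra_simps del: One_nat_def)
  then show "moment 2 1 = fps_X * (catalan * (upoly [:1, 44, 544, 3152, 10124, 19128, 21160, 12672,
      3168:] + 2 * moment 2 1) + upoly ?rest)"
    unfolding rest raised_21_aux by (simp add: algebra_simps)
qed simp

lemma raised_02_aux: "raised_moment 0 2 = moment 0 2 + upoly [:1, 24, 176, 592, 1016, 864, 288:]"
proof -
  have "raised_moment 0 2 = tree_gf (\<lambda>P. monomial 0 2 P + (4 * monomial 1 1 P
      + 2 * (slots P * monomial 0 1 P) + 4 * monomial 2 0 P + 4 * (slots P * monomial 1 0 P)
      + slots P * (slots P * monomial 0 0 P)))"
    unfolding raised_moment_def raised_area_def raised_sqarea_def monomial_def by (intro gf_cong) algebra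
  also have "\<dots> = moment 0 2 + (4 * moment 1 1 + 2 * slot_op (moment 0 1) + 4 * moment 2 0
      + 4 * slot_op (moment 1 0) + slot_op (slot_op (moment 0 0)))"
    by (simp only: gf_add gf_numeral tree_gf_slots moment_mono)
  finally show ?thesis by (simp add: moment_values upoly_arith del: One_nat_def)
qed

lemma moment_02 [moment_values]: "moment 0 2 = upoly [:0, 1, 26, 192, 642, 1092, 920, 304:]"
proof (rule tree_solve)
  have rest: "2 * (raised_moment 0 1 * moment 0 1) = upoly [:0, 2, 18, 64, 112, 96, 32:]"
    (is "?sum = upoly ?rest")
    by (simp add: moment_values upoly_arith del: One_nat_def)
  have "moment 0 2 = fps_X * (catalan * moment 0 2 + ?sum + raised_moment 0 2 * catalan)"
    by (subst moment_rec) (simp add: moment_rec_simps algebra_simps del: One_nat_def)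
  then show "moment 0 2 = fps_X * (catalan * (upoly [:1, 24, 176, 592, 1016, 864, 288:]
      + 2 * moment 0 2) + upoly ?rest)"
    unfolding rest raised_02_aux by (simp add: algebra_simps)
qed simp

lemma euler_op_diff: "euler_op (F - G) = euler_op F - euler_op G"
  by (simp add: euler_op_def algebra_simps)

lemma euler_op_catalan: "euler_op catalan = central - catalan"
  by (simp add: central_def slot_op_def)

lemma tree_gf_moments:
  "tree_gf (\<lambda>_. 1) = catalan" "tree_gf (\<lambda>P. area P) = moment 1 0" "tree_gf (\<lambda>P. (area P)\<^sup>2) = moment 2 0"
  "tree_gf (\<lambda>P. raised_area P) = raised_moment 1 0" "tree_gf (\<lambda>P. (raised_area P)\<^sup>2) = raised_moment 2 0"
  by (simp_all add: moment_def raised_moment_def catalan_def)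

lemma slots_mirror: "slots (mirror P) = slots P" and raised_area_mirror: "raised_area (mirror P) =
    raised_area P"
  by (simp_all add: slots_def raised_area_def)

text \<open>In the square of the torque of a tree all products in which the torque of a subtree occurs
to the first power vanish by reversal. Besides the unknown itself only moments of order at most
two remain.\<close>

lemma tree_gf_torque_sq: "tree_gf (\<lambda>P. (torque P)\<^sup>2) = upoly [:0, 0, 0, 2, 18, 66, 126, 132, 72, 16:]"
proof (rule tree_solve)
  let ?V = "tree_gf (\<lambda>P. (torque P)\<^sup>2)"
  have sq: "(torque (Node P Q))\<^sup>2 = (torque P)\<^sup>2 * 1 + 1 * (torque Q)\<^sup>2 + 2 * (torque P * torque Q)
      + (slots P * (slots P * 1)) * (area Q)\<^sup>2 + (raised_area P)\<^sup>2 * (real (nodes Q) * (real (nodes Q) * 1))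
      - 2 * ((slots P * raised_area P) * (real (nodes Q) * area Q))
      + 2 * ((torque P * slots P) * area Q) - 2 * ((torque P * raised_area P) * real (nodes Q))
      + 2 * (slots P * (torque Q * area Q)) - 2 * (raised_area P * (torque Q * real (nodes Q)))" for P Q
    unfolding torque.simps raised_area_def slots_def by algebra
  have zero: "tree_gf torque = 0" "tree_gf (\<lambda>P. torque P * slots P) =
      0" "tree_gf (\<lambda>P. torque P * raised_area P) = 0"
    "tree_gf (\<lambda>P. torque P * area P) = 0" "tree_gf (\<lambda>P. torque P * real (nodes P)) = 0"
    using tree_gf_torque[of "\<lambda>_. 1"] by (simp_all add: tree_gf_torque slots_mirror raised_area_mirror)
  have "?V = fps_X * (?V * catalan + catalan * ?V + slot_op (slot_op catalan) * moment 2 0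
      + raised_moment 2 0 * euler_op (euler_op catalan)
          - 2 * (slot_op (raised_moment 1 0) * euler_op (moment 1 0)))"
    by (subst tree_gf_rec) (simp only: sq pair_gf_add pair_gf_diff pair_gf_numeral pair_gf_prod zero
      tree_gf_slots gf_size tree_gf_moments, simp)
  moreover have "euler_op (euler_op catalan) = euler_op central - central + catalan"
    by (simp add: euler_op_catalan euler_op_diff)
  ultimately have "?V = fps_X * (catalan * (raised_moment 2 0 + 2 * ?V) + (slot_op central * moment 2 0
      + raised_moment 2 0 * (euler_op central - central)
          - 2 * (slot_op (raised_moment 1 0) * euler_op (moment 1 0))))"
    unfolding central_def[symmetric] by algebra
  also have "slot_op central * moment 2 0 + raised_moment 2 0 * (euler_op central - central)
      - 2 * (slot_op (raised_moment 1 0) * euler_op (moment 1 0)) = upoly [:-1, -10, -40, -70, -14, 136,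
          208, 128, 32:]"
    by (simp add: moment_values central_upoly upoly_arith del: One_nat_def)
  finally show "?V = fps_X * (catalan * (upoly [:1, 9, 34, 64, 58, 20:] + 2 * ?V) + upoly [:-1, -10,
      -40, -70, -14, 136, 208, 128, 32:])"
    unfolding raised_20 .
qed simp

section \<open>Generating functions of lists of trees\<close>

text \<open>With this size an odd list of total length \<open>2 * m + 1\<close> has size \<open>m\<close>, and so has an even list
of total length \<open>2 * m\<close>.\<close>

definition forest_size :: "btree list \<Rightarrow> nat" where
  "forest_size Bs = forest_length Bs div 2"

text \<open>The parity of the number of trees is the parity of the total length. Lists with an odd and
with an even number of trees therefore have to be treated side by side.\<close>

lemma odd_forest_length: "odd (forest_length Bs) \<longleftrightarrow> odd (length Bs)"
  by (induction Bs) auto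

lemma forest_length_odd: "odd (length Bs) \<Longrightarrow> forest_length Bs = 2 * forest_size Bs + 1"
  unfolding forest_size_def using odd_forest_length[of Bs] by presburger

lemma forest_length_even: "even (length Bs) \<Longrightarrow> forest_length Bs = 2 * forest_size Bs"
  unfolding forest_size_def using odd_forest_length[of Bs] by presburger

lemma forest_size_Cons_even: "even (length R) \<Longrightarrow> forest_size (B # R) = nodes B + forest_size R"
  using forest_length_even[of R] by (simp add: forest_size_def)

lemma forest_size_Cons_odd: "odd (length R) \<Longrightarrow> forest_size (B # R) = Suc (nodes B + forest_size R)"
  using forest_length_odd[of R] by (simp add: forest_size_def)

abbreviation odd_gf :: "(btree list \<Rightarrow> real) \<Rightarrow> real fps" where
  "odd_gf \<equiv> gf forest_size {Bs. odd (length Bs)}"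

abbreviation even_gf :: "(btree list \<Rightarrow> real) \<Rightarrow> real fps" where
  "even_gf \<equiv> gf forest_size {Bs. even (length Bs)}"

lemma finite_fibres_forest: "finite_fibres forest_size S"
proof -
  have fin: "finite {Bs. forest_length Bs \<le> k}" for k
  proof (rule finite_subset)
    have trees: "finite {P. nodes P \<le> k}"
    proof (rule finite_subset)
      show "{P. nodes P \<le> k} \<subseteq> (\<Union>i\<le>k. {P \<in> UNIV. nodes P = i})" by auto
    qed (use finite_fibres_btree in \<open>simp add: finite_fibres_def\<close>)
    show "finite {Bs. set Bs \<subseteq> {P. nodes P \<le> k} \<and> length Bs \<le> k}"
      by (rule finite_lists_length_le[OF trees])
    have "length Bs \<le> forest_length Bs \<and> (\<forall>B\<in>set Bs. nodes B \<le> forest_length Bs)" for Bs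
      by (induction Bs) auto
    then show "{Bs. forest_length Bs \<le> k} \<subseteq> {Bs. set Bs \<subseteq> {P. nodes P \<le> k} \<and> length Bs \<le> k}"
      by (fastforce intro: order_trans)
  qed
  have "finite {Bs \<in> S. forest_size Bs = k}" for k
    by (rule finite_subset[OF _ fin[of "2 * k + 1"]]) (auto simp: forest_size_def)
  then show ?thesis by (simp add: finite_fibres_def)
qed

abbreviation cons_gf :: "btree list set \<Rightarrow> (btree \<Rightarrow> btree list \<Rightarrow> real) \<Rightarrow> real fps" where
  "cons_gf S F \<equiv> gf (\<lambda>(B, R). nodes B + forest_size R) (UNIV \<times> S) (\<lambda>(B, R). F B R)"

lemma cons_gf_prod: "cons_gf S (\<lambda>B R. f B * g R) = tree_gf f * gf forest_size S g"
  by (rule gf_prod[OF finite_fibres_btree finite_fibres_forest])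

lemma cons_gf_add: "cons_gf S (\<lambda>P Q. F P Q + G P Q) = cons_gf S F + cons_gf S G"
  by (simp add: split_def gf_add)

lemma cons_gf_diff: "cons_gf S (\<lambda>P Q. F P Q - G P Q) = cons_gf S F - cons_gf S G"
  by (simp add: split_def gf_diff)

lemma cons_gf_numeral: "cons_gf S (\<lambda>P Q. numeral c * F P Q) = numeral c * cons_gf S F"
  by (simp add: split_def gf_numeral)

lemma cons_gf_scale: "cons_gf S (\<lambda>P Q. c * F P Q) = fps_const c * cons_gf S F"
  by (simp add: split_def gf_scale)

lemma odd_gf_rec: "odd_gf f = cons_gf {Bs. even (length Bs)} (\<lambda>B R. f (B # R))"
proof -
  have "odd_gf f = gf (\<lambda>(B, R). nodes B + forest_size R) (UNIV \<times> {Bs. even (length Bs)})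
      (\<lambda>x. f (case_prod (#) x))"
  proof (rule gf_bij)
    show "bij_betw (case_prod (#)) (UNIV \<times> {Bs. even (length Bs)}) {Bs :: btree list. odd (length Bs)}"
    proof (rule bij_betw_imageI)
      have "Bs \<in> case_prod (#) ` (UNIV \<times> {Bs. even (length Bs)})" if "odd (length Bs)"
        for Bs :: "btree list"
        using that by (cases Bs) (auto simp: image_iff)
      then show "case_prod (#) ` (UNIV \<times> {Bs. even (length Bs)}) = {Bs :: btree list. odd (length Bs)}"
        by auto
    qed (auto simp: inj_on_def)
  qed (auto simp: forest_size_Cons_even)
  then show ?thesis by (simp add: split_def)
qed

lemma even_gf_rec: "even_gf f = fps_const (f []) + fps_X * cons_gf {Bs. odd (length Bs)} (\<lambda>B R. f (B # R))"
proof -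
  let ?N = "{Bs :: btree list. even (length Bs) \<and> Bs \<noteq> []}"
  have "even_gf f = gf forest_size (insert [] ?N) f" by (rule arg_cong[of _ _ "\<lambda>S. gf _ S _"]) auto
  also have "\<dots> = fps_const (f []) + gf forest_size ?N f"
    by (rule gf_insert[OF finite_fibres_forest]) (auto simp: forest_size_def)
  also have "gf forest_size ?N f = gf (\<lambda>x. Suc (case x of (B, R) \<Rightarrow> nodes B + forest_size R))
      (UNIV \<times> {Bs. odd (length Bs)}) (\<lambda>x. f (case_prod (#) x))"
  proof (rule gf_bij)
    show "bij_betw (case_prod (#)) (UNIV \<times> {Bs. odd (length Bs)}) ?N"
    proof (rule bij_betw_imageI)
      have "Bs \<in> case_prod (#) ` (UNIV \<times> {Bs. odd (length Bs)})" if "Bs \<in> ?N" for Bs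
        using that by (cases Bs) (auto simp: image_iff)
      then show "case_prod (#) ` (UNIV \<times> {Bs. odd (length Bs)}) = ?N" by auto
    qed (auto simp: inj_on_def)
  qed (auto simp: forest_size_Cons_odd)
  finally show ?thesis by (simp add: gf_Suc split_def)
qed

text \<open>Removing the first tree relates odd lists to even ones and vice versa. This pair of linear
equations has a unique solution, because \<open>1 - X * c\<^sup>2\<close> is invertible; as in \<open>tree_solve\<close>, the
series \<open>X\<close> and \<open>c\<close> are eliminated and a proposed pair of polynomials is verified.\<close>

lemma forest_solve:
  assumes "F = catalan * (E + upoly c) + upoly a" "E = fps_X * (catalan * (F + upoly d) + upoly b)"
    and "[:1, 1:] * po = [:1, 2:] * (pe + c) + [:1, 1:] * a"
    and "[:1, 2:] * [:1, 2:] * pe = [:0, 1:] * [:1, 2:] * (po + d) + [:0, 1, 1:] * b"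
  shows "F = upoly po" "E = upoly pe"
proof -
  have po: "(1 + unif) * upoly po = central * (upoly pe + upoly c) + (1 + unif) * upoly a"
    using arg_cong[OF assms(3), of upoly] by (simp only: upoly_add[symmetric] upoly_mult[symmetric])
      (simp add: upoly_pCons algebra_simps central_unif)
  have pe: "central * central * upoly pe = unif * central * (upoly po + upoly d) + unif * (1
      + unif) * upoly b"
    using arg_cong[OF assms(4), of upoly] by (simp only: upoly_add[symmetric] upoly_mult[symmetric])
      (simp add: upoly_pCons algebra_simps central_unif)
  have "(1 + unif) * F = catalan * (1 + unif) * (E + upoly c) + (1 + unif) * upoly a"
    by (subst assms(1)) algebra
  then have F: "(1 + unif) * (F - upoly po) = central * (E - upoly pe)"
    unfolding catalan_unif using po by algebra
  have "central * central * E = (fps_X * catalan * central) * central * (F + upoly d)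
      + (fps_X * central\<^sup>2) * upoly b"
    by (subst assms(2)) algebra
  then have E: "central * (central * (E - upoly pe)) = central * (unif * (F - upoly po))"
    unfolding X_catalan_central X_central_square using pe by algebra
  then have "central * (E - upoly pe) = unif * (F - upoly po)" using central_nonzero by simp
  then have "F - upoly po = 0" using F by algebra
  then show "F = upoly po" by simp
  then have "central * (E - upoly pe) = 0" using F by simp
  then show "E = upoly pe" using central_nonzero by simp
qed

definition odd_moment :: "nat \<Rightarrow> nat \<Rightarrow> real fps" where
  "odd_moment i k = odd_gf (\<lambda>Bs. forest_area Bs ^ i * forest_sqarea Bs ^ k)"

definition even_moment :: "nat \<Rightarrow> nat \<Rightarrow> real fps" where
  "even_moment i k = even_gf (\<lambda>Bs. forest_area Bs ^ i * forest_sqarea Bs ^ k)"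

definition forest_mono :: "nat \<Rightarrow> nat \<Rightarrow> btree list \<Rightarrow> real" where
  "forest_mono i k Bs = forest_area Bs ^ i * forest_sqarea Bs ^ k"

lemma cons_gf_moment:
  "cons_gf S (\<lambda>B R. forest_area (B # R) ^ i * forest_sqarea (B # R) ^ k) = (\<Sum>a\<le>i. \<Sum>b\<le>k.
     fps_const (real (i choose a) * real (k choose b)) * (moment a b *
       gf forest_size S (\<lambda>Bs. forest_area Bs ^ (i - a) * forest_sqarea Bs ^ (k - b))))"
proof -
  have "forest_area (B # R) ^ i * forest_sqarea (B # R) ^ k = (\<Sum>a\<le>i. \<Sum>b\<le>k.
      real (i choose a) * real (k choose b) * ((area B ^ a * sqarea B ^ b) *
        (forest_area R ^ (i - a) * forest_sqarea R ^ (k - b))))" for B R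
    unfolding binomial_product[symmetric] by simp
  then have "cons_gf S (\<lambda>B R. forest_area (B # R) ^ i * forest_sqarea (B # R) ^ k) = (\<Sum>a\<le>i. \<Sum>b\<le>k.
      fps_const (real (i choose a) * real (k choose b)) * cons_gf S (\<lambda>B R.
        (area B ^ a * sqarea B ^ b) * (forest_area R ^ (i - a) * forest_sqarea R ^ (k - b))))"
    by (simp only: split_def gf_sum gf_scale)
  then show ?thesis by (simp only: cons_gf_prod moment_def)
qed

lemma odd_moment_rec:
  "odd_moment i k = (\<Sum>a\<le>i. \<Sum>b\<le>k. fps_const (real (i choose a) * real (k choose b)) *
     (moment a b * even_moment (i - a) (k - b)))"
  unfolding odd_moment_def even_moment_def by (subst odd_gf_rec) (rule cons_gf_moment)

lemma even_moment_rec: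
  "even_moment i k = fps_const (0 ^ i * 0 ^ k) + fps_X * (\<Sum>a\<le>i. \<Sum>b\<le>k.
     fps_const (real (i choose a) * real (k choose b)) * (moment a b * odd_moment (i - a) (k - b)))"
  unfolding odd_moment_def even_moment_def
  by (subst even_gf_rec) (simp only: cons_gf_moment, simp)

lemma odd_moment_00 [moment_values]: "odd_moment 0 0 = upoly [:1,
    2:]" and even_moment_00 [moment_values]: "even_moment 0 0 = upoly [:1, 1:]"
proof -
  have F: "odd_moment 0 0 = catalan * even_moment 0 0"
    by (subst odd_moment_rec) (simp add: moment_00)
  have E: "even_moment 0 0 = 1 + fps_X * (catalan * odd_moment 0 0)"
    by (subst even_moment_rec) (simp add: moment_00)
  have "central * even_moment 0 0 = central + fps_X * catalan * central * odd_moment 0 0"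
    by (subst E) algebra
  then have "central * even_moment 0 0 = central + unif * odd_moment 0 0" unfolding X_catalan_central .
  moreover have "(1 + unif) * odd_moment 0 0 = central * even_moment 0 0"
    using F catalan_unif by algebra
  ultimately have "odd_moment 0 0 = central" by algebra
  then have "central * even_moment 0 0 = central * (1 + unif)"
    using \<open>(1 + unif) * odd_moment 0 0 = central * even_moment 0 0\<close> by (metis mult.commute)
  then have "even_moment 0 0 = 1 + unif" unfolding mult_left_cancel[OF central_nonzero] .
  then show "odd_moment 0 0 = upoly [:1, 2:]" "even_moment 0 0 = upoly [:1, 1:]"
    using \<open>odd_moment 0 0 = central\<close> by (simp_all add: central_upoly upoly_pCons)
qed

lemma odd_moment_10 [moment_values]: "odd_moment 1 0 = upoly [:0, 1, 5, 8, 4:]"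
    (is "_ = upoly ?po")
  and even_moment_10 [moment_values]: "even_moment 1 0 = upoly [:0, 0, 2, 4, 2:]"
    (is "_ = upoly ?pe")
proof -
  have a: "moment 1 0 * even_moment 0 0 = upoly [:0, 1, 3, 2:]"
    (is "_ = upoly ?pa")
    by (simp add: moment_values upoly_arith del: One_nat_def)
  have b: "moment 1 0 * odd_moment 0 0 = upoly [:0, 1, 4, 4:]"
    (is "_ = upoly ?pb")
    by (simp add: moment_values upoly_arith del: One_nat_def)
  have F: "odd_moment 1 0 = catalan * (even_moment 1 0 + upoly 0) + upoly ?pa"
    unfolding a[symmetric]
    by (subst odd_moment_rec) (simp add: moment_rec_simps algebra_simps del: One_nat_def)
  have E: "even_moment 1 0 = fps_X * (catalan * (odd_moment 1 0 + upoly 0) + upoly ?pb)"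
    unfolding b[symmetric]
    by (subst even_moment_rec) (simp add: moment_rec_simps algebra_simps del: One_nat_def)
  show "odd_moment 1 0 = upoly ?po" "even_moment 1 0 = upoly ?pe"
    by (rule forest_solve(1)[OF F E, where pe = ?pe], simp, simp)
      (rule forest_solve(2)[OF F E, where po = ?po], simp, simp)
qed

lemma odd_moment_20 [moment_values]: "odd_moment 2 0 = upoly [:0, 1, 13, 70, 190, 272, 196, 56:]"
    (is "_ = upoly ?po")
  and even_moment_20 [moment_values]: "even_moment 2 0 = upoly [:0, 0, 2, 22, 80, 130, 98, 28:]"
    (is "_ = upoly ?pe")
proof -
  have a: "2 * (moment 1 0 * even_moment 1 0) + (moment 2 0 * even_moment 0 0) = upoly [:0, 1, 11, 46,
      90, 82, 28:]"
    (is "_ = upoly ?pa")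
    by (simp add: moment_values upoly_arith del: One_nat_def)
  have b: "2 * (moment 1 0 * odd_moment 1 0) + (moment 2 0 * odd_moment 0 0) = upoly [:0, 1, 14, 66,
      142, 144, 56:]"
    (is "_ = upoly ?pb")
    by (simp add: moment_values upoly_arith del: One_nat_def)
  have F: "odd_moment 2 0 = catalan * (even_moment 2 0 + upoly 0) + upoly ?pa"
    unfolding a[symmetric]
    by (subst odd_moment_rec) (simp add: moment_rec_simps algebra_simps del: One_nat_def)
  have E: "even_moment 2 0 = fps_X * (catalan * (odd_moment 2 0 + upoly 0) + upoly ?pb)"
    unfolding b[symmetric]
    by (subst even_moment_rec) (simp add: moment_rec_simps algebra_simps del: One_nat_def)
  show "odd_moment 2 0 = upoly ?po" "even_moment 2 0 = upoly ?pe"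
    by (rule forest_solve(1)[OF F E, where pe = ?pe], simp, simp)
      (rule forest_solve(2)[OF F E, where po = ?po], simp, simp)
qed

lemma odd_moment_30 [moment_values]: "odd_moment 3 0 = upoly [:0, 1, 35, 410, 2452, 8610, 18774, 25728,
    21552, 10080, 2016:]"
    (is "_ = upoly ?po")
  and even_moment_30 [moment_values]: "even_moment 3 0 = upoly [:0, 0, 2, 70, 680, 3126, 7986, 12000,
      10560, 5040, 1008:]"
    (is "_ = upoly ?pe")
proof -
  have a: "3 * (moment 1 0 * even_moment 2 0) + (3 * (moment 2 0 * even_moment 1 0)
      + (moment 3 0 * even_moment 0 0)) = upoly [:0, 1, 33, 338, 1704, 4872, 8274, 8256, 4464, 1008:]"
    (is "_ = upoly ?pa")
    by (simp add: moment_values upoly_arith del: One_nat_def)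
  have b: "3 * (moment 1 0 * odd_moment 2 0) + (3 * (moment 2 0 * odd_moment 1 0)
      + (moment 3 0 * odd_moment 0 0)) = upoly [:0, 1, 40, 448, 2406, 7290, 13164, 14064, 8208, 2016:]"
    (is "_ = upoly ?pb")
    by (simp add: moment_values upoly_arith del: One_nat_def)
  have F: "odd_moment 3 0 = catalan * (even_moment 3 0 + upoly 0) + upoly ?pa"
    unfolding a[symmetric]
    by (subst odd_moment_rec) (simp add: moment_rec_simps algebra_simps del: One_nat_def)
  have E: "even_moment 3 0 = fps_X * (catalan * (odd_moment 3 0 + upoly 0) + upoly ?pb)"
    unfolding b[symmetric]
    by (subst even_moment_rec) (simp add: moment_rec_simps algebra_simps del: One_nat_def)
  show "odd_moment 3 0 = upoly ?po" "even_moment 3 0 = upoly ?pe"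
    by (rule forest_solve(1)[OF F E, where pe = ?pe], simp, simp)
      (rule forest_solve(2)[OF F E, where po = ?po], simp, simp)
qed

lemma odd_moment_40 [moment_values]: "odd_moment 4 0 = upoly [:0, 1, 97, 2266, 25030, 161468, 670096,
    1878848, 3639168, 4880640, 4451568, 2635200, 912912, 140448:]"
    (is "_ = upoly ?po")
  and even_moment_40 [moment_values]: "even_moment 4 0 = upoly [:0, 0, 2, 202, 4316, 40846, 216734,
      716260, 1550448, 2239272, 2141040, 1302192, 456456, 70224:]"
    (is "_ = upoly ?pe")
proof -
  have a: "4 * (moment 1 0 * even_moment 3 0) + (6 * (moment 2 0 * even_moment 2 0)
      + (4 * (moment 3 0 * even_moment 1 0) + (moment 4 0 * even_moment 0 0))) = upoly [:0, 1, 95, 2062,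
      20514, 116506, 416632, 982584, 1552464, 1627176, 1085448, 417048, 70224:]"
    (is "_ = upoly ?pa")
    by (simp add: moment_values upoly_arith del: One_nat_def)
  have b: "4 * (moment 1 0 * odd_moment 3 0) + (6 * (moment 2 0 * odd_moment 2 0)
      + (4 * (moment 3 0 * odd_moment 1 0) + (moment 4 0 * odd_moment 0 0))) = upoly [:0, 1, 110, 2562,
      26794, 159060, 594488, 1468896, 2440344, 2700600, 1909992, 781056, 140448:]"
    (is "_ = upoly ?pb")
    by (simp add: moment_values upoly_arith del: One_nat_def)
  have F: "odd_moment 4 0 = catalan * (even_moment 4 0 + upoly 0) + upoly ?pa"
    unfolding a[symmetric]
    by (subst odd_moment_rec) (simp add: moment_rec_simps algebra_simps del: One_nat_def)
  have E: "even_moment 4 0 = fps_X * (catalan * (odd_moment 4 0 + upoly 0) + upoly ?pb)"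
    unfolding b[symmetric]
    by (subst even_moment_rec) (simp add: moment_rec_simps algebra_simps del: One_nat_def)
  show "odd_moment 4 0 = upoly ?po" "even_moment 4 0 = upoly ?pe"
    by (rule forest_solve(1)[OF F E, where pe = ?pe], simp, simp)
      (rule forest_solve(2)[OF F E, where po = ?po], simp, simp)
qed

lemma odd_moment_01 [moment_values]: "odd_moment 0 1 = upoly [:0, 1, 7, 18, 20, 8:]"
    (is "_ = upoly ?po")
  and even_moment_01 [moment_values]: "even_moment 0 1 = upoly [:0, 0, 2, 8, 10, 4:]"
    (is "_ = upoly ?pe")
proof -
  have a: "moment 0 1 * even_moment 0 0 = upoly [:0, 1, 5, 8, 4:]"
    (is "_ = upoly ?pa")
    by (simp add: moment_values upoly_arith del: One_nat_def)
  have b: "moment 0 1 * odd_moment 0 0 = upoly [:0, 1, 6, 12, 8:]"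
    (is "_ = upoly ?pb")
    by (simp add: moment_values upoly_arith del: One_nat_def)
  have F: "odd_moment 0 1 = catalan * (even_moment 0 1 + upoly 0) + upoly ?pa"
    unfolding a[symmetric]
    by (subst odd_moment_rec) (simp add: moment_rec_simps algebra_simps del: One_nat_def)
  have E: "even_moment 0 1 = fps_X * (catalan * (odd_moment 0 1 + upoly 0) + upoly ?pb)"
    unfolding b[symmetric]
    by (subst even_moment_rec) (simp add: moment_rec_simps algebra_simps del: One_nat_def)
  show "odd_moment 0 1 = upoly ?po" "even_moment 0 1 = upoly ?pe"
    by (rule forest_solve(1)[OF F E, where pe = ?pe], simp, simp)
      (rule forest_solve(2)[OF F E, where po = ?po], simp, simp)
qed

lemma odd_moment_11 [moment_values]: "odd_moment 1 1 = upoly [:0, 1, 19, 136, 494, 1004, 1156, 704, 176:]"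
    (is "_ = upoly ?po")
  and even_moment_11 [moment_values]: "even_moment 1 1 = upoly [:0, 0, 2, 34, 180, 442, 558, 352, 88:]"
    (is "_ = upoly ?pe")
proof -
  have a: "moment 0 1 * even_moment 1 0 + (moment 1 0 * even_moment 0 1
      + (moment 1 1 * even_moment 0 0)) = upoly [:0, 1, 17, 100, 282, 414, 304, 88:]"
    (is "_ = upoly ?pa")
    by (simp add: moment_values upoly_arith del: One_nat_def)
  have b: "moment 0 1 * odd_moment 1 0 + (moment 1 0 * odd_moment 0 1 + (moment 1 1 * odd_moment 0 0)) =
      upoly [:0, 1, 20, 130, 402, 652, 536, 176:]"
    (is "_ = upoly ?pb")
    by (simp add: moment_values upoly_arith del: One_nat_def)
  have F: "odd_moment 1 1 = catalan * (even_moment 1 1 + upoly 0) + upoly ?pa"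
    unfolding a[symmetric]
    by (subst odd_moment_rec) (simp add: moment_rec_simps algebra_simps del: One_nat_def)
  have E: "even_moment 1 1 = fps_X * (catalan * (odd_moment 1 1 + upoly 0) + upoly ?pb)"
    unfolding b[symmetric]
    by (subst even_moment_rec) (simp add: moment_rec_simps algebra_simps del: One_nat_def)
  show "odd_moment 1 1 = upoly ?po" "even_moment 1 1 = upoly ?pe"
    by (rule forest_solve(1)[OF F E, where pe = ?pe], simp, simp)
      (rule forest_solve(2)[OF F E, where po = ?po], simp, simp)
qed

lemma odd_moment_21 [moment_values]: "odd_moment 2 1 = upoly [:0, 1, 53, 808, 6060, 26602, 73738,
    133052, 156060, 114760, 48048, 8736:]"
    (is "_ = upoly ?po")
  and even_moment_21 [moment_values]: "even_moment 2 1 = upoly [:0, 0, 2, 106, 1396, 8446, 28518, 58212,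
      73584, 56392, 24024, 4368:]"
    (is "_ = upoly ?pe")
proof -
  have a: "moment 0 1 * even_moment 2 0 + (2 * (moment 1 0 * even_moment 1 1)
      + (2 * (moment 1 1 * even_moment 1 0) + (moment 2 0 * even_moment 0 1
      + (moment 2 1 * even_moment 0 0)))) = upoly [:0, 1, 51, 700, 4560, 16864, 38066, 53476, 45628,
      21632, 4368:]"
    (is "_ = upoly ?pa")
    by (simp add: moment_values upoly_arith del: One_nat_def)
  have b: "moment 0 1 * odd_moment 2 0 + (2 * (moment 1 0 * odd_moment 1 1)
      + (2 * (moment 1 1 * odd_moment 1 0) + (moment 2 0 * odd_moment 0 1
      + (moment 2 1 * odd_moment 0 0)))) = upoly [:0, 1, 58, 856, 5922, 23242, 55884, 84092, 77320,
      39728, 8736:]"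
    (is "_ = upoly ?pb")
    by (simp add: moment_values upoly_arith del: One_nat_def)
  have F: "odd_moment 2 1 = catalan * (even_moment 2 1 + upoly 0) + upoly ?pa"
    unfolding a[symmetric]
    by (subst odd_moment_rec) (simp add: moment_rec_simps algebra_simps del: One_nat_def)
  have E: "even_moment 2 1 = fps_X * (catalan * (odd_moment 2 1 + upoly 0) + upoly ?pb)"
    unfolding b[symmetric]
    by (subst even_moment_rec) (simp add: moment_rec_simps algebra_simps del: One_nat_def)
  show "odd_moment 2 1 = upoly ?po" "even_moment 2 1 = upoly ?pe"
    by (rule forest_solve(1)[OF F E, where pe = ?pe], simp, simp)
      (rule forest_solve(2)[OF F E, where po = ?po], simp, simp)
qed

lemma odd_moment_02 [moment_values]: "odd_moment 0 2 = upoly [:0, 1, 29, 278, 1326, 3616, 5908, 5720,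
    3024, 672:]"
    (is "_ = upoly ?po")
  and even_moment_02 [moment_values]: "even_moment 0 2 = upoly [:0, 0, 2, 54, 408, 1426, 2674, 2780,
      1512, 336:]"
    (is "_ = upoly ?pe")
proof -
  have a: "2 * (moment 0 1 * even_moment 0 1) + (moment 0 2 * even_moment 0 0) = upoly [:0, 1, 27, 222,
      866, 1834, 2164, 1336, 336:]"
    (is "_ = upoly ?pa")
    by (simp add: moment_values upoly_arith del: One_nat_def)
  have b: "2 * (moment 0 1 * odd_moment 0 1) + (moment 0 2 * odd_moment 0 0) = upoly [:0, 1, 30, 266,
      1126, 2616, 3424, 2368, 672:]"
    (is "_ = upoly ?pb")
    by (simp add: moment_values upoly_arith del: One_nat_def)
  have F: "odd_moment 0 2 = catalan * (even_moment 0 2 + upoly 0) + upoly ?pa"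
    unfolding a[symmetric]
    by (subst odd_moment_rec) (simp add: moment_rec_simps algebra_simps del: One_nat_def)
  have E: "even_moment 0 2 = fps_X * (catalan * (odd_moment 0 2 + upoly 0) + upoly ?pb)"
    unfolding b[symmetric]
    by (subst even_moment_rec) (simp add: moment_rec_simps algebra_simps del: One_nat_def)
  show "odd_moment 0 2 = upoly ?po" "even_moment 0 2 = upoly ?pe"
    by (rule forest_solve(1)[OF F E, where pe = ?pe], simp, simp)
      (rule forest_solve(2)[OF F E, where po = ?po], simp, simp)
qed

subsection \<open>The torque of a list of trees\<close>

lemma forest_append_stats:
  "forest_length (Bs @ Cs) = forest_length Bs + forest_length Cs"
  "forest_area (Bs @ Cs) = forest_area Bs + forest_area Cs"
  "forest_sqarea (Bs @ Cs) = forest_sqarea Bs + forest_sqarea Cs"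
  by (induction Bs) auto

lemma forest_torque_append:
  "forest_torque (Bs @ Cs) = forest_torque Bs + forest_torque Cs
     + (real (forest_length Bs) * forest_area Cs - real (forest_length Cs) * forest_area Bs) / 2"
  by (induction Bs) (auto simp: forest_append_stats field_simps)

text \<open>Reversal of the whole sequence reverses the order of the trees and each of the trees.\<close>

definition forest_mirror :: "btree list \<Rightarrow> btree list" where
  "forest_mirror Bs = rev (map mirror Bs)"

lemma forest_mirror_Cons: "forest_mirror (B # Bs) = forest_mirror Bs @ [mirror B]"
  by (simp add: forest_mirror_def)

lemma forest_mirror_stats [simp]:
  "length (forest_mirror Bs) = length Bs"
  "forest_length (forest_mirror Bs) = forest_length Bs"
  "forest_area (forest_mirror Bs) = forest_area Bs"
  "forest_sqarea (forest_mirror Bs) = forest_sqarea Bs"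
proof -
  show "length (forest_mirror Bs) = length Bs" by (simp add: forest_mirror_def)
  show "forest_length (forest_mirror Bs) = forest_length Bs" "forest_area (forest_mirror Bs) =
      forest_area Bs"
    "forest_sqarea (forest_mirror Bs) = forest_sqarea Bs"
    by (induction Bs) (auto simp: forest_mirror_Cons forest_append_stats, simp_all add: forest_mirror_def)
qed

lemma forest_size_mirror [simp]: "forest_size (forest_mirror Bs) = forest_size Bs"
  by (simp add: forest_size_def)

lemma forest_torque_mirror: "forest_torque (forest_mirror Bs) = - forest_torque Bs"
proof (induction Bs)
  case (Cons B Bs)
  then show ?case
    by (simp add: forest_mirror_Cons forest_torque_append torque_mirror field_simps)
qed (simp add: forest_mirror_def)

lemma forest_mirror_mirror: "forest_mirror (forest_mirror Bs) = Bs"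
  by (simp add: forest_mirror_def rev_map o_def)

lemma bij_betw_forest_mirror:
  "(\<And>Bs. forest_mirror Bs \<in> S \<longleftrightarrow> Bs \<in> S) \<Longrightarrow> bij_betw forest_mirror S S"
  by (rule bij_betw_byWitness[where f' = forest_mirror]) (auto simp: forest_mirror_mirror)

lemma odd_gf_torque:
  "(\<And>Bs. f (forest_mirror Bs) = f Bs) \<Longrightarrow> odd_gf (\<lambda>Bs. forest_torque Bs * f Bs) = 0"
  by (rule gf_antisymmetric[OF bij_betw_forest_mirror]) (auto simp: forest_torque_mirror)

lemma even_gf_torque:
  "(\<And>Bs. f (forest_mirror Bs) = f Bs) \<Longrightarrow> even_gf (\<lambda>Bs. forest_torque Bs * f Bs) = 0"
  by (rule gf_antisymmetric[OF bij_betw_forest_mirror]) (auto simp: forest_torque_mirror)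

definition length_op :: "real fps \<Rightarrow> real fps" where
  "length_op F = 2 * euler_op F + F"

text \<open>The number of places that a tree occupies in a spread word, including its final zero.\<close>

definition block_length :: "btree \<Rightarrow> real" where
  "block_length B = 2 * real (nodes B) + 1"

lemma tree_gf_block_length: "tree_gf (\<lambda>B. block_length B * f B) = length_op (tree_gf f)"
proof -
  have "(\<lambda>B. block_length B * f B) = (\<lambda>B. 2 * (real (nodes B) * f B) + f B)"
      by (auto simp: block_length_def algebra_simps)
  then show ?thesis by (simp only: gf_add gf_numeral gf_size length_op_def)
qed

lemma odd_gf_length: "odd_gf (\<lambda>Bs. real (forest_length Bs) * f Bs) = length_op (odd_gf f)"
proof -
  have "odd_gf (\<lambda>Bs. real (forest_length Bs) * f Bs) = odd_gf (\<lambda>Bs. 2 * (real (forest_size Bs) * f Bs)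
      + f Bs)"
    by (rule gf_cong) (simp add: forest_length_odd algebra_simps)
  then show ?thesis by (simp only: gf_add gf_numeral gf_size length_op_def)
qed

lemma even_gf_length: "even_gf (\<lambda>Bs. real (forest_length Bs) * f Bs) = 2 * euler_op (even_gf f)"
proof -
  have "even_gf (\<lambda>Bs. real (forest_length Bs) * f Bs) = even_gf (\<lambda>Bs. 2 * (real (forest_size Bs) * f Bs))"
    by (rule gf_cong) (simp add: forest_length_even algebra_simps)
  then show ?thesis by (simp only: gf_numeral gf_size)
qed

lemma length_op_upoly: "length_op (upoly p) = upoly (smult 2 (pderiv p * [:0, 1, 3, 2:]) + p)"
  by (simp add: length_op_def euler_op_upoly upoly_numeral_mult upoly_add)

lemma length_op_length_op_catalan: "length_op (length_op catalan) = 4 * euler_op central + catalan"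
  by (simp add: length_op_def euler_op_add euler_op_mult euler_op_numeral euler_op_catalan euler_op_diff
      algebra_simps)

lemma forest_gf_moments:
  "odd_gf (\<lambda>_. 1) = odd_moment 0 0" "odd_gf (\<lambda>Bs. forest_area Bs) = odd_moment 1 0"
  "odd_gf (\<lambda>Bs. (forest_area Bs)\<^sup>2) = odd_moment 2 0"
  "even_gf (\<lambda>_. 1) = even_moment 0 0" "even_gf (\<lambda>Bs. forest_area Bs) = even_moment 1 0"
  "even_gf (\<lambda>Bs. (forest_area Bs)\<^sup>2) = even_moment 2 0"
  by (simp_all add: odd_moment_def even_moment_def)

text \<open>As for trees, the products containing a torque to the first power vanish by reversal. The
factor 4 keeps the polynomials integral.\<close>

lemma odd_gf_torque_sq: "4 * odd_gf (\<lambda>Bs. (forest_torque Bs)\<^sup>2) = upoly [:0, 0, 8, 112, 744, 3008, 7952,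
    13984, 16176, 11808, 4928, 896:]"
proof -
  let ?F = "odd_gf (\<lambda>Bs. 4 * (forest_torque Bs)\<^sup>2)" and ?E = "even_gf (\<lambda>Bs. 4 * (forest_torque Bs)\<^sup>2)"
  have sq: "4 * (forest_torque (B # R))\<^sup>2 = 4 * ((torque B)\<^sup>2 * 1) + 1 * (4 * (forest_torque R)\<^sup>2)
      + 8 * (torque B * forest_torque R) + (block_length B * (block_length B * 1)) * (forest_area R)\<^sup>2
      + (area B)\<^sup>2 * (real (forest_length R) * (real (forest_length R) * 1))
      - 2 * ((block_length B * area B) * (real (forest_length R) * forest_area R))
      + 4 * ((torque B * block_length B) * forest_area R)
          - 4 * ((torque B * area B) * real (forest_length R))
      + 4 * (block_length B * (forest_torque R * forest_area R))
      - 4 * (area B * (forest_torque R * real (forest_length R)))" for B R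
    unfolding forest_torque.simps block_length_def by (simp add: field_simps power2_eq_square)
  have zero: "tree_gf torque = 0" "tree_gf (\<lambda>B. torque B * block_length B) =
      0" "tree_gf (\<lambda>B. torque B * area B) = 0"
    "odd_gf (\<lambda>R. forest_torque R * forest_area R) = 0"
    "odd_gf (\<lambda>R. forest_torque R * real (forest_length R)) = 0"
    "even_gf (\<lambda>R. forest_torque R * forest_area R) = 0"
    "even_gf (\<lambda>R. forest_torque R * real (forest_length R)) = 0"
    using tree_gf_torque[of "\<lambda>_. 1"]
    by (simp_all add: tree_gf_torque block_length_def odd_gf_torque even_gf_torque)
  have F: "?F = 4 * (upoly [:0, 0, 0, 2, 18, 66, 126, 132, 72, 16:] * even_moment 0 0) + catalan * ?E
      + length_op (length_op catalan) * even_moment 2 0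
      + moment 2 0 * (2 * euler_op (2 * euler_op (even_moment 0 0)))
      - 2 * (length_op (moment 1 0) * (2 * euler_op (even_moment 1 0)))"
    by (subst odd_gf_rec) (simp only: sq cons_gf_add cons_gf_diff cons_gf_numeral cons_gf_prod zero
      tree_gf_block_length even_gf_length tree_gf_moments forest_gf_moments tree_gf_torque_sq, simp)
  have E: "?E = fps_X * (4 * (upoly [:0, 0, 0, 2, 18, 66, 126, 132, 72, 16:] * odd_moment 0 0)
      + catalan * ?F + length_op (length_op catalan) * odd_moment 2 0
      + moment 2 0 * length_op (length_op (odd_moment 0 0))
          - 2 * (length_op (moment 1 0) * length_op (odd_moment 1 0)))"
    by (subst even_gf_rec) (simp only: sq cons_gf_add cons_gf_diff cons_gf_numeral cons_gf_prod zero
      tree_gf_block_length odd_gf_length tree_gf_moments forest_gf_moments tree_gf_torque_sq, simp)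
  have a: "4 * (upoly [:0, 0, 0, 2, 18, 66, 126, 132, 72, 16:] * even_moment 0 0)
      + 4 * euler_op central * even_moment 2 0
      + moment 2 0 * (2 * euler_op (2 * euler_op (even_moment 0 0)))
      - 2 * (length_op (moment 1 0) * (2 * euler_op (even_moment 1 0))) = upoly [:0, 0, 4, 52, 352,
          1408, 3400, 5000, 4400, 2144, 448:]"
    by (simp add: moment_values central_upoly length_op_upoly upoly_arith del: One_nat_def)
  have b: "4 * (upoly [:0, 0, 0, 2, 18, 66, 126, 132, 72, 16:] * odd_moment 0 0)
      + 4 * euler_op central * odd_moment 2 0
      + moment 2 0 * length_op (length_op (odd_moment 0 0))
          - 2 * (length_op (moment 1 0) * length_op (odd_moment 1 0)) = upoly [:0, 1, 18, 162, 898,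
          3152, 7040, 9952, 8640, 4224, 896:]"
    by (simp add: moment_values central_upoly length_op_upoly upoly_arith del: One_nat_def)
  have F': "?F = catalan * (?E + upoly [:0, 0, 2, 22, 80, 130, 98, 28:]) + upoly [:0, 0, 4, 52, 352,
      1408, 3400, 5000, 4400, 2144, 448:]"
    using F unfolding a[symmetric] length_op_length_op_catalan even_moment_20[symmetric]
        by (simp add: algebra_simps)
  have E': "?E = fps_X * (catalan * (?F + upoly [:0, 1, 13, 70, 190, 272, 196, 56:]) + upoly [:0, 1, 18,
      162, 898, 3152, 7040, 9952, 8640, 4224, 896:])"
    using E unfolding b[symmetric] length_op_length_op_catalan odd_moment_20[symmetric]
        by (simp add: algebra_simps)
  have "?F = upoly [:0, 0, 8, 112, 744, 3008, 7952, 13984, 16176, 11808, 4928, 896:]"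
    by (rule forest_solve(1)[OF F' E', where pe = "[:0, 0, 2, 34, 260, 1182, 3430, 6452, 7800, 5840,
        2464, 448:]"]) simp_all
  then show ?thesis by (simp only: gf_numeral)
qed

section \<open>First and second moment of the size\<close>

lemma power_sums:
  "(\<Sum>j\<le>a. real j) = real a * (real a + 1) / 2"
  "(\<Sum>j\<le>a. (real j)\<^sup>2) = real a * (real a + 1) * (2 * real a + 1) / 6"
  "(\<Sum>j\<le>a. (real j) ^ 3) = (real a)\<^sup>2 * (real a + 1)\<^sup>2 / 4"
  "(\<Sum>j\<le>a. (real j) ^ 4) =
     real a * (real a + 1) * (2 * real a + 1) * (3 * (real a)\<^sup>2 + 3 * real a - 1) / 30"
  by (induction a) (simp_all add: field_simps power2_eq_square power3_eq_cube power4_eq_xxxx)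

lemma sum_quadratic:
  "(\<Sum>j\<le>a. x + y * real j + z * (real j)\<^sup>2) =
     x * (real a + 1) + y * (\<Sum>j\<le>a. real j) + z * (\<Sum>j\<le>a. (real j)\<^sup>2)"
  by (simp add: sum.distrib sum_distrib_left)

text \<open>The size is a quadratic polynomial in \<open>j\<close>, so its square needs the power sums up to exponent
four.\<close>

lemma sum_quadratic_squared:
  "(\<Sum>j\<le>a. (x + y * real j + z * (real j)\<^sup>2)\<^sup>2) =
     x\<^sup>2 * (real a + 1) + 2 * x * y * (\<Sum>j\<le>a. real j) + (y\<^sup>2 + 2 * x * z) * (\<Sum>j\<le>a. (real j)\<^sup>2)
     + 2 * y * z * (\<Sum>j\<le>a. (real j) ^ 3) + z\<^sup>2 * (\<Sum>j\<le>a. (real j) ^ 4)"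
proof -
  have "(x + y * real j + z * (real j)\<^sup>2)\<^sup>2 = x\<^sup>2 + 2 * x * y * real j + (y\<^sup>2 + 2 * x * z) * (real j)\<^sup>2
      + 2 * y * z * (real j) ^ 3 + z\<^sup>2 * (real j) ^ 4" for j
    by algebra
  then show ?thesis by (simp add: sum.distrib sum_distrib_left)
qed

text \<open>The coefficient of \<open>n + 1\<close> in the size.\<close>

definition weight :: "btree \<Rightarrow> btree list \<Rightarrow> real" where
  "weight P R = sqarea P + area P + forest_sqarea R"

text \<open>The part of the size that is independent of \<open>n\<close> and invariant under reversal, with its sign
changed.\<close>

definition defect :: "btree \<Rightarrow> btree list \<Rightarrow> nat \<Rightarrow> real" where
  "defect P R j = (area P + forest_area R)\<^sup>2 / 2 + (real j + 1 / 2) * (area P + forest_area R)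
     - (real (nodes P) - real j) * (real (nodes P) - real j + 1) / 2"

lemma config_size_eq:
  "config_size n (P, j, R) = (real n + 1) * weight P R - defect P R j + torque P + forest_torque R"
  by (simp add: config_size_def weight_def defect_def Let_def algebra_simps)

definition defect_sum :: "btree \<Rightarrow> btree list \<Rightarrow> real" where
  "defect_sum P R = (let T = area P + forest_area R; l = slots P in
     (3 * l * T\<^sup>2 + 3 * l\<^sup>2 * T - l ^ 3 + l) / 6)"

definition defect_square_sum :: "btree \<Rightarrow> btree list \<Rightarrow> real" where
  "defect_square_sum P R = (let T = area P + forest_area R; l = slots P in
     (15 * l * T ^ 4 + 30 * l\<^sup>2 * T ^ 3 + (10 * l ^ 3 + 5 * l) * T\<^sup>2 - (5 * l ^ 4 - 5 * l\<^sup>2) * T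
       + 3 * l ^ 5 - 5 * l ^ 3 + 2 * l) / 60)"

lemma six_defect_sum: "6 * defect_sum P R = 3 * slots P * (area P + forest_area R)\<^sup>2
    + 3 * (slots P)\<^sup>2 * (area P + forest_area R) - (slots P) ^ 3 + slots P"
  by (simp add: defect_sum_def Let_def)

lemma sixty_defect_square_sum: "60 * defect_square_sum P R = 15 * slots P * (area P + forest_area R) ^ 4
    + 30 * (slots P)\<^sup>2 * (area P + forest_area R) ^ 3
    + (10 * (slots P) ^ 3 + 5 * slots P) * (area P + forest_area R)\<^sup>2
    - (5 * (slots P) ^ 4 - 5 * (slots P)\<^sup>2) * (area P + forest_area R)
    + 3 * (slots P) ^ 5 - 5 * (slots P) ^ 3 + 2 * slots P"
  by (simp add: defect_square_sum_def Let_def)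

lemma defect_quadratic:
  fixes P R
  defines "T \<equiv> area P + forest_area R" and "a \<equiv> real (nodes P)"
  shows "defect P R j = (T\<^sup>2 / 2 + T / 2 - a * (a + 1) / 2) + (T + a + 1 / 2) * real j
      + (- 1 / 2) * (real j)\<^sup>2"
  by (simp add: defect_def T_def a_def field_simps power2_eq_square)

lemma sum_defect: "(\<Sum>j\<le>nodes P. defect P R j) = defect_sum P R"
  unfolding defect_quadratic sum_quadratic power_sums defect_sum_def Let_def slots_def
  by (simp add: field_simps power2_eq_square power3_eq_cube)

lemma sum_defect_square: "(\<Sum>j\<le>nodes P. (defect P R j)\<^sup>2) = defect_square_sum P R"
proof -
  define T a where "T = area P + forest_area R" and "a = real (nodes P)"
  show ?thesis
    unfolding defect_quadratic sum_quadratic_squared power_sums defect_square_sum_def Let_def slots_def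
      T_def[symmetric] a_def[symmetric]
    by (simp add: field_simps) algebra
qed

abbreviation config_gf :: "(btree \<Rightarrow> btree list \<Rightarrow> real) \<Rightarrow> real fps" where
  "config_gf \<equiv> cons_gf {Bs. odd (length Bs)}"

text \<open>The two conditions on a configuration, an odd list and the right total length, together say
that the sizes of the tree and of the list add up to \<open>n\<close>.\<close>

lemma sum_configurations:
  "(\<Sum>c\<in>configurations n. f c) = fps_nth (config_gf (\<lambda>P R. \<Sum>j\<le>nodes P. f (P, j, R))) n"
proof -
  let ?S = "{z. z \<in> UNIV \<times> {Bs. odd (length Bs)} \<and> (case z of (P, R) \<Rightarrow> nodes P + forest_size R) = n}"
  have fin: "finite ?S"
    using finite_fibres_prod[OF finite_fibres_btree finite_fibres_forest[of "{Bs. odd (length Bs)}"]]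
    by (simp add: finite_fibres_def)
  have size: "2 * nodes P + forest_length R = Suc (2 * n) \<longleftrightarrow> odd (length R) \<and> nodes P + forest_size R = n"
    for P R
  proof (cases "odd (length R)")
    case True
    then show ?thesis using forest_length_odd[OF True] by auto
  next
    case False
    then show ?thesis using forest_length_even[of R] by presburger
  qed
  have bij: "bij_betw (\<lambda>((P, R), j). (P, j, R)) (SIGMA z:?S. {..nodes (fst z)}) (configurations n)"
    by (rule bij_betw_byWitness[where f' = "\<lambda>(P, j, R). ((P, R), j)"])
      (auto simp: configurations_def size forest_length_odd)
  have "(\<Sum>c\<in>configurations n. f c) = (\<Sum>(z, j)\<in>(SIGMA z:?S. {..nodes (fst z)}). f (fst z, j, snd z))"
    using sum.reindex_bij_betw[OF bij, of f] by (simp add: split_def)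
  also have "\<dots> = (\<Sum>z\<in>?S. \<Sum>j\<le>nodes (fst z). f (fst z, j, snd z))"
    using sum.Sigma[OF fin, of "\<lambda>z. {..nodes (fst z)}" "\<lambda>z j. f (fst z, j, snd z)"] by simp
  finally show ?thesis by (simp add: gf_nth split_def)
qed

lemma bij_betw_mirror_pair: "bij_betw (\<lambda>(P, R). (mirror P, R)) (UNIV \<times> S) (UNIV \<times> S)"
  by (rule bij_betw_byWitness[where f' = "\<lambda>(P, R). (mirror P, R)"]) auto

lemma bij_betw_forest_mirror_pair:
  "bij_betw (\<lambda>(P, R). (P, forest_mirror R)) (UNIV \<times> {Bs. odd (length Bs)}) (UNIV \<times> {Bs. odd (length Bs)})"
  by (rule bij_betw_byWitness[where f' = "\<lambda>(P, R). (P, forest_mirror R)"]) (auto simp: forest_mirror_mirror)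

lemma config_gf_torque:
  assumes "\<And>P R. F (mirror P) R = F P R"
  shows "config_gf (\<lambda>P R. torque P * F P R) = 0"
  by (rule gf_antisymmetric[OF bij_betw_mirror_pair]) (auto simp: torque_mirror assms)

lemma config_gf_forest_torque:
  assumes "\<And>P R. F P (forest_mirror R) = F P R"
  shows "config_gf (\<lambda>P R. forest_torque R * F P R) = 0"
  by (rule gf_antisymmetric[OF bij_betw_forest_mirror_pair]) (auto simp: forest_torque_mirror assms)

lemma weight_mirror: "weight (mirror P) R = weight P R" "weight P (forest_mirror R) = weight P R"
  by (simp_all add: weight_def)

lemma defect_sum_mirror:
  "defect_sum (mirror P) R = defect_sum P R" "defect_sum P (forest_mirror R) = defect_sum P R"
  by (simp_all add: defect_sum_def slots_mirror)

text \<open>The torque terms vanish by reversal of the tree and of the list.\<close>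

lemma sum_size:
  "(\<Sum>c\<in>configurations n. config_size n c) =
     (real n + 1) * fps_nth (config_gf (\<lambda>P R. slots P * weight P R)) n - fps_nth (config_gf defect_sum) n"
proof -
  have "(\<Sum>j\<le>nodes P. config_size n (P, j, R)) = (real n + 1) * (slots P * weight P R) - defect_sum P R
      + torque P * slots P + forest_torque R * slots P" for P R
    unfolding config_size_eq sum_defect[symmetric]
    by (simp add: sum.distrib sum_subtractf slots_def algebra_simps)
  then have "(\<Sum>c\<in>configurations n. config_size n c) = fps_nth (config_gf (\<lambda>P R.
      (real n + 1) * (slots P * weight P R) - defect_sum P R + torque P * slots P
          + forest_torque R * slots P)) n"
    unfolding sum_configurations by simp
  also have "\<dots> = (real n + 1) * fps_nth (config_gf (\<lambda>P R. slots P * weight P R)) n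
      - fps_nth (config_gf defect_sum) n"
    unfolding cons_gf_add cons_gf_diff cons_gf_scale
    by (subst config_gf_torque, simp add: slots_mirror, subst config_gf_forest_torque, simp) simp
  finally show ?thesis .
qed

text \<open>Reversal of the tree alone, and of the list alone, kills every product in which one of the
torques occurs to the first power.\<close>

lemma sum_size_square:
  "(\<Sum>c\<in>configurations n. (config_size n c)\<^sup>2) =
     (real n + 1)\<^sup>2 * fps_nth (config_gf (\<lambda>P R. slots P * (weight P R)\<^sup>2)) n
     - 2 * (real n + 1) * fps_nth (config_gf (\<lambda>P R. weight P R * defect_sum P R)) n
     + fps_nth (config_gf defect_square_sum) n
     + fps_nth (config_gf (\<lambda>P R. (slots P * (torque P)\<^sup>2) * 1)) n
     + fps_nth (config_gf (\<lambda>P R. (slots P * 1) * (forest_torque R)\<^sup>2)) n"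
proof -
  define N where "N = real n + 1"
  have "(\<Sum>j\<le>nodes P. (config_size n (P, j, R))\<^sup>2) = N\<^sup>2 * (slots P * (weight P R)\<^sup>2)
      - (2 * N) * (weight P R * defect_sum P R) + defect_square_sum P R
      + (slots P * (torque P)\<^sup>2) * 1 + (slots P * 1) * (forest_torque R)\<^sup>2
      + torque P * (2 * (N * (slots P * weight P R) - defect_sum P R) + 2 * slots P * forest_torque R)
      + forest_torque R * (2 * (N * (slots P * weight P R) - defect_sum P R))" for P R
  proof -
    define c where "c = N * weight P R + torque P + forest_torque R"
    have "(\<Sum>j\<le>nodes P. (config_size n (P, j, R))\<^sup>2) = (\<Sum>j\<le>nodes P. c\<^sup>2 - 2 * c * defect P R j
        + (defect P R j)\<^sup>2)"
      by (rule sum.cong[OF refl]) (simp add: config_size_eq c_def N_def power2_eq_square algebra_simps)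
    also have "\<dots> = slots P * c\<^sup>2 - 2 * c * defect_sum P R + defect_square_sum P R"
      unfolding sum.distrib sum_subtractf sum_distrib_left[symmetric] sum_defect sum_defect_square
      by (simp add: slots_def)
    finally show ?thesis unfolding c_def by (simp add: power2_eq_square algebra_simps)
  qed
  then have "(\<Sum>c\<in>configurations n. (config_size n c)\<^sup>2) = fps_nth (config_gf (\<lambda>P R.
      N\<^sup>2 * (slots P * (weight P R)\<^sup>2)
      - (2 * N) * (weight P R * defect_sum P R) + defect_square_sum P R
      + (slots P * (torque P)\<^sup>2) * 1 + (slots P * 1) * (forest_torque R)\<^sup>2
      + torque P * (2 * (N * (slots P * weight P R) - defect_sum P R) + 2 * slots P * forest_torque R)
      + forest_torque R * (2 * (N * (slots P * weight P R) - defect_sum P R)))) n"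
    unfolding sum_configurations by simp
  also have "\<dots> = N\<^sup>2 * fps_nth (config_gf (\<lambda>P R. slots P * (weight P R)\<^sup>2)) n
     - 2 * N * fps_nth (config_gf (\<lambda>P R. weight P R * defect_sum P R)) n
     + fps_nth (config_gf defect_square_sum) n
     + fps_nth (config_gf (\<lambda>P R. (slots P * (torque P)\<^sup>2) * 1)) n
     + fps_nth (config_gf (\<lambda>P R. (slots P * 1) * (forest_torque R)\<^sup>2)) n"
  proof -
    have "config_gf (\<lambda>P R. torque P *
        (2 * (N * (slots P * weight P R) - defect_sum P R) + 2 * slots P * forest_torque R)) = 0"
      by (rule config_gf_torque) (simp add: slots_mirror weight_mirror defect_sum_mirror)
    moreover have "config_gf (\<lambda>P R. forest_torque R *
        (2 * (N * (slots P * weight P R) - defect_sum P R))) = 0"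
      by (rule config_gf_forest_torque) (simp add: weight_mirror defect_sum_mirror)
    ultimately show ?thesis
      by (simp only: cons_gf_add cons_gf_diff cons_gf_scale) simp
  qed
  finally show ?thesis unfolding N_def .
qed

subsection \<open>Even powers of the central binomial series\<close>

lemma central_square: "central\<^sup>2 * (1 - 4 * fps_X) = 1"
  using X_central_square central_unif by algebra

definition binomial_series :: "nat \<Rightarrow> real fps" where
  "binomial_series k = Abs_fps (\<lambda>n. 4 ^ n * real ((n + k) choose k))"

lemma one_minus_4X: "F * (1 - 4 * fps_X) = F - fps_const 4 * (fps_X * F)" for F :: "real fps"
  by (simp add: algebra_simps numeral_fps_const)

lemma binomial_series_step: "binomial_series (Suc k) * (1 - 4 * fps_X) = binomial_series k"
  unfolding one_minus_4X
proof (rule fps_ext)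
  fix n
  show "fps_nth (binomial_series (Suc k) - fps_const 4 * (fps_X * binomial_series (Suc k))) n
      = fps_nth (binomial_series k) n"
    by (cases n) (simp_all add: binomial_series_def algebra_simps)
qed

lemma binomial_series_0: "binomial_series 0 * (1 - 4 * fps_X) = 1"
  unfolding one_minus_4X
proof (rule fps_ext)
  fix n
  show "fps_nth (binomial_series 0 - fps_const 4 * (fps_X * binomial_series 0)) n = fps_nth 1 n"
    by (cases n) (simp_all add: binomial_series_def)
qed

text \<open>Both sides satisfy the same recursion under multiplication by \<open>1 - 4 * X\<close>, by Pascal's rule.\<close>

lemma central_even_power: "(central\<^sup>2) ^ Suc k = binomial_series k"
proof (induction k)
  case 0
  have "(central\<^sup>2) ^ Suc 0 = central\<^sup>2 * (binomial_series 0 * (1 - 4 * fps_X))"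
    unfolding binomial_series_0 by simp
  also have "\<dots> = binomial_series 0 * (central\<^sup>2 * (1 - 4 * fps_X))" by (simp only: ac_simps)
  finally show ?case unfolding central_square by simp
next
  case (Suc k)
  have "(central\<^sup>2) ^ Suc (Suc k) = central\<^sup>2 * (binomial_series (Suc k) * (1 - 4 * fps_X))"
    unfolding binomial_series_step Suc.IH[symmetric] by simp
  also have "\<dots> = binomial_series (Suc k) * (central\<^sup>2 * (1 - 4 * fps_X))" by (simp only: ac_simps)
  finally show ?case unfolding central_square by simp
qed

lemma choose_step: "real ((n + Suc k) choose Suc k) = (real n + real k + 1) / (real k + 1) * real ((n
    + k) choose k)"
proof -
  have "(real k + 1) * real (Suc (n + k) choose Suc k) = (real n + real k + 1) * real ((n + k) choose k)"
    using arg_cong[OF Suc_times_binomial[of k "n + k"], of real] by (simp add: algebra_simps)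
  then show ?thesis by (simp add: field_simps)
qed

lemma binomial_series_nth_0: "fps_nth (binomial_series 0) n = 4 ^ n"
  by (simp add: binomial_series_def)

lemma binomial_series_nth_Suc:
  "fps_nth (binomial_series (Suc k)) n = (real n + real k + 1) / (real k
      + 1) * fps_nth (binomial_series k) n"
  unfolding binomial_series_def fps_nth_Abs_fps choose_step by simp

lemma nth_numeral_mult: "fps_nth (numeral k * F) n = numeral k * fps_nth F n" for F :: "real fps"
  by (simp add: numeral_fps_const)

lemma binomial_series_poly_0: "binomial_series 0 = upoly [:1, 4, 4:]"
  using central_even_power[of 0] by (simp add: central_upoly power2_eq_square upoly_mult)

lemma binomial_series_Suc: "binomial_series (Suc k) = (central * central) * binomial_series k"
  by (simp only: central_even_power[symmetric] power_Suc power2_eq_square)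

lemma binomial_series_poly_1: "binomial_series 1 = upoly [:1, 8, 24, 32, 16:]"
proof -
  have e: "(1::nat) = Suc 0" by simp
  show ?thesis unfolding e binomial_series_Suc binomial_series_poly_0 central_upoly
      by (simp add: upoly_mult)
qed

lemma binomial_series_poly_2: "binomial_series 2 = upoly [:1, 12, 60, 160, 240, 192, 64:]"
proof -
  have e: "(2::nat) = Suc 1" by simp
  show ?thesis unfolding e binomial_series_Suc binomial_series_poly_1 central_upoly
      by (simp add: upoly_mult)
qed

lemma binomial_series_poly_3: "binomial_series 3 = upoly [:1, 16, 112, 448, 1120, 1792, 1792, 1024, 256:]"
proof -
  have e: "(3::nat) = Suc 2" by simp
  show ?thesis unfolding e binomial_series_Suc binomial_series_poly_2 central_upoly
      by (simp add: upoly_mult)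
qed

lemma binomial_series_poly_4: "binomial_series 4 = upoly [:1, 20, 180, 960, 3360, 8064, 13440, 15360,
    11520, 5120, 1024:]"
proof -
  have e: "(4::nat) = Suc 3" by simp
  show ?thesis unfolding e binomial_series_Suc binomial_series_poly_3 central_upoly
      by (simp add: upoly_mult)
qed

lemma binomial_series_poly_5: "binomial_series 5 = upoly [:1, 24, 264, 1760, 7920, 25344, 59136, 101376,
    126720, 112640, 67584, 24576, 4096:]"
proof -
  have e: "(5::nat) = Suc 4" by simp
  show ?thesis unfolding e binomial_series_Suc binomial_series_poly_4 central_upoly
      by (simp add: upoly_mult)
qed

lemma binomial_series_poly_6: "binomial_series 6 = upoly [:1, 28, 364, 2912, 16016, 64064, 192192,
    439296, 768768, 1025024, 1025024, 745472, 372736, 114688, 16384:]"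
proof -
  have e: "(6::nat) = Suc 5" by simp
  show ?thesis unfolding e binomial_series_Suc binomial_series_poly_5 central_upoly
      by (simp add: upoly_mult)
qed

lemma odd_moment_mono: "odd_gf (forest_mono i k) = odd_moment i k"
  unfolding odd_moment_def by (rule gf_cong) (simp add: forest_mono_def)

lemmas config_gf_expand = cons_gf_add cons_gf_diff cons_gf_numeral cons_gf_prod tree_gf_slots moment_mono
  odd_moment_mono

lemmas binomial_series_polys = binomial_series_poly_0 binomial_series_poly_1 binomial_series_poly_2
    binomial_series_poly_3 binomial_series_poly_4 binomial_series_poly_5 binomial_series_poly_6

lemma series_value_0: "fps_nth (binomial_series 0) n = 4 ^ n"
  by (rule binomial_series_nth_0)

lemma series_value_1: "fps_nth (binomial_series 1) n = (real n + 1) * 4 ^ n"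
proof -
  have "binomial_series 1 = binomial_series (Suc 0)" by (rule arg_cong[where f = binomial_series]) simp
  then show ?thesis by (simp only: binomial_series_nth_Suc series_value_0) (simp add: add_ac)
qed

lemma series_value_2: "fps_nth (binomial_series 2) n = (real n + 2) / 2 * ((real n + 1) * 4 ^ n)"
proof -
  have "binomial_series 2 = binomial_series (Suc 1)" by (rule arg_cong[where f = binomial_series]) simp
  then show ?thesis by (simp only: binomial_series_nth_Suc series_value_1) (simp add: add_ac)
qed

lemma series_value_3: "fps_nth (binomial_series 3) n = (real n + 3) / 3 * ((real n + 2) / 2 * ((real n
    + 1) * 4 ^ n))"
proof -
  have "binomial_series 3 = binomial_series (Suc 2)" by (rule arg_cong[where f = binomial_series]) simp
  then show ?thesis by (simp only: binomial_series_nth_Suc series_value_2) (simp add: add_ac)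
qed

lemma series_value_4: "fps_nth (binomial_series 4) n = (real n + 4) / 4 * ((real n + 3) / 3 * ((real n
    + 2) / 2 * ((real n + 1) * 4 ^ n)))"
proof -
  have "binomial_series 4 = binomial_series (Suc 3)" by (rule arg_cong[where f = binomial_series]) simp
  then show ?thesis by (simp only: binomial_series_nth_Suc series_value_3) (simp add: add_ac)
qed

lemma series_value_5: "fps_nth (binomial_series 5) n = (real n + 5) / 5 * ((real n + 4) / 4 * ((real n
    + 3) / 3 * ((real n + 2) / 2 * ((real n + 1) * 4 ^ n))))"
proof -
  have "binomial_series 5 = binomial_series (Suc 4)" by (rule arg_cong[where f = binomial_series]) simp
  then show ?thesis by (simp only: binomial_series_nth_Suc series_value_4) (simp add: add_ac)
qed

lemma series_value_6: "fps_nth (binomial_series 6) n = (real n + 6) / 6 * ((real n + 5) / 5 * ((real n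
    + 4) / 4 * ((real n + 3) / 3 * ((real n + 2) / 2 * ((real n + 1) * 4 ^ n)))))"
proof -
  have "binomial_series 6 = binomial_series (Suc 5)" by (rule arg_cong[where f = binomial_series]) simp
  then show ?thesis by (simp only: binomial_series_nth_Suc series_value_5) (simp add: add_ac)
qed

lemmas series_values = series_value_0 series_value_1 series_value_2 series_value_3 series_value_4
  series_value_5 series_value_6

text \<open>The polynomial in \<open>u\<close> of this sum is even in \<open>1 + 2 * u\<close>. Expanding it in even powers of the
central binomial series gives the coefficients as \<open>4 ^ n\<close> times a polynomial; the same happens for
the sums that follow.\<close>

lemma value_weight: "fps_nth (config_gf (\<lambda>P R. slots P * weight P R)) n = (2 * real n ^ 2
    + 3 * real n) / 4 * 4 ^ n"
  (is "fps_nth ?F n = _")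
proof -
  have expand: "slots P * weight P R =
    (slots P * monomial 0 0 P) * forest_mono 0 1 R
    + (slots P * monomial 0 1 P) * forest_mono 0 0 R
    + (slots P * monomial 1 0 P) * forest_mono 0 0 R" for P R
    unfolding weight_def monomial_def forest_mono_def by algebra
  have "?F =
    slot_op (moment 0 0) * odd_moment 0 1
    + slot_op (moment 0 1) * odd_moment 0 0
    + slot_op (moment 1 0) * odd_moment 0 0"
    unfolding expand by (simp only: config_gf_expand)
  also have "\<dots> = upoly [:0, 5, 41, 136, 228, 192, 64:]"
    by (simp add: moment_values upoly_arith del: One_nat_def)
  finally have "?F = upoly [:0, 5, 41, 136, 228, 192, 64:]" .
  from arg_cong[OF this, of "\<lambda>F. 4 * F"]
  have "4 * ?F = (4 * binomial_series 2) - (binomial_series 0 + 3 * binomial_series 1)" (is "_ = ?comb")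
    by (simp add: binomial_series_polys upoly_arith del: One_nat_def)
  from arg_cong[OF this, of "\<lambda>F. fps_nth F n"]
  have "fps_nth ?F n = fps_nth ?comb n / 4"
    unfolding nth_numeral_mult by (simp add: field_simps)
  also have "\<dots> = (2 * real n ^ 2 + 3 * real n) / 4 * 4 ^ n"
    unfolding nth_numeral_mult fps_add_nth fps_sub_nth series_values
    by (simp add: field_simps power_numeral_reduce)
  finally show ?thesis .
qed

lemma value_defect: "fps_nth (config_gf (defect_sum)) n = (6 * real n ^ 3 + 13 * real n ^ 2
    + 5 * real n) / 32 * 4 ^ n"
  (is "fps_nth ?F n = _")
proof -
  have expand: "6 * (defect_sum P R) =
    ((slots P * monomial 0 0 P) * forest_mono 0 0 R
    + 3 * ((slots P * monomial 0 0 P) * forest_mono 2 0 R)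
    + 3 * ((slots P * (slots P * monomial 0 0 P)) * forest_mono 1 0 R)
    + 6 * ((slots P * monomial 1 0 P) * forest_mono 1 0 R)
    + 3 * ((slots P * (slots P * monomial 1 0 P)) * forest_mono 0 0 R)
    + 3 * ((slots P * monomial 2 0 P) * forest_mono 0 0 R))
    - ((slots P * (slots P * (slots P * monomial 0 0 P))) * forest_mono 0 0 R)" for P R
    unfolding six_defect_sum weight_def monomial_def forest_mono_def by algebra
  have "6 * ?F =
    (slot_op (moment 0 0) * odd_moment 0 0
    + 3 * (slot_op (moment 0 0) * odd_moment 2 0)
    + 3 * (slot_op (slot_op (moment 0 0)) * odd_moment 1 0)
    + 6 * (slot_op (moment 1 0) * odd_moment 1 0)
    + 3 * (slot_op (slot_op (moment 1 0)) * odd_moment 0 0)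
    + 3 * (slot_op (moment 2 0) * odd_moment 0 0))
    - (slot_op (slot_op (slot_op (moment 0 0))) * odd_moment 0 0)"
    unfolding cons_gf_numeral[symmetric] expand by (simp only: config_gf_expand)
  also have "\<dots> = upoly [:0, 18, 276, 1692, 5514, 10440, 11544, 6912, 1728:]"
    by (simp add: moment_values upoly_arith del: One_nat_def)
  finally have "6 * ?F = upoly [:0, 18, 276, 1692, 5514, 10440, 11544, 6912, 1728:]" .
  from arg_cong[OF this, of "\<lambda>F. 8 * F"]
  have "48 * ?F = (3 * binomial_series 0 + 12 * binomial_series 1 + 54 * binomial_series 3)
      - (69 * binomial_series 2)" (is "_ = ?comb")
    by (simp add: binomial_series_polys upoly_arith del: One_nat_def)
  from arg_cong[OF this, of "\<lambda>F. fps_nth F n"]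
  have "fps_nth ?F n = fps_nth ?comb n / 48"
    unfolding nth_numeral_mult by (simp add: field_simps)
  also have "\<dots> = (6 * real n ^ 3 + 13 * real n ^ 2 + 5 * real n) / 32 * 4 ^ n"
    unfolding nth_numeral_mult fps_add_nth fps_sub_nth series_values
    by (simp add: field_simps power_numeral_reduce)
  finally show ?thesis .
qed

lemma value_weight_square: "fps_nth (config_gf (\<lambda>P R. slots P * (weight P R)\<^sup>2)) n = (40 * real n ^ 4
    + 109 * real n ^ 3 + 71 * real n ^ 2 - 4 * real n) / 96 * 4 ^ n"
  (is "fps_nth ?F n = _")
proof -
  have expand: "slots P * (weight P R)\<^sup>2 =
    (slots P * monomial 0 0 P) * forest_mono 0 2 R
    + 2 * ((slots P * monomial 0 1 P) * forest_mono 0 1 R)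
    + (slots P * monomial 0 2 P) * forest_mono 0 0 R
    + 2 * ((slots P * monomial 1 0 P) * forest_mono 0 1 R)
    + 2 * ((slots P * monomial 1 1 P) * forest_mono 0 0 R)
    + (slots P * monomial 2 0 P) * forest_mono 0 0 R" for P R
    unfolding weight_def monomial_def forest_mono_def by algebra
  have "?F =
    slot_op (moment 0 0) * odd_moment 0 2
    + 2 * (slot_op (moment 0 1) * odd_moment 0 1)
    + slot_op (moment 0 2) * odd_moment 0 0
    + 2 * (slot_op (moment 1 0) * odd_moment 0 1)
    + 2 * (slot_op (moment 1 1) * odd_moment 0 0)
    + slot_op (moment 2 0) * odd_moment 0 0"
    unfolding expand by (simp only: config_gf_expand)
  also have "\<dots> = upoly [:0, 9, 271, 2824, 15306, 49716, 102364, 134976, 110544, 51200, 10240:]"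
    by (simp add: moment_values upoly_arith del: One_nat_def)
  finally have "?F = upoly [:0, 9, 271, 2824, 15306, 49716, 102364, 134976, 110544, 51200, 10240:]" .
  from arg_cong[OF this, of "\<lambda>F. 16 * F"]
  have "16 * ?F = (binomial_series 0 + 139 * binomial_series 2 + 160 * binomial_series 4)
      - (9 * binomial_series 1 + 291 * binomial_series 3)" (is "_ = ?comb")
    by (simp add: binomial_series_polys upoly_arith del: One_nat_def)
  from arg_cong[OF this, of "\<lambda>F. fps_nth F n"]
  have "fps_nth ?F n = fps_nth ?comb n / 16"
    unfolding nth_numeral_mult by (simp add: field_simps)
  also have "\<dots> = (40 * real n ^ 4 + 109 * real n ^ 3 + 71 * real n ^ 2 - 4 * real n) / 96 * 4 ^ n"
    unfolding nth_numeral_mult fps_add_nth fps_sub_nth series_values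
    by (simp add: field_simps power_numeral_reduce)
  finally show ?thesis .
qed

lemma value_weight_defect: "fps_nth (config_gf (\<lambda>P R. weight P R * defect_sum P R)) n =
    (123 * real n ^ 5 + 418 * real n ^ 4 + 407 * real n ^ 3 + 56 * real n ^ 2 - 44 * real n) / 768 * 4 ^ n"
  (is "fps_nth ?F n = _")
proof -
  have expand: "6 * (weight P R * defect_sum P R) =
    ((slots P * monomial 0 0 P) * forest_mono 0 1 R
    + 3 * ((slots P * monomial 0 0 P) * forest_mono 2 1 R)
    + 3 * ((slots P * (slots P * monomial 0 0 P)) * forest_mono 1 1 R)
    + (slots P * monomial 0 1 P) * forest_mono 0 0 R
    + 3 * ((slots P * monomial 0 1 P) * forest_mono 2 0 R)
    + 3 * ((slots P * (slots P * monomial 0 1 P)) * forest_mono 1 0 R)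
    + (slots P * monomial 1 0 P) * forest_mono 0 0 R
    + 6 * ((slots P * monomial 1 0 P) * forest_mono 1 1 R)
    + 3 * ((slots P * monomial 1 0 P) * forest_mono 2 0 R)
    + 3 * ((slots P * (slots P * monomial 1 0 P)) * forest_mono 0 1 R)
    + 3 * ((slots P * (slots P * monomial 1 0 P)) * forest_mono 1 0 R)
    + 6 * ((slots P * monomial 1 1 P) * forest_mono 1 0 R)
    + 3 * ((slots P * (slots P * monomial 1 1 P)) * forest_mono 0 0 R)
    + 3 * ((slots P * monomial 2 0 P) * forest_mono 0 1 R)
    + 6 * ((slots P * monomial 2 0 P) * forest_mono 1 0 R)
    + 3 * ((slots P * (slots P * monomial 2 0 P)) * forest_mono 0 0 R)
    + 3 * ((slots P * monomial 2 1 P) * forest_mono 0 0 R)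
    + 3 * ((slots P * monomial 3 0 P) * forest_mono 0 0 R))
    - ((slots P * (slots P * (slots P * monomial 0 0 P))) * forest_mono 0 1 R
    + (slots P * (slots P * (slots P * monomial 0 1 P))) * forest_mono 0 0 R
    + (slots P * (slots P * (slots P * monomial 1 0 P))) * forest_mono 0 0 R)" for P R
    unfolding mult.left_commute[of 6] six_defect_sum weight_def monomial_def forest_mono_def by algebra
  have "6 * ?F =
    (slot_op (moment 0 0) * odd_moment 0 1
    + 3 * (slot_op (moment 0 0) * odd_moment 2 1)
    + 3 * (slot_op (slot_op (moment 0 0)) * odd_moment 1 1)
    + slot_op (moment 0 1) * odd_moment 0 0
    + 3 * (slot_op (moment 0 1) * odd_moment 2 0)
    + 3 * (slot_op (slot_op (moment 0 1)) * odd_moment 1 0)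
    + slot_op (moment 1 0) * odd_moment 0 0
    + 6 * (slot_op (moment 1 0) * odd_moment 1 1)
    + 3 * (slot_op (moment 1 0) * odd_moment 2 0)
    + 3 * (slot_op (slot_op (moment 1 0)) * odd_moment 0 1)
    + 3 * (slot_op (slot_op (moment 1 0)) * odd_moment 1 0)
    + 6 * (slot_op (moment 1 1) * odd_moment 1 0)
    + 3 * (slot_op (slot_op (moment 1 1)) * odd_moment 0 0)
    + 3 * (slot_op (moment 2 0) * odd_moment 0 1)
    + 6 * (slot_op (moment 2 0) * odd_moment 1 0)
    + 3 * (slot_op (slot_op (moment 2 0)) * odd_moment 0 0)
    + 3 * (slot_op (moment 2 1) * odd_moment 0 0)
    + 3 * (slot_op (moment 3 0) * odd_moment 0 0))
    - (slot_op (slot_op (slot_op (moment 0 0))) * odd_moment 0 1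
    + slot_op (slot_op (slot_op (moment 0 1))) * odd_moment 0 0
    + slot_op (slot_op (slot_op (moment 1 0))) * odd_moment 0 0)"
    unfolding cons_gf_numeral[symmetric] expand by (simp only: config_gf_expand)
  also have "\<dots> = upoly [:0, 30, 1662, 27282, 224670, 1110486, 3574722, 7782816, 11580744, 11618880,
      7519296, 2833920, 472320:]"
    by (simp add: moment_values upoly_arith del: One_nat_def)
  finally have "6 * ?F = upoly [:0, 30, 1662, 27282, 224670, 1110486, 3574722, 7782816, 11580744,
      11618880, 7519296, 2833920, 472320:]" .
  from arg_cong[OF this, of "\<lambda>F. 32 * F"]
  have "192 * ?F = (45 * binomial_series 1 + 6333 * binomial_series 3 + 3690 * binomial_series 5)
      - (3 * binomial_series 0 + 1503 * binomial_series 2 + 8562 * binomial_series 4)" (is "_ = ?comb")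
    by (simp add: binomial_series_polys upoly_arith del: One_nat_def)
  from arg_cong[OF this, of "\<lambda>F. fps_nth F n"]
  have "fps_nth ?F n = fps_nth ?comb n / 192"
    unfolding nth_numeral_mult by (simp add: field_simps)
  also have "\<dots> = (123 * real n ^ 5 + 418 * real n ^ 4 + 407 * real n ^ 3 + 56 * real n ^ 2
      - 44 * real n) / 768 * 4 ^ n"
    unfolding nth_numeral_mult fps_add_nth fps_sub_nth series_values
    by (simp add: field_simps power_numeral_reduce)
  finally show ?thesis .
qed

lemma value_defect_square: "fps_nth (config_gf (defect_square_sum)) n = (954 * real n ^ 6
    + 4155 * real n ^ 5 + 6655 * real n ^ 4 + 4815 * real n ^ 3 + 2111 * real n ^ 2
    + 510 * real n) / 15360 * 4 ^ n"
  (is "fps_nth ?F n = _")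
proof -
  have expand: "60 * (defect_square_sum P R) =
    (2 * ((slots P * monomial 0 0 P) * forest_mono 0 0 R)
    + 5 * ((slots P * monomial 0 0 P) * forest_mono 2 0 R)
    + 15 * ((slots P * monomial 0 0 P) * forest_mono 4 0 R)
    + 5 * ((slots P * (slots P * monomial 0 0 P)) * forest_mono 1 0 R)
    + 30 * ((slots P * (slots P * monomial 0 0 P)) * forest_mono 3 0 R)
    + 10 * ((slots P * (slots P * (slots P * monomial 0 0 P))) * forest_mono 2 0 R)
    + 3 * ((slots P * (slots P * (slots P * (slots P * (slots P * monomial 0 0 P))))) * forest_mono 0 0 R)
    + 10 * ((slots P * monomial 1 0 P) * forest_mono 1 0 R)
    + 60 * ((slots P * monomial 1 0 P) * forest_mono 3 0 R)
    + 5 * ((slots P * (slots P * monomial 1 0 P)) * forest_mono 0 0 R)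
    + 90 * ((slots P * (slots P * monomial 1 0 P)) * forest_mono 2 0 R)
    + 20 * ((slots P * (slots P * (slots P * monomial 1 0 P))) * forest_mono 1 0 R)
    + 5 * ((slots P * monomial 2 0 P) * forest_mono 0 0 R)
    + 90 * ((slots P * monomial 2 0 P) * forest_mono 2 0 R)
    + 90 * ((slots P * (slots P * monomial 2 0 P)) * forest_mono 1 0 R)
    + 10 * ((slots P * (slots P * (slots P * monomial 2 0 P))) * forest_mono 0 0 R)
    + 60 * ((slots P * monomial 3 0 P) * forest_mono 1 0 R)
    + 30 * ((slots P * (slots P * monomial 3 0 P)) * forest_mono 0 0 R)
    + 15 * ((slots P * monomial 4 0 P) * forest_mono 0 0 R))
    - (5 * ((slots P * (slots P * (slots P * monomial 0 0 P))) * forest_mono 0 0 R)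
    + 5 * ((slots P * (slots P * (slots P * (slots P * monomial 0 0 P)))) * forest_mono 1 0 R)
    + 5 * ((slots P * (slots P * (slots P * (slots P * monomial 1 0 P)))) * forest_mono 0 0 R))" for P R
    unfolding sixty_defect_square_sum monomial_def forest_mono_def by algebra
  have "60 * ?F =
    (2 * (slot_op (moment 0 0) * odd_moment 0 0)
    + 5 * (slot_op (moment 0 0) * odd_moment 2 0)
    + 15 * (slot_op (moment 0 0) * odd_moment 4 0)
    + 5 * (slot_op (slot_op (moment 0 0)) * odd_moment 1 0)
    + 30 * (slot_op (slot_op (moment 0 0)) * odd_moment 3 0)
    + 10 * (slot_op (slot_op (slot_op (moment 0 0))) * odd_moment 2 0)
    + 3 * (slot_op (slot_op (slot_op (slot_op (slot_op (moment 0 0))))) * odd_moment 0 0)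
    + 10 * (slot_op (moment 1 0) * odd_moment 1 0)
    + 60 * (slot_op (moment 1 0) * odd_moment 3 0)
    + 5 * (slot_op (slot_op (moment 1 0)) * odd_moment 0 0)
    + 90 * (slot_op (slot_op (moment 1 0)) * odd_moment 2 0)
    + 20 * (slot_op (slot_op (slot_op (moment 1 0))) * odd_moment 1 0)
    + 5 * (slot_op (moment 2 0) * odd_moment 0 0)
    + 90 * (slot_op (moment 2 0) * odd_moment 2 0)
    + 90 * (slot_op (slot_op (moment 2 0)) * odd_moment 1 0)
    + 10 * (slot_op (slot_op (slot_op (moment 2 0))) * odd_moment 0 0)
    + 60 * (slot_op (moment 3 0) * odd_moment 1 0)
    + 30 * (slot_op (slot_op (moment 3 0)) * odd_moment 0 0)
    + 15 * (slot_op (moment 4 0) * odd_moment 0 0))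
    - (5 * (slot_op (slot_op (slot_op (moment 0 0))) * odd_moment 0 0)
    + 5 * (slot_op (slot_op (slot_op (slot_op (moment 0 0)))) * odd_moment 1 0)
    + 5 * (slot_op (slot_op (slot_op (slot_op (moment 1 0)))) * odd_moment 0 0))"
    unfolding cons_gf_numeral[symmetric] expand by (simp only: config_gf_expand)
  also have "\<dots> = upoly [:0, 300, 20880, 470400, 5360340, 36939720, 168403560, 533264160, 1202855880,
      1949243520, 2254698240, 1817268480, 969609600, 307722240, 43960320:]"
    by (simp add: moment_values upoly_arith del: One_nat_def)
  finally have "60 * ?F = upoly [:0, 300, 20880, 470400, 5360340, 36939720, 168403560, 533264160,
      1202855880, 1949243520, 2254698240, 1817268480, 969609600, 307722240, 43960320:]" .
  from arg_cong[OF this, of "\<lambda>F. 32 * F"]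
  have "1920 * ?F = (30 * binomial_series 0 + 13200 * binomial_series 2 + 233670 * binomial_series 4
      + 85860 * binomial_series 6) - (405 * binomial_series 1 + 94170 * binomial_series 3
      + 238185 * binomial_series 5)" (is "_ = ?comb")
    by (simp add: binomial_series_polys upoly_arith del: One_nat_def)
  from arg_cong[OF this, of "\<lambda>F. fps_nth F n"]
  have "fps_nth ?F n = fps_nth ?comb n / 1920"
    unfolding nth_numeral_mult by (simp add: field_simps)
  also have "\<dots> = (954 * real n ^ 6 + 4155 * real n ^ 5 + 6655 * real n ^ 4 + 4815 * real n ^ 3
      + 2111 * real n ^ 2 + 510 * real n) / 15360 * 4 ^ n"
    unfolding nth_numeral_mult fps_add_nth fps_sub_nth series_values
    by (simp add: field_simps power_numeral_reduce)
  finally show ?thesis .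
qed

lemma value_torque: "fps_nth (config_gf (\<lambda>P R. (slots P * (torque P)\<^sup>2) * 1)) n = (9 * real n ^ 5
    - 5 * real n ^ 4 - 35 * real n ^ 3 + 5 * real n ^ 2 + 26 * real n) / 7680 * 4 ^ n"
  (is "fps_nth ?F n = _")
proof -
  have "?F = upoly [:0, 0, 0, 8, 124, 840, 3264, 8016, 12900, 13600, 9056, 3456, 576:]"
    by (simp only: cons_gf_prod tree_gf_slots tree_gf_torque_sq forest_gf_moments odd_moment_00) (simp
        add: upoly_arith)
  from arg_cong[OF this, of "\<lambda>F. 64 * F"]
  have "64 * ?F = (binomial_series 1 + 30 * binomial_series 3 + 9 * binomial_series 5)
      - (12 * binomial_series 2 + 28 * binomial_series 4)" (is "_ = ?comb")
    by (simp add: binomial_series_polys upoly_arith del: One_nat_def)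
  from arg_cong[OF this, of "\<lambda>F. fps_nth F n"]
  have "fps_nth ?F n = fps_nth ?comb n / 64"
    unfolding nth_numeral_mult by (simp add: field_simps)
  also have "\<dots> = (9 * real n ^ 5 - 5 * real n ^ 4 - 35 * real n ^ 3 + 5 * real n ^ 2
      + 26 * real n) / 7680 * 4 ^ n"
    unfolding nth_numeral_mult fps_add_nth fps_sub_nth series_values
    by (simp add: field_simps power_numeral_reduce)
  finally show ?thesis .
qed

lemma value_forest_torque: "fps_nth (config_gf (\<lambda>P R. (slots P * 1) * (forest_torque R)\<^sup>2)) n =
    (7 * real n ^ 5 + 25 * real n ^ 4 + 75 * real n ^ 3 - 25 * real n ^ 2 - 82 * real n) / 7680 * 4 ^ n"
  (is "fps_nth ?F n = _")
proof -
  have "4 * ?F = slot_op catalan * (4 * odd_gf (\<lambda>Bs. (forest_torque Bs)\<^sup>2))"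
    by (simp only: cons_gf_prod tree_gf_slots tree_gf_moments) simp
  then have "4 * ?F = upoly [:0, 0, 8, 128, 968, 4496, 13968, 29888, 44144, 44160, 28544, 10752, 1792:]"
    unfolding odd_gf_torque_sq by (simp add: upoly_arith)
  from arg_cong[OF this, of "\<lambda>F. 16 * F"]
  have "64 * ?F = (3 * binomial_series 1 + 14 * binomial_series 3 + 7 * binomial_series 5)
      - (8 * binomial_series 2 + 16 * binomial_series 4)" (is "_ = ?comb")
    by (simp add: binomial_series_polys upoly_arith del: One_nat_def)
  from arg_cong[OF this, of "\<lambda>F. fps_nth F n"]
  have "fps_nth ?F n = fps_nth ?comb n / 64"
    unfolding nth_numeral_mult by (simp add: field_simps)
  also have "\<dots> = (7 * real n ^ 5 + 25 * real n ^ 4 + 75 * real n ^ 3 - 25 * real n ^ 2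
      - 82 * real n) / 7680 * 4 ^ n"
    unfolding nth_numeral_mult fps_add_nth fps_sub_nth series_values
    by (simp add: field_simps power_numeral_reduce)
  finally show ?thesis .
qed

section \<open>Mean and variance\<close>

lemma total_size: "(\<Sum>c\<in>configurations n. config_size n c) = (10 * real n ^ 3 + 27 * real n ^ 2
    + 19 * real n) / 32 * 4 ^ n"
  unfolding sum_size value_weight value_defect by (simp add: field_simps power_numeral_reduce)

lemma total_size_square: "(\<Sum>c\<in>configurations n. (config_size n c)\<^sup>2) = (2434 * real n ^ 6
    + 12787 * real n ^ 5 + 26335 * real n ^ 4 + 25895 * real n ^ 3 + 11671 * real n ^ 2
    + 1518 * real n) / 15360 * 4 ^ n"
  unfolding sum_size_square value_weight_square value_weight_defect value_defect_square value_torque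
    value_forest_torque
  by (simp add: field_simps power_numeral_reduce)

lemma card_configurations: "real (card (configurations n)) = 4 ^ n"
proof -
  have "real (card (configurations n)) = (\<Sum>c\<in>configurations n. 1)" by simp
  also have "\<dots> = fps_nth (config_gf (\<lambda>P R. (slots P * 1) * 1)) n"
    unfolding sum_configurations by (simp add: slots_def add.commute)
  also have "config_gf (\<lambda>P R. (slots P * 1) * 1) = binomial_series 0"
    unfolding binomial_series_poly_0 by (simp only: cons_gf_prod tree_gf_slots tree_gf_moments
        forest_gf_moments odd_moment_00)
      (simp add: upoly_arith)
  finally show ?thesis by (simp add: binomial_series_nth_0)
qed

theorem theorem2:
  fixes n :: nat
  assumes "n \<ge> 1"
  shows "measure_pmf.variance (pmf_of_set (distinct_core_partitions (2 * n + 1) (2 * n + 3)))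
           (\<lambda>xs. real (partition_size xs))
         = 1 / 15360 * (934 * real n ^ 6 + 4687 * real n ^ 5 + 9700 * real n ^ 4
             + 10505 * real n ^ 3 + 6256 * real n ^ 2 + 1518 * real n)"
proof -
  let ?C = "distinct_core_partitions (2 * n + 1) (2 * n + 3)"
  let ?X = "\<lambda>xs. real (partition_size xs)"
  note S = sum_over_cores[OF assms]
  have card: "real (card ?C) = 4 ^ n"
  proof -
    have "real (card ?C) = (\<Sum>xs\<in>?C. 1)" by simp
    also have "\<dots> = (\<Sum>c\<in>configurations n. 1)" by (rule S)
    finally show ?thesis using card_configurations[of n] by simp
  qed
  then have "card ?C \<noteq> 0" by (metis of_nat_0 power_not_zero zero_neq_numeral)
  then have fin: "finite ?C" and ne: "?C \<noteq> {}" by (auto simp: card_eq_0_iff)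
  let ?p = "measure_pmf (pmf_of_set ?C)"
  have int: "integrable ?p f" for f :: "nat list \<Rightarrow> real"
    by (rule integrable_measure_pmf_finite) (simp only: set_pmf_of_set[OF ne fin] fin)
  have E1: "measure_pmf.expectation (pmf_of_set ?C) ?X = (10 * real n ^ 3 + 27 * real n ^ 2
      + 19 * real n) / 32"
    unfolding integral_pmf_of_set[OF ne fin] card using S[of "\<lambda>x. x"] total_size[of n] by simp
  have E2: "measure_pmf.expectation (pmf_of_set ?C) (\<lambda>xs. (?X xs)\<^sup>2) = (2434 * real n ^ 6
      + 12787 * real n ^ 5 + 26335 * real n ^ 4 + 25895 * real n ^ 3 + 11671 * real n ^ 2
      + 1518 * real n) / 15360"
    unfolding integral_pmf_of_set[OF ne fin] card using S[of "\<lambda>x. x\<^sup>2"] total_size_square[of n] by simp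
  have "measure_pmf.variance (pmf_of_set ?C) ?X =
      measure_pmf.expectation (pmf_of_set ?C) (\<lambda>xs. (?X xs)\<^sup>2)
          - (measure_pmf.expectation (pmf_of_set ?C) ?X)\<^sup>2"
    by (rule measure_pmf.variance_eq[OF int int])
  then show ?thesis unfolding E1 E2 by (simp add: field_simps power_numeral_reduce)
qed

end
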